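(* Let $X(\xi,t)$ be a solution on $\mathbb{S}^1\times[0,T]$ of $$\partial_t X=\frac{1}{|\partial_\xi X|}\,\partial_\xi\Big(\frac{\partial_\xi X}{|\partial_\xi X|}\Big)-f(L)\Big(\frac{\partial_\xi X}{|\partial_\xi X|}\Big)^{\perp},\qquad X(\xi,0)=X^0(\xi),$$ such that $X\in C^1([0,T],C^4(\mathbb{S}^1))$, with $K_1(X):=\|X\|_{C^1([0,T],C^4(\mathbb{S}^1))}<\infty$, and such that there are constants $0<C_1<C_2$ with $C_1\le|\partial_\xi X(\xi,t)|\le C_2$ for all $(\xi,t)\in\mathbb{S}^1\times[0,T]$. Then there exists $h_0>0$ such that for all $0<h\le h_0$ (with $h=2\pi/N$) there exists a unique finite difference semi-discrete solution $x_h:\mathcal{G}_h\times[0,T]\to\mathbb{R}^2$, that is, a unique time-dependent grid function satisfying, for $j=1,\dots,N$, $$\dot x_j=\frac{2}{q_j+q_{j+1}}(\tau_{j+1}-\tau_j)-f(l_h)\,\tau_{j+1/2}^{\perp}\quad\text{in }(0,T],\qquad x_j(0)=X^0(\xi_j).$$ Furthermore, $$\sup_{t\in[0,T]}\|X(t)-x_h(t)\|_{H^1_G}\le C h^2,$$ where the constants $h_0$ and $C$ depend on $C_1,C_2,K_1(X),T$ and $f$.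
   Context: $\mathbb{S}^1=[0,2\pi]$ with endpoints identified (all functions on it are $2\pi$-periodic); $(a,b)^\perp:=(-b,a)$; $X:\mathbb{S}^1\times[0,T]\to\mathbb{R}^2$ parametrizes a closed plane curve; $L=L(t)=\int_{\mathbb{S}^1}|\partial_\xi X|\,d\xi$ is its perimeter; $f$ is a given real-valued Lipschitz function of the perimeter (a positive real variable). Grid: for an integer $N\ge2$, $h=2\pi/N$, $\xi_j=jh$ ($j=0,\dots,N$), $\mathcal{G}_h=\{\xi_1,\dots,\xi_N\}$; indices are periodic, $a_j=a_{j\pm N}$. For a grid function $x_h:\mathcal{G}_h\to\mathbb{R}^2$ put $x_j=x_h(\xi_j)$, $q_j=|x_j-x_{j-1}|$, $\tau_j=(x_j-x_{j-1})/q_j$, $\tau_{j+1/2}=\frac{\tau_j+\tau_{j+1}}{|\tau_j+\tau_{j+1}|}$, $l_h=\sum_{j=1}^N q_j$. A dot denotes the time derivative; a solution is understood to be one for which all quantities in the equation are defined. For a grid function $u:\mathcal{G}_h\to\mathbb{R}^2$, $\delta u_j=(u_j-u_{j-1})/h$ and $\|u\|_{H^1_G}=\big(h\sum_{j=1}^N(|u_j|^2+|\delta u_j|^2)\big)^{1/2}$. In $\|X(t)-x_h(t)\|_{H^1_G}$, $X(t)$ is restricted to the grid $\mathcal{G}_h$. *)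

theory Defs
  imports "HOL-Analysis.Analysis"
begin

definition perp :: "real^2 \<Rightarrow> real^2" where
  "perp v = vector [- (v $ 2), v $ 1]"

section \<open>Function spaces\<close>

text \<open>Functions on the circle are \<open>2\<pi>\<close>-periodic functions on the reals.\<close>

definition vderiv :: "(real \<Rightarrow> real^2) \<Rightarrow> real \<Rightarrow> real^2" where
  "vderiv u = (\<lambda>\<xi>. vector_derivative u (at \<xi>))"

definition circle_Ck :: "nat \<Rightarrow> (real \<Rightarrow> real^2) \<Rightarrow> bool" where
  "circle_Ck k u \<longleftrightarrow>
     (\<forall>\<xi>. u (\<xi> + 2 * pi) = u \<xi>) \<and>
     (\<forall>i<k. \<forall>\<xi>. (vderiv ^^ i) u differentiable (at \<xi>)) \<and>
     continuous_on UNIV ((vderiv ^^ k) u)"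

text \<open>The \<open>C\<^sup>k\<close> norm; only meaningful for functions satisfying \<^const>\<open>circle_Ck\<close>,
  for which the suprema are over bounded sets.\<close>

definition Ck_norm :: "nat \<Rightarrow> (real \<Rightarrow> real^2) \<Rightarrow> real" where
  "Ck_norm k u = (\<Sum>i\<le>k. SUP \<xi>\<in>{0..2*pi}. norm ((vderiv ^^ i) u \<xi>))"

text \<open>A space-time function is written \<open>X \<xi> t\<close>. The time derivative is one-sided at the
  end points of \<open>[0,T]\<close>.\<close>

definition time_deriv :: "real \<Rightarrow> (real \<Rightarrow> real \<Rightarrow> real^2) \<Rightarrow> real \<Rightarrow> real \<Rightarrow> real^2" where
  "time_deriv T X \<xi> t = vector_derivative (\<lambda>s. X \<xi> s) (at t within {0..T})"

definition space_deriv :: "(real \<Rightarrow> real \<Rightarrow> real^2) \<Rightarrow> real \<Rightarrow> real \<Rightarrow> real^2" where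
  "space_deriv X \<xi> t = vector_derivative (\<lambda>\<eta>. X \<eta> t) (at \<xi>)"

text \<open>\<open>X \<in> C\<^sup>1([0,T], C\<^sup>k)\<close>: the map \<open>t \<mapsto> X(\<cdot>,t)\<close> into the Banach space \<open>C\<^sup>k\<close> is continuously
  differentiable on \<open>[0,T]\<close>. A derivative in the sense of \<open>C\<^sup>k\<close> is in particular a pointwise
  derivative, so it has to be \<^const>\<open>time_deriv\<close>.\<close>

definition C1_Ck :: "real \<Rightarrow> nat \<Rightarrow> (real \<Rightarrow> real \<Rightarrow> real^2) \<Rightarrow> bool" where
  "C1_Ck T k X \<longleftrightarrow>
     (\<forall>t\<in>{0..T}.
        circle_Ck k (\<lambda>\<xi>. X \<xi> t) \<and>
        circle_Ck k (\<lambda>\<xi>. time_deriv T X \<xi> t) \<and>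
        ((\<lambda>s. Ck_norm k (\<lambda>\<xi>. (X \<xi> s - X \<xi> t) /\<^sub>R (s - t) - time_deriv T X \<xi> t)) \<longlongrightarrow> 0)
          (at t within {0..T}) \<and>
        ((\<lambda>s. Ck_norm k (\<lambda>\<xi>. time_deriv T X \<xi> s - time_deriv T X \<xi> t)) \<longlongrightarrow> 0)
          (at t within {0..T}))"

text \<open>For \<open>X\<close> satisfying \<^const>\<open>C1_Ck\<close> both suprema are over bounded sets, since they are
  suprema of continuous functions of \<open>t\<close> on a compact interval; the norm is then finite.\<close>

definition C1_Ck_norm :: "real \<Rightarrow> nat \<Rightarrow> (real \<Rightarrow> real \<Rightarrow> real^2) \<Rightarrow> real" where
  "C1_Ck_norm T k X =
     (SUP t\<in>{0..T}. Ck_norm k (\<lambda>\<xi>. X \<xi> t)) +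
     (SUP t\<in>{0..T}. Ck_norm k (\<lambda>\<xi>. time_deriv T X \<xi> t))"

section \<open>The curvature flow\<close>

definition perimeter :: "(real \<Rightarrow> real \<Rightarrow> real^2) \<Rightarrow> real \<Rightarrow> real" where
  "perimeter X t = integral {0..2*pi} (\<lambda>\<xi>. norm (space_deriv X \<xi> t))"

definition tangent :: "(real \<Rightarrow> real \<Rightarrow> real^2) \<Rightarrow> real \<Rightarrow> real \<Rightarrow> real^2" where
  "tangent X \<xi> t = space_deriv X \<xi> t /\<^sub>R norm (space_deriv X \<xi> t)"

definition flow_solution ::
  "(real \<Rightarrow> real) \<Rightarrow> real \<Rightarrow> (real \<Rightarrow> real^2) \<Rightarrow> (real \<Rightarrow> real \<Rightarrow> real^2) \<Rightarrow> bool" where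
  "flow_solution f T X0 X \<longleftrightarrow>
     (\<forall>\<xi>. \<forall>t\<in>{0..T}.
        time_deriv T X \<xi> t =
          (1 / norm (space_deriv X \<xi> t)) *\<^sub>R space_deriv (tangent X) \<xi> t
          - f (perimeter X t) *\<^sub>R perp (tangent X \<xi> t)) \<and>
     (\<forall>\<xi>. X \<xi> 0 = X0 \<xi>)"

section \<open>The finite difference scheme\<close>

text \<open>A grid function is represented by its values \<open>u j = u(\<xi>\<^sub>j)\<close> as an \<open>N\<close>-periodic function
  of the index \<open>j\<close>.\<close>

definition mesh :: "nat \<Rightarrow> real" where
  "mesh N = 2 * pi / real N"

definition grid_pt :: "nat \<Rightarrow> int \<Rightarrow> real" where
  "grid_pt N j = of_int j * mesh N"

definition grid_fun :: "nat \<Rightarrow> (int \<Rightarrow> real^2) \<Rightarrow> bool" where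
  "grid_fun N u \<longleftrightarrow> (\<forall>j. u (j + int N) = u j)"

definition seg_len :: "(int \<Rightarrow> real^2) \<Rightarrow> int \<Rightarrow> real" where
  "seg_len x j = norm (x j - x (j - 1))"

definition seg_tan :: "(int \<Rightarrow> real^2) \<Rightarrow> int \<Rightarrow> real^2" where
  "seg_tan x j = (x j - x (j - 1)) /\<^sub>R seg_len x j"

definition mid_tan :: "(int \<Rightarrow> real^2) \<Rightarrow> int \<Rightarrow> real^2" where
  "mid_tan x j = (seg_tan x j + seg_tan x (j + 1)) /\<^sub>R norm (seg_tan x j + seg_tan x (j + 1))"

definition discrete_len :: "nat \<Rightarrow> (int \<Rightarrow> real^2) \<Rightarrow> real" where
  "discrete_len N x = (\<Sum>j=1..int N. seg_len x j)"

text \<open>All denominators occurring in the scheme are nonzero.\<close>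

definition scheme_defined :: "nat \<Rightarrow> (int \<Rightarrow> real^2) \<Rightarrow> bool" where
  "scheme_defined N x \<longleftrightarrow>
     (\<forall>j\<in>{1..int N}. seg_len x j \<noteq> 0 \<and> seg_tan x j + seg_tan x (j + 1) \<noteq> 0)"

definition scheme_rhs :: "(real \<Rightarrow> real) \<Rightarrow> nat \<Rightarrow> (int \<Rightarrow> real^2) \<Rightarrow> int \<Rightarrow> real^2" where
  "scheme_rhs f N x j =
     (2 / (seg_len x j + seg_len x (j + 1))) *\<^sub>R (seg_tan x (j + 1) - seg_tan x j)
     - f (discrete_len N x) *\<^sub>R perp (mid_tan x j)"

text \<open>As the differential equation is only imposed on \<open>(0,T]\<close>, continuity on \<open>[0,T]\<close> is what
  links the solution to its initial value.\<close>

definition scheme_solution ::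
  "(real \<Rightarrow> real) \<Rightarrow> real \<Rightarrow> (real \<Rightarrow> real^2) \<Rightarrow> nat \<Rightarrow> (int \<Rightarrow> real \<Rightarrow> real^2) \<Rightarrow> bool" where
  "scheme_solution f T X0 N x \<longleftrightarrow>
     (\<forall>t\<in>{0..T}. grid_fun N (\<lambda>j. x j t)) \<and>
     (\<forall>j\<in>{1..int N}. continuous_on {0..T} (x j) \<and> x j 0 = X0 (grid_pt N j)) \<and>
     (\<forall>t\<in>{0<..T}.
        scheme_defined N (\<lambda>i. x i t) \<and>
        (\<forall>j\<in>{1..int N}.
           (x j has_vector_derivative scheme_rhs f N (\<lambda>i. x i t) j) (at t within {0..T})))"

definition H1G_norm :: "nat \<Rightarrow> (int \<Rightarrow> real^2) \<Rightarrow> real" where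
  "H1G_norm N u =
     sqrt (mesh N *
       (\<Sum>j=1..int N. (norm (u j))\<^sup>2 + (norm ((u j - u (j - 1)) /\<^sub>R mesh N))\<^sup>2))"

end

theory Submission
  imports Defs "HOL-Probability.Discrete_Topology"
begin

text \<open>
  Let \<open>e\<^sub>j = X(\<xi>\<^sub>j) - x\<^sub>j\<close>, and let \<open>T\<^sub>j, \<tau>\<^sub>j\<close> and \<open>Q\<^sub>j, q\<^sub>j\<close> be the unit tangents and lengths of the edges of
  the exact and the discrete polygon. Multiply the difference of the two equations for the velocities
  by the time derivative of \<open>e\<close> and sum by parts: this gives the time derivative of the tangent
  energy \<open>\<Sum> q\<^sub>j |T\<^sub>j - \<tau>\<^sub>j|\<^sup>2 / 2\<close> plus the dissipation \<open>\<Sum> q\<^sub>j |\<partial>\<^sub>t e\<^sub>j|\<^sup>2\<close>. The velocity of a vertex is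
  orthogonal to \<open>\<tau>\<^sub>j + \<tau>\<^sub>j\<^sub>+\<^sub>1\<close>, so the rate of change of \<open>q\<^sub>j\<close> is an expression in the velocities without
  differences, and the error \<open>\<Sum> (Q\<^sub>j - q\<^sub>j)\<^sup>2 / h\<close> of the lengths can be added to the energy: the
  terms quadratic in \<open>\<partial>\<^sub>t e\<close> that it produces are absorbed by the dissipation as long as
  \<open>|Q\<^sub>j - q\<^sub>j|\<close> is small compared to \<open>h\<close>. Gronwall's inequality bounds the energy by \<open>C h\<^sup>4\<close>. This forces
  the edges of the two polygons to differ by at most \<open>C h\<^sup>5\<^sup>/\<^sup>2\<close>, so that the solution never leaves
  the region where the argument applies. In this region the scheme coincides with a globally
  Lipschitz system, whence existence and uniqueness.

  The residual of the exact solution in the scheme is \<open>O(h\<^sup>2)\<close>, and its tangential part varies by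
  \<open>O(h\<^sup>3)\<close> between neighbouring nodes. Both follow from the odd and even parts of \<open>s \<mapsto> sgn (c + s)\<close>
  and four derivatives of \<open>X\<close>.
\<close>

section \<open>Differential inequalities and Lipschitz differential equations\<close>

text \<open>The flow smooths only in the normal direction. Nothing damps the errors of the edge
  lengths, and the tangent energy alone cannot bound them. Counting powers of h shows what this
  costs: if the tangential residual were only known to be O(h^2) at each node, an edge length could
  drift by O(h^2), a relative error O(h), and the H^1 error would be of first order. The bound
  O(h^3) on the variation of that residual gives the relative error O(h^2), which matches the
  tangents.

  Testing with the time derivative of e, rather than with e, is dictated by the equation for the
  tangent jumps: there the velocity error appears with the positive factor (q_j + q_{j+1})/2. The
  position error is added to the energy for the L^2 part of the norm.

  All constants of the energy estimate are uniform in h, because they come from bounds on edges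
  relative to h. The Lipschitz constants of the truncated system, in contrast, may depend on the
  grid; they serve only existence and uniqueness on a fixed grid.\<close>

lemma gronwall_affine:
  fixes y y' :: "real \<Rightarrow> real"
  assumes "a \<le> b" and cont: "continuous_on {a..b} y"
    and deriv: "\<And>t. a < t \<Longrightarrow> t < b \<Longrightarrow> (y has_real_derivative y' t) (at t)"
    and bound: "\<And>t. a < t \<Longrightarrow> t < b \<Longrightarrow> y' t \<le> C * (y t + m)"
  shows "y b + m \<le> exp (C * (b - a)) * (y a + m)"
proof -
  \<comment> \<open>The source enters as the shift \<open>m\<close> of \<open>y\<close>, so a single
    integrating factor handles it and no division by \<open>C\<close> occurs.\<close>
  define z where "z = (\<lambda>t. exp (- C * (t - a)) * (y t + m))"
  have "z b \<le> z a"
  proof (rule DERIV_nonpos_imp_decreasing_open[OF \<open>a \<le> b\<close>])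
    fix t assume t: "a < t" "t < b"
    have "(z has_real_derivative exp (- C * (t - a)) * (y' t - C * (y t + m))) (at t)"
      unfolding z_def
      by (rule derivative_eq_intros deriv[OF t] refl | simp add: algebra_simps)+
    moreover have "exp (- C * (t - a)) * (y' t - C * (y t + m)) \<le> 0"
      using bound[OF t] by (intro mult_nonneg_nonpos) auto
    ultimately show "\<exists>d. (z has_real_derivative d) (at t) \<and> d \<le> 0" by blast
  next
    show "continuous_on {a..b} z"
      unfolding z_def by (intro continuous_intros cont)
  qed
  then have "exp (C * (b - a)) * z b \<le> exp (C * (b - a)) * z a" by simp
  also have "exp (C * (b - a)) * z b = y b + m"
    by (simp add: z_def mult.assoc[symmetric] mult_exp_exp)
  finally show ?thesis by (simp add: z_def)
qed

text \<open>At the first time where \<open>m\<close> reaches \<open>b\<close> the weak bound holds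
  on the whole interval before, and \<open>step\<close> contradicts equality there.\<close>

lemma continuity_bootstrap:
  fixes m :: "real \<Rightarrow> real"
  assumes cont: "continuous_on {0..T} m" and m0: "m 0 < b"
    and step: "\<And>s. s \<in> {0..T} \<Longrightarrow> \<forall>t\<in>{0..s}. m t \<le> b \<Longrightarrow> m s < b"
  shows "\<forall>t\<in>{0..T}. m t < b"
proof (rule ccontr)
  assume "\<not> ?thesis"
  then obtain t1 where t1: "t1 \<in> {0..T}" "b \<le> m t1" by (auto simp: not_less)
  define S where "S = {t\<in>{0..T}. b \<le> m t}"
  have "closed S"
    unfolding S_def using continuous_on_closed_Collect_le[OF continuous_on_const cont] by simp
  have bb: "bdd_below S" and ne: "S \<noteq> {}" using t1 by (auto simp: S_def)
  define s where "s = Inf S"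
  have s: "s \<in> S" unfolding s_def by (rule closed_contains_Inf[OF ne bb \<open>closed S\<close>])
  have min: "s \<le> t" if "t \<in> S" for t unfolding s_def by (rule cInf_lower[OF that bb])
  \<comment> \<open>Membership in \<open>S\<close> gives only \<open>b \<le> m s\<close>; the
    intermediate value theorem and the minimality of \<open>s\<close> yield equality, so the weak
    bound also holds at \<open>s\<close> itself.\<close>
  have "\<exists>t\<ge>0. t \<le> s \<and> m t = b"
    using s m0 by (intro IVT') (auto simp: S_def intro: continuous_on_subset[OF cont])
  then obtain t where t: "0 \<le> t" "t \<le> s" "m t = b" by auto
  have "t \<in> S" using t s by (auto simp: S_def)
  then have "t = s" using min t by force
  then have "\<forall>r\<in>{0..s}. m r \<le> b"
    using min t s by (force simp: S_def not_le[symmetric])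
  with step[of s] s have "m s < b" by (auto simp: S_def)
  with s show False by (auto simp: S_def)
qed

lemma exp_has_integral:
  fixes K t :: real assumes "0 < K" "0 \<le> t"
  shows "((\<lambda>s. exp (K * s)) has_integral (exp (K * t) - 1) / K) {0..t}"
proof -
  have "((\<lambda>s. exp (K * s)) has_integral (exp (K * t) / K - exp (K * 0) / K)) {0..t}"
    using assms by (intro fundamental_theorem_of_calculus)
      (auto intro!: derivative_eq_intros simp flip: has_real_derivative_iff_has_vector_derivative)
  then show ?thesis using assms by (simp add: diff_divide_distrib)
qed

text \<open>The unknown is \<open>y t = exp (- 2 * L * t) *\<^sub>R x t\<close>: with this exponential weight the
  Picard map contracts on the whole interval by the factor \<open>1/2\<close>.\<close>

lemma lipschitz_ode_solution:
  fixes F :: "'a::banach \<Rightarrow> 'a"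
  assumes lip: "\<And>x y. norm (F x - F y) \<le> L * norm (x - y)" and "L > 0" "T \<ge> 0"
  obtains x where "x 0 = x0"
    and "\<And>t. t \<in> {0..T} \<Longrightarrow> (x has_vector_derivative F (x t)) (at t within {0..T})"
proof -
  \<comment> \<open>Precomposing with the projection onto \<open>{0..T}\<close> makes the Picard
    iterates bounded continuous functions on the whole line, where the supremum metric is
    complete.\<close>
  define cl where "cl = (\<lambda>t. max 0 (min T t))"
  have cl: "cl t \<in> {0..T}" for t using assms by (auto simp: cl_def)
  have cl_id: "cl t = t" if "t \<in> {0..T}" for t using that by (auto simp: cl_def)
  have contcl: "continuous_on UNIV cl" unfolding cl_def by (intro continuous_intros)
  have contF: "continuous_on UNIV F"
    by (intro lipschitz_on_continuous_on[of L] lipschitz_onI)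
       (use lip \<open>L > 0\<close> in \<open>auto simp: dist_norm\<close>)
  define G where "G = (\<lambda>(y :: real \<Rightarrow>\<^sub>C 'a) s. F (exp (2 * L * s) *\<^sub>R apply_bcontfun y s))"
  have contG: "continuous_on S (G y)" for S y
    unfolding G_def
    by (intro continuous_on_compose2[OF contF] continuous_intros) auto
  define P where "P = (\<lambda>(y :: real \<Rightarrow>\<^sub>C 'a) t. exp (- 2 * L * t) *\<^sub>R (x0 + integral {0..t} (G y)))"
  have dI: "((\<lambda>t. integral {0..t} (G y)) has_vector_derivative G y t) (at t within {0..T})"
    if "t \<in> {0..T}" for y t
    by (rule integral_has_vector_derivative[OF contG that])
  have contP: "continuous_on {0..T} (P y)" for y
  proof -
    have "continuous_on {0..T} (\<lambda>t. integral {0..t} (G y))"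
      by (rule continuous_on_vector_derivative[OF dI])
    then show ?thesis unfolding P_def by (intro continuous_intros)
  qed
  define \<Phi> where "\<Phi> = (\<lambda>y. Bcontfun (\<lambda>t. P y (cl t)))"
  have inb: "(\<lambda>t. P y (cl t)) \<in> bcontfun" for y
  proof -
    have "continuous_on UNIV (\<lambda>t. P y (cl t))"
      by (rule continuous_on_compose2[OF contP contcl]) (use cl in auto)
    moreover have "bounded (P y ` {0..T})"
      by (intro compact_imp_bounded compact_continuous_image contP) auto
    then have "bounded (range (\<lambda>t. P y (cl t)))"
      by (rule bounded_subset) (use cl in auto)
    ultimately show ?thesis by (simp add: bcontfun_def)
  qed
  have app: "apply_bcontfun (\<Phi> y) t = P y (cl t)" for y t
    unfolding \<Phi>_def by (simp add: Bcontfun_inverse[OF inb])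
  have "\<exists>!y. \<Phi> y = y"
  proof (rule banach_fix_type[of "1/2"]; clarsimp?)
    fix y z :: "real \<Rightarrow>\<^sub>C 'a"
    have "dist (apply_bcontfun (\<Phi> y) t) (apply_bcontfun (\<Phi> z) t) \<le> dist y z / 2" for t
    proof -
      define s where "s = cl t"
      have s: "0 \<le> s" using cl[of t] by (auto simp: s_def)
      have int: "G w integrable_on {0..s}" for w by (rule integrable_continuous_real[OF contG])
      have "norm (integral {0..s} (G y) - integral {0..s} (G z))
          = norm (integral {0..s} (\<lambda>r. G y r - G z r))"
        by (simp add: integral_diff[OF int int])
      also have "\<dots> \<le> integral {0..s} (\<lambda>r. (L * dist y z) * exp (2 * L * r))"
      proof (rule integral_norm_bound_integral)
        show "(\<lambda>r. G y r - G z r) integrable_on {0..s}" by (intro integrable_diff int)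
        show "(\<lambda>r. (L * dist y z) * exp (2 * L * r)) integrable_on {0..s}"
          by (intro integrable_continuous_real continuous_intros)
        fix r assume "r \<in> {0..s}"
        have "norm (G y r - G z r) \<le> L * norm (exp (2 * L * r) *\<^sub>R (apply_bcontfun y r - apply_bcontfun z r))"
          unfolding G_def using lip by (simp add: scaleR_diff_right)
        also have "\<dots> \<le> L * (exp (2 * L * r) * dist y z)"
          using dist_bounded[of y r z] \<open>L > 0\<close> by (simp add: dist_norm)
        finally show "norm (G y r - G z r) \<le> (L * dist y z) * exp (2 * L * r)"
          by (simp add: algebra_simps)
      qed
      also have "\<dots> = (L * dist y z) * ((exp (2 * L * s) - 1) / (2 * L))"
        using has_integral_mult_right[OF exp_has_integral[of "2 * L" s], of "L * dist y z"] s \<open>L > 0\<close>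
        by (intro integral_unique) auto
      also have "\<dots> \<le> dist y z / 2 * exp (2 * L * s)"
        using \<open>L > 0\<close> by (simp add: field_simps)
      finally have *: "norm (integral {0..s} (G y) - integral {0..s} (G z)) \<le> dist y z / 2 * exp (2 * L * s)" .
      have "dist (P y s) (P z s) = exp (- 2 * L * s) * norm (integral {0..s} (G y) - integral {0..s} (G z))"
        unfolding P_def dist_norm scaleR_diff_right[symmetric] norm_scaleR by simp
      also have "\<dots> \<le> exp (- 2 * L * s) * (dist y z / 2 * exp (2 * L * s))"
        using * by (intro mult_left_mono) auto
      also have "\<dots> = dist y z / 2" by (simp add: exp_minus)
      finally show ?thesis by (simp add: app s_def)
    qed
    then show "dist (\<Phi> y) (\<Phi> z) * 2 \<le> dist y z" using dist_bound[of "\<Phi> y" "\<Phi> z"] by fastforce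
  qed
  then obtain y where y: "\<Phi> y = y" by blast
  define x where "x = (\<lambda>t. x0 + integral {0..t} (G y))"
  have "G y t = F (x t)" if "t \<in> {0..T}" for t
  proof -
    have "apply_bcontfun y t = P y t" using app[of y t] y cl_id[OF that] by simp
    then show ?thesis by (simp add: G_def P_def x_def exp_minus)
  qed
  then have "(x has_vector_derivative F (x t)) (at t within {0..T})" if "t \<in> {0..T}" for t
    unfolding x_def using dI[OF that, of y] that
    by (auto intro!: derivative_eq_intros simp: x_def)
  moreover have "x 0 = x0" by (simp add: x_def)
  ultimately show thesis using that by blast
qed

section \<open>Differences of unit vectors and of smooth functions\<close>

lemma abs_divide_le:
  fixes n d a b :: real
  assumes "\<bar>n\<bar> \<le> a" "b \<le> d" "0 < b"
  shows "\<bar>n / d\<bar> \<le> a / b"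
  using assms by (simp add: frac_le)

lemma norm_sgn_le: "norm (sgn (a :: 'a::real_normed_vector)) \<le> 1"
  by (simp add: norm_sgn)

lemma abs_inverse_diff:
  fixes a b :: "'a::real_normed_vector"
  assumes "a \<noteq> 0" "b \<noteq> 0"
  shows "\<bar>inverse (norm a) - inverse (norm b)\<bar> = \<bar>norm b - norm a\<bar> / (norm a * norm b)"
proof -
  have "inverse (norm a) - inverse (norm b) = (norm b - norm a) / (norm a * norm b)"
    using assms by (simp add: field_simps)
  then show ?thesis by (simp add: abs_mult)
qed

text \<open>Only \<open>a\<close> needs a lower bound: if \<open>a\<close> belongs to the exact
  curve, nothing has to be known about the perturbed vector \<open>b\<close>, which may even
  vanish.\<close>

lemma norm_sgn_diff_le:
  fixes a b :: "'a::real_normed_vector"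
  assumes "a \<noteq> 0"
  shows "norm (sgn a - sgn b) \<le> 2 * norm (a - b) / norm a"
proof (cases "b = 0")
  case True with assms show ?thesis by (simp add: norm_sgn)
next
  case False
  have "sgn a - sgn b = (a - b) /\<^sub>R norm a + (inverse (norm a) - inverse (norm b)) *\<^sub>R b"
    by (simp add: sgn_div_norm algebra_simps)
  then have "norm (sgn a - sgn b) \<le> norm (a - b) / norm a + \<bar>inverse (norm a) - inverse (norm b)\<bar> * norm b"
    by (metis norm_triangle_ineq norm_scaleR divide_inverse mult.commute abs_inverse abs_norm_cancel)
  also have "\<bar>inverse (norm a) - inverse (norm b)\<bar> * norm b = \<bar>norm b - norm a\<bar> / norm a"
    unfolding abs_inverse_diff[OF assms False] using False by simp
  also have "\<dots> \<le> norm (a - b) / norm a"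
    using norm_triangle_ineq3[of b a] by (intro divide_right_mono) (auto simp: norm_minus_commute)
  finally show ?thesis by simp
qed

text \<open>The derivative of \<open>sgn\<close> at \<open>c\<close> in direction \<open>s\<close>:
  the projection of \<open>s\<close> onto the orthogonal complement of \<open>c\<close>, divided by
  the norm of \<open>c\<close>; see \<open>has_vector_derivative_sgn\<close>.\<close>

definition dsgn :: "'a::real_inner \<Rightarrow> 'a \<Rightarrow> 'a" where
  "dsgn c s = (s - (sgn c \<bullet> s) *\<^sub>R sgn c) /\<^sub>R norm c"

lemma sgn_inner_self: "sgn y \<bullet> y = norm (y :: 'a::real_inner)"
  by (cases "y = 0") (simp_all add: sgn_div_norm power2_eq_square flip: power2_norm_eq_inner)

lemma abs_inner_sgn_le: "\<bar>sgn c \<bullet> s\<bar> \<le> norm s"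
proof -
  have "\<bar>sgn c \<bullet> s\<bar> \<le> norm (sgn c) * norm s" by (rule Cauchy_Schwarz_ineq2)
  also have "\<dots> \<le> 1 * norm s" by (intro mult_right_mono norm_sgn_le) simp
  finally show ?thesis by simp
qed

lemma norm_dsgn_numerator_le: "norm (s - (sgn c \<bullet> s) *\<^sub>R sgn c) \<le> 2 * norm s"
proof -
  have "norm ((sgn c \<bullet> s) *\<^sub>R sgn c) \<le> norm s * 1"
    unfolding norm_scaleR by (intro mult_mono norm_sgn_le abs_inner_sgn_le) auto
  then show ?thesis by (intro norm_triangle_le_diff) simp
qed

lemma norm_dsgn_le: "norm (dsgn c s) \<le> 2 * norm s / norm c"
  using norm_dsgn_numerator_le[of s c]
  by (simp add: dsgn_def divide_inverse mult.commute mult_left_mono)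

lemma dsgn_diff: "dsgn c s - dsgn c r = dsgn c (s - r)"
  by (simp add: dsgn_def inner_diff_right algebra_simps)

lemma dsgn_scale: "dsgn c (k *\<^sub>R s) = k *\<^sub>R dsgn c s"
  by (simp add: dsgn_def algebra_simps)

lemma norm_dsgn_diff_le:
  fixes b c :: "'a::real_inner"
  assumes b: "b \<noteq> 0" and c: "c \<noteq> 0"
  shows "norm (dsgn c s - dsgn b s) \<le> 6 * norm (c - b) * norm s / (norm c * norm b)"
proof -
  note ineq = abs_inner_sgn_le[of _ s]
  define v where "v = s - (sgn b \<bullet> s) *\<^sub>R sgn b"
  define d where "d = norm (c - b)"
  have v: "norm v \<le> 2 * norm s" unfolding v_def by (rule norm_dsgn_numerator_le)
  have sd: "norm (sgn c - sgn b) \<le> 2 * d / norm b"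
    using norm_sgn_diff_le[OF b, of c] by (simp add: d_def norm_minus_commute)
  \<comment> \<open>Telescoping: the base point is changed once in each of the two factors
    \<open>sgn c\<close> and once in the reciprocal norm. Each change costs
    \<open>2 * norm (c - b) * norm s / (norm c * norm b)\<close>, hence the factor 6.\<close>
  have "dsgn c s - dsgn b s =
      inverse (norm c) *\<^sub>R (((sgn b - sgn c) \<bullet> s) *\<^sub>R sgn b + (sgn c \<bullet> s) *\<^sub>R (sgn b - sgn c))
      + (inverse (norm c) - inverse (norm b)) *\<^sub>R v"
    by (simp add: dsgn_def v_def algebra_simps inner_diff_left)
  also have "norm \<dots> \<le> inverse (norm c) * (2 * d / norm b * norm s * 1 + norm s * (2 * d / norm b))
      + d / (norm c * norm b) * (2 * norm s)"
  proof (intro norm_triangle_mono)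
    have "norm (((sgn b - sgn c) \<bullet> s) *\<^sub>R sgn b + (sgn c \<bullet> s) *\<^sub>R (sgn b - sgn c))
      \<le> 2 * d / norm b * norm s * 1 + norm s * (2 * d / norm b)"
    proof (intro norm_triangle_mono)
      have "\<bar>(sgn b - sgn c) \<bullet> s\<bar> \<le> norm (sgn b - sgn c) * norm s" by (rule Cauchy_Schwarz_ineq2)
      also have "\<dots> \<le> 2 * d / norm b * norm s"
        using sd by (intro mult_right_mono) (auto simp: norm_minus_commute)
      finally show "norm (((sgn b - sgn c) \<bullet> s) *\<^sub>R sgn b) \<le> 2 * d / norm b * norm s * 1"
        unfolding norm_scaleR by (intro mult_mono norm_sgn_le) (auto simp: d_def)
      show "norm ((sgn c \<bullet> s) *\<^sub>R (sgn b - sgn c)) \<le> norm s * (2 * d / norm b)"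
        unfolding norm_scaleR using sd ineq[of c] by (intro mult_mono) (auto simp: norm_minus_commute)
    qed
    then show "norm (inverse (norm c) *\<^sub>R (((sgn b - sgn c) \<bullet> s) *\<^sub>R sgn b + (sgn c \<bullet> s) *\<^sub>R (sgn b - sgn c)))
      \<le> inverse (norm c) * (2 * d / norm b * norm s * 1 + norm s * (2 * d / norm b))"
      unfolding norm_scaleR abs_inverse abs_norm_cancel by (rule mult_left_mono) simp
    have "\<bar>inverse (norm c) - inverse (norm b)\<bar> = \<bar>norm b - norm c\<bar> / (norm c * norm b)"
      by (rule abs_inverse_diff[OF c b])
    also have "\<dots> \<le> d / (norm c * norm b)"
      using norm_triangle_ineq3[of b c]
      by (intro divide_right_mono) (auto simp: d_def norm_minus_commute)
    finally show "norm ((inverse (norm c) - inverse (norm b)) *\<^sub>R v) \<le> d / (norm c * norm b) * (2 * norm s)"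
      unfolding norm_scaleR using v by (intro mult_mono) (auto simp: d_def)
  qed
  also have "\<dots> = 6 * d * norm s / (norm c * norm b)" using b c by (simp add: field_simps)
  finally show ?thesis by (simp add: d_def)
qed

section \<open>Even and odd parts of \<open>sgn\<close> about a point\<close>

context
  fixes c s :: "'a::real_inner"
  assumes c: "c \<noteq> 0" and s: "norm s \<le> norm c / 2"
begin

text \<open>Everything comes from the parallelogram law and the bound \<open>2 * norm s\<close> for
  the difference of the two norms: sum and product of the norms of \<open>c + s\<close> and
  \<open>c - s\<close> have no term of first order in \<open>s\<close>. Later \<open>c + s\<close>
  and \<open>c - s\<close> are mostly a forward and a backward difference quotient.\<close>

lemma norm_sum_sym: "2 * norm c \<le> norm (c + s) + norm (c - s)"
  and norm_sum_sym_le: "norm (c + s) + norm (c - s) \<le> 2 * norm c + (norm s)\<^sup>2 / norm c"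
  and norm_prod_sym: "\<bar>norm (c + s) * norm (c - s) - (norm c)\<^sup>2\<bar> \<le> (norm s)\<^sup>2"
  and norm_prod_sym_ge: "(norm c)\<^sup>2 / 2 \<le> norm (c + s) * norm (c - s)"
proof -
  let ?p = "norm (c + s)" and ?m = "norm (c - s)" and ?R = "norm c" and ?k = "norm s"
  have R: "?R > 0" using c by simp
  have "2 *\<^sub>R c = (c + s) + (c - s)" by (simp add: scaleR_2)
  then have "norm (2 *\<^sub>R c) \<le> ?p + ?m" by (metis norm_triangle_ineq)
  then show 1: "2 * ?R \<le> ?p + ?m" by simp
  have sq: "?p\<^sup>2 + ?m\<^sup>2 = 2 * ?R\<^sup>2 + 2 * ?k\<^sup>2"
    by (simp add: power2_norm_eq_inner inner_add_left inner_add_right inner_diff_left inner_diff_right inner_commute)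
  have d: "(?p - ?m)\<^sup>2 \<le> (2 * ?k)\<^sup>2"
  proof -
    have "\<bar>?p - ?m\<bar> \<le> norm ((c + s) - (c - s))" by (rule norm_triangle_ineq3)
    also have "(c + s) - (c - s) = 2 *\<^sub>R s" by (simp add: scaleR_2)
    finally show ?thesis by (intro abs_le_square_iff[THEN iffD1]) simp
  qed
  have pm: "4 * (?p * ?m) = (?p + ?m)\<^sup>2 - (?p - ?m)\<^sup>2" by (simp add: power2_eq_square algebra_simps)
  have sum: "(?p + ?m)\<^sup>2 = 4 * ?R\<^sup>2 + 4 * ?k\<^sup>2 - (?p - ?m)\<^sup>2"
    using sq by (simp add: power2_eq_square algebra_simps)
  have lo: "4 * ?R\<^sup>2 \<le> (?p + ?m)\<^sup>2" using power_mono[OF 1, of 2] by (simp add: power_mult_distrib)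
  have "(?p - ?m)\<^sup>2 \<ge> 0" by simp
  then have hi: "(?p + ?m)\<^sup>2 \<le> 4 * ?R\<^sup>2 + 4 * ?k\<^sup>2" using sum by linarith
  also have "\<dots> \<le> (2 * ?R + ?k\<^sup>2 / ?R)\<^sup>2"
  proof -
    have "(2 * ?R + ?k\<^sup>2 / ?R)\<^sup>2 = 4 * ?R\<^sup>2 + 4 * ?k\<^sup>2 + (?k\<^sup>2 / ?R)\<^sup>2"
      using R by (simp add: power2_sum power_mult_distrib)
    then show ?thesis by simp
  qed
  finally show "?p + ?m \<le> 2 * ?R + ?k\<^sup>2 / ?R"
    by (rule power2_le_imp_le) simp
  have four: "(2::real)\<^sup>2 = 4" by simp
  show 3: "\<bar>?p * ?m - ?R\<^sup>2\<bar> \<le> ?k\<^sup>2"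
    using pm lo hi d \<open>(?p - ?m)\<^sup>2 \<ge> 0\<close> unfolding abs_le_iff power_mult_distrib four
    by (intro conjI; linarith)
  have "?k\<^sup>2 \<le> (?R / 2)\<^sup>2" by (intro power_mono s) simp
  then show "?R\<^sup>2 / 2 \<le> ?p * ?m" using 3 zero_le_power2[of ?R] by (simp add: power_divide abs_le_iff)
qed

lemma norm_sym_pos: "0 < norm (c + s)" "0 < norm (c - s)"
  using norm_prod_sym_ge c by (smt (verit) mult_eq_0_iff half_gt_zero norm_ge_zero zero_less_norm_iff zero_less_power)+

text \<open>Over a common denominator, \<open>norm c\<close> times the sum of the two norms and
  twice their product both equal \<open>2 * (norm c)\<^sup>2\<close>, up to one and two times
  \<open>(norm s)\<^sup>2\<close>. The denominator is at least half the cube of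
  \<open>norm c\<close>, which gives 3 / (1/2) = 6.\<close>

lemma inverse_norm_sym:
  "\<bar>1 / norm (c + s) + 1 / norm (c - s) - 2 / norm c\<bar> \<le> 6 * (norm s)\<^sup>2 / norm c ^ 3"
proof -
  let ?p = "norm (c + s)" and ?m = "norm (c - s)" and ?R = "norm c" and ?k = "norm s"
  have R: "?R > 0" using c by simp
  have "1 / ?p + 1 / ?m - 2 / ?R = (?R * (?p + ?m) - 2 * (?p * ?m)) / (?p * ?m * ?R)"
    using norm_sym_pos R by (simp add: field_simps)
  also have "\<bar>\<dots>\<bar> \<le> (3 * ?k\<^sup>2) / (?R\<^sup>2 / 2 * ?R)"
  proof (rule abs_divide_le)
    have "?R * (?p + ?m) \<le> ?R * (2 * ?R + ?k\<^sup>2 / ?R)" "?R * (2 * ?R) \<le> ?R * (?p + ?m)"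
      using norm_sum_sym norm_sum_sym_le R by (auto intro!: mult_left_mono)
    then have "?R * (?p + ?m) \<le> 2 * ?R\<^sup>2 + ?k\<^sup>2" "2 * ?R\<^sup>2 \<le> ?R * (?p + ?m)"
      using R by (auto simp: distrib_left power2_eq_square)
    then show "\<bar>?R * (?p + ?m) - 2 * (?p * ?m)\<bar> \<le> 3 * ?k\<^sup>2"
      using norm_prod_sym zero_le_power2[of ?k] unfolding abs_le_iff by linarith
    show "?R\<^sup>2 / 2 * ?R \<le> ?p * ?m * ?R" using norm_prod_sym_ge by (intro mult_right_mono) auto
    show "0 < ?R\<^sup>2 / 2 * ?R" using R by simp
  qed
  finally show ?thesis by (simp add: power2_eq_square power3_eq_cube)
qed

lemma sgn_even_part:
  "norm (sgn (c + s) + sgn (c - s) - 2 *\<^sub>R sgn c) \<le> 10 * (norm s)\<^sup>2 / (norm c)\<^sup>2"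
proof -
  let ?p = "norm (c + s)" and ?m = "norm (c - s)" and ?R = "norm c" and ?k = "norm s"
  have R: "?R > 0" using c by simp
  have "sgn (c + s) + sgn (c - s) - 2 *\<^sub>R sgn c
      = (1 / ?p + 1 / ?m - 2 / ?R) *\<^sub>R c + (1 / ?p - 1 / ?m) *\<^sub>R s"
    by (simp add: sgn_div_norm algebra_simps divide_inverse)
  also have "norm \<dots> \<le> 6 * ?k\<^sup>2 / ?R ^ 3 * ?R + (2 * ?k) / (?R\<^sup>2 / 2) * ?k"
  proof (intro norm_triangle_mono)
    show "norm ((1 / ?p + 1 / ?m - 2 / ?R) *\<^sub>R c) \<le> 6 * ?k\<^sup>2 / ?R ^ 3 * ?R"
      unfolding norm_scaleR using inverse_norm_sym by (intro mult_right_mono) auto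
    have "1 / ?p - 1 / ?m = (?m - ?p) / (?p * ?m)" using norm_sym_pos by (simp add: field_simps)
    also have "\<bar>\<dots>\<bar> \<le> (2 * ?k) / (?R\<^sup>2 / 2)"
    proof (rule abs_divide_le)
      have "\<bar>?m - ?p\<bar> \<le> norm ((c - s) - (c + s))" by (rule norm_triangle_ineq3)
      also have "(c - s) - (c + s) = - (2 *\<^sub>R s)" by (simp add: scaleR_2)
      finally show "\<bar>?m - ?p\<bar> \<le> 2 * ?k" by simp
    qed (use R norm_prod_sym_ge in auto)
    finally show "norm ((1 / ?p - 1 / ?m) *\<^sub>R s) \<le> (2 * ?k) / (?R\<^sup>2 / 2) * ?k"
      unfolding norm_scaleR by (intro mult_right_mono) auto
  qed
  also have "\<dots> = 10 * ?k\<^sup>2 / ?R\<^sup>2" using R by (simp add: field_simps power2_eq_square power3_eq_cube)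
  finally show ?thesis .
qed

lemma sgn_odd_part:
  "norm (sgn (c + s) - sgn (c - s) - 2 *\<^sub>R dsgn c s) \<le> 14 * (norm s) ^ 3 / (norm c) ^ 3"
proof -
  let ?p = "norm (c + s)" and ?m = "norm (c - s)" and ?R = "norm c" and ?k = "norm s"
  have R: "?R > 0" using c by simp
  \<comment> \<open>Multiplying by the sum of the norms turns \<open>1 / ?p - 1 / ?m\<close> into an
    exact multiple of \<open>c \<bullet> s\<close>. What remains is the error \<open>b\<close> of
    replacing \<open>?p * ?m * (?p + ?m)\<close> by \<open>2 * ?R ^ 3\<close>, which is of second
    order in \<open>s\<close> by the symmetry.\<close>
  define b where "b = 2 / ?R ^ 3 - 4 / (?p * ?m * (?p + ?m))"
  have "?m\<^sup>2 - ?p\<^sup>2 = - 4 * (c \<bullet> s)"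
    by (simp add: power2_norm_eq_inner inner_add_left inner_add_right inner_diff_left inner_diff_right inner_commute)
  then have "(?m - ?p) * (?p + ?m) = - 4 * (c \<bullet> s)" by (simp add: power2_eq_square algebra_simps)
  then have mp: "1 / ?p - 1 / ?m = - 4 * (c \<bullet> s) / (?p * ?m * (?p + ?m))"
  proof -
    have "1 / a - 1 / b = (b - a) * (a + b) / (a * b * (a + b))" if "a > 0" "b > 0" for a b :: real
    proof -
      have "a + b \<noteq> 0" using that by linarith
      then show ?thesis using that by (simp add: diff_frac_eq)
    qed
    from this[OF norm_sym_pos]
    have "1 / ?p - 1 / ?m = (?m - ?p) * (?p + ?m) / (?p * ?m * (?p + ?m))" .
    then show ?thesis unfolding \<open>(?m - ?p) * (?p + ?m) = - 4 * (c \<bullet> s)\<close> .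
  qed
  have dd: "dsgn c s = (1 / ?R) *\<^sub>R s - ((c \<bullet> s) / ?R ^ 3) *\<^sub>R c"
    by (simp add: dsgn_def sgn_div_norm divide_inverse power3_eq_cube algebra_simps)
  have "sgn (c + s) - sgn (c - s) - 2 *\<^sub>R dsgn c s
      = ((1 / ?p - 1 / ?m) + (c \<bullet> s) * (2 / ?R ^ 3)) *\<^sub>R c + (1 / ?p + 1 / ?m - 2 / ?R) *\<^sub>R s"
    unfolding dd by (simp add: sgn_div_norm algebra_simps divide_inverse)
  also have "(1 / ?p - 1 / ?m) + (c \<bullet> s) * (2 / ?R ^ 3) = (c \<bullet> s) * b"
    unfolding mp b_def by (simp add: algebra_simps)
  also have "norm (((c \<bullet> s) * b) *\<^sub>R c + (1 / ?p + 1 / ?m - 2 / ?R) *\<^sub>R s)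
      \<le> (?R * ?k) * (8 * ?k\<^sup>2 / ?R ^ 5) * ?R + 6 * ?k\<^sup>2 / ?R ^ 3 * ?k"
  proof (intro norm_triangle_mono)
    show "norm ((1 / ?p + 1 / ?m - 2 / ?R) *\<^sub>R s) \<le> 6 * ?k\<^sup>2 / ?R ^ 3 * ?k"
      unfolding norm_scaleR using inverse_norm_sym by (intro mult_right_mono) auto
    have "b = (2 * (?p * ?m * (?p + ?m)) - 4 * ?R ^ 3) / (?R ^ 3 * (?p * ?m * (?p + ?m)))"
    proof -
      have "2 / x - 4 / y = (2 * y - 4 * x) / (x * y)" if "x > 0" "y > 0" for x y :: real
        using that by (simp add: diff_frac_eq)
      then show ?thesis unfolding b_def using R norm_sym_pos by (simp add: add_pos_pos)
    qed
    also have "\<bar>\<dots>\<bar> \<le> (8 * ?R * ?k\<^sup>2) / (?R ^ 3 * (?R\<^sup>2 / 2 * (2 * ?R)))"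
    proof (rule abs_divide_le)
      have "?k \<le> ?R" using s R by linarith
      then have "?k\<^sup>2 \<le> ?R\<^sup>2" by (intro power_mono) auto
      have "?p * ?m * (?p + ?m) \<le> (?R\<^sup>2 + ?k\<^sup>2) * (2 * ?R + ?k\<^sup>2 / ?R)"
        using norm_sum_sym_le norm_prod_sym by (intro mult_mono) auto
      also have "\<dots> = 2 * ?R ^ 3 + 3 * ?R * ?k\<^sup>2 + ?k\<^sup>2 * ?k\<^sup>2 / ?R"
        using R by (simp add: field_simps power2_eq_square power3_eq_cube)
      also have "?k\<^sup>2 * ?k\<^sup>2 / ?R \<le> ?R\<^sup>2 * ?k\<^sup>2 / ?R"
        using \<open>?k\<^sup>2 \<le> ?R\<^sup>2\<close> by (intro divide_right_mono mult_right_mono) auto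
      also have "\<dots> = ?R * ?k\<^sup>2" using R by (simp add: power2_eq_square)
      finally have 1: "?p * ?m * (?p + ?m) \<le> 2 * ?R ^ 3 + 4 * ?R * ?k\<^sup>2" by simp
      have "(?R\<^sup>2 - ?k\<^sup>2) * (2 * ?R) \<le> ?p * ?m * (?p + ?m)"
        using norm_sum_sym norm_prod_sym \<open>?k\<^sup>2 \<le> ?R\<^sup>2\<close> R by (intro mult_mono) auto
      then have 2: "2 * ?R ^ 3 - 2 * ?R * ?k\<^sup>2 \<le> ?p * ?m * (?p + ?m)"
        by (simp add: algebra_simps power2_eq_square power3_eq_cube)
      have "0 \<le> ?R * ?k\<^sup>2" by simp
      then show "\<bar>2 * (?p * ?m * (?p + ?m)) - 4 * ?R ^ 3\<bar> \<le> 8 * ?R * ?k\<^sup>2"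
        using 1 2 unfolding abs_le_iff by linarith
      show "?R ^ 3 * (?R\<^sup>2 / 2 * (2 * ?R)) \<le> ?R ^ 3 * (?p * ?m * (?p + ?m))"
        using norm_sum_sym norm_prod_sym_ge by (intro mult_mono) auto
    qed (use R in auto)
    also have "\<dots> = 8 * ?k\<^sup>2 / ?R ^ 5" using R by (simp add: field_simps eval_nat_numeral)
    finally show "norm (((c \<bullet> s) * b) *\<^sub>R c) \<le> (?R * ?k) * (8 * ?k\<^sup>2 / ?R ^ 5) * ?R"
      unfolding norm_scaleR abs_mult using Cauchy_Schwarz_ineq2[of c s] by (intro mult_mono) auto
  qed
  also have "\<dots> = 14 * ?k ^ 3 / ?R ^ 3" using R by (simp add: field_simps eval_nat_numeral)
  finally show ?thesis .
qed

end

section \<open>Taylor remainders of symmetric differences\<close>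

lemma vector_mvt_bound:
  fixes f :: "real \<Rightarrow> 'a::real_normed_vector"
  assumes "0 \<le> s" and d: "\<And>x. (f has_vector_derivative f' x) (at x)"
    and B: "\<And>x. 0 \<le> x \<Longrightarrow> x \<le> s \<Longrightarrow> norm (f' x) \<le> B"
  shows "norm (f s - f 0) \<le> B * s"
proof -
  have "norm (f s - f 0) \<le> B * norm (s - 0)"
  proof (rule differentiable_bound[of "{0..s}"])
    fix x assume "x \<in> {0..s}"
    show "(f has_derivative (\<lambda>h. h *\<^sub>R f' x)) (at x within {0..s})"
      using d[of x] unfolding has_vector_derivative_def by (rule has_derivative_at_withinI)
    show "onorm (\<lambda>h. h *\<^sub>R f' x) \<le> B"
      using B \<open>x \<in> {0..s}\<close>
      by (intro onorm_le) (auto simp: mult.commute[of _ "norm (f' x)"] intro!: mult_right_mono)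
  qed (use assms in auto)
  then show ?thesis using assms by simp
qed

lemma has_vector_derivative_shift_add:
  assumes "\<And>x. (u has_vector_derivative u1 x) (at x)"
  shows "((\<lambda>s. u (x + s)) has_vector_derivative u1 (x + s)) (at s)"
    and "((\<lambda>s. u (x - s)) has_vector_derivative - u1 (x - s)) (at s)"
proof -
  have "((\<lambda>s. x + s) has_vector_derivative 1) (at s)" "((\<lambda>s. x - s) has_vector_derivative -1) (at s)"
    by (auto intro!: derivative_eq_intros simp flip: has_real_derivative_iff_has_vector_derivative)
  from vector_diff_chain_at[OF this(1) assms] vector_diff_chain_at[OF this(2) assms]
  show "((\<lambda>s. u (x + s)) has_vector_derivative u1 (x + s)) (at s)"
    and "((\<lambda>s. u (x - s)) has_vector_derivative - u1 (x - s)) (at s)"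
    by (simp_all add: o_def)
qed

lemma vector_lipschitz:
  fixes u :: "real \<Rightarrow> 'a::real_normed_vector"
  assumes d: "\<And>x. (u has_vector_derivative u1 x) (at x)" and K: "\<And>x. norm (u1 x) \<le> K"
  shows "norm (u x - u y) \<le> K * \<bar>x - y\<bar>"
proof (cases "y \<le> x")
  case True
  then show ?thesis
    using vector_mvt_bound[of "x - y" "\<lambda>s. u (y + s)" "\<lambda>s. u1 (y + s)" K]
      has_vector_derivative_shift_add[OF d] K by auto
next
  case False
  then show ?thesis
    using vector_mvt_bound[of "y - x" "\<lambda>s. u (x + s)" "\<lambda>s. u1 (x + s)" K]
      has_vector_derivative_shift_add[OF d] K by (auto simp: norm_minus_commute)
qed

text \<open>The derivative in \<open>s\<close> of a symmetric difference of \<open>u\<close> is a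
  symmetric difference of \<open>u1\<close> of the preceding kind. The three bounds that start here
  follow from one another in this way by the mean value inequality; since the derivative is simply
  bounded by its largest value, the constant stays \<open>2 * K\<close>.\<close>

lemma second_difference_bound:
  fixes u :: "real \<Rightarrow> 'a::real_normed_vector"
  assumes d: "\<And>x. (u has_vector_derivative u1 x) (at x)" "\<And>x. (u1 has_vector_derivative u2 x) (at x)"
    and K: "\<And>x. norm (u2 x) \<le> K" and s: "0 \<le> s"
  shows "norm (u (x + s) + u (x - s) - 2 *\<^sub>R u x) \<le> 2 * K * s\<^sup>2"
proof -
  have "K \<ge> 0" using K[of 0] norm_ge_zero order_trans by blast
  have "norm ((u (x + s) + u (x - s)) - (u (x + 0) + u (x - 0))) \<le> (2 * K * s) * s"
  proof (rule vector_mvt_bound[OF s])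
    show "((\<lambda>s. u (x + s) + u (x - s)) has_vector_derivative u1 (x + r) - u1 (x - r)) (at r)" for r
      by (rule derivative_eq_intros has_vector_derivative_shift_add[OF d(1)] | simp)+
    fix r assume r: "0 \<le> r" "r \<le> s"
    have "norm (u1 (x + r) - u1 (x - r)) \<le> K * \<bar>(x + r) - (x - r)\<bar>"
      by (rule vector_lipschitz[OF d(2) K])
    also have "\<dots> \<le> 2 * K * s" using r \<open>K \<ge> 0\<close> by (simp add: mult_left_mono)
    finally show "norm (u1 (x + r) - u1 (x - r)) \<le> 2 * K * s" .
  qed
  then show ?thesis by (simp add: power2_eq_square scaleR_2 algebra_simps)
qed

lemma central_difference_bound:
  fixes u :: "real \<Rightarrow> 'a::real_normed_vector"
  assumes d: "\<And>x. (u has_vector_derivative u1 x) (at x)" "\<And>x. (u1 has_vector_derivative u2 x) (at x)"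
      "\<And>x. (u2 has_vector_derivative u3 x) (at x)"
    and K: "\<And>x. norm (u3 x) \<le> K" and s: "0 \<le> s"
  shows "norm (u (x + s) - u (x - s) - (2 * s) *\<^sub>R u1 x) \<le> 2 * K * s ^ 3"
proof -
  have "K \<ge> 0" using K[of 0] norm_ge_zero order_trans by blast
  have "norm ((u (x + s) - u (x - s) - (2 * s) *\<^sub>R u1 x) - (u (x + 0) - u (x - 0) - (2 * 0) *\<^sub>R u1 x))
      \<le> (2 * K * s\<^sup>2) * s"
  proof (rule vector_mvt_bound[OF s])
    show "((\<lambda>s. u (x + s) - u (x - s) - (2 * s) *\<^sub>R u1 x) has_vector_derivative
        u1 (x + r) + u1 (x - r) - 2 *\<^sub>R u1 x) (at r)" for r
      by (rule derivative_eq_intros has_vector_derivative_shift_add[OF d(1)] | simp)+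
    fix r assume r: "0 \<le> r" "r \<le> s"
    have "norm (u1 (x + r) + u1 (x - r) - 2 *\<^sub>R u1 x) \<le> 2 * K * r\<^sup>2"
      by (rule second_difference_bound[OF d(2,3) K r(1)])
    also have "\<dots> \<le> 2 * K * s\<^sup>2" using r \<open>K \<ge> 0\<close> by (intro mult_left_mono power_mono) auto
    finally show "norm (u1 (x + r) + u1 (x - r) - 2 *\<^sub>R u1 x) \<le> 2 * K * s\<^sup>2" .
  qed
  then show ?thesis by (simp add: power2_eq_square power3_eq_cube)
qed

lemma second_difference_expansion:
  fixes u :: "real \<Rightarrow> 'a::real_normed_vector"
  assumes d: "\<And>x. (u has_vector_derivative u1 x) (at x)" "\<And>x. (u1 has_vector_derivative u2 x) (at x)"
      "\<And>x. (u2 has_vector_derivative u3 x) (at x)" "\<And>x. (u3 has_vector_derivative u4 x) (at x)"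
    and K: "\<And>x. norm (u4 x) \<le> K" and s: "0 \<le> s"
  shows "norm (u (x + s) + u (x - s) - 2 *\<^sub>R u x - s\<^sup>2 *\<^sub>R u2 x) \<le> 2 * K * s ^ 4"
proof -
  have "K \<ge> 0" using K[of 0] norm_ge_zero order_trans by blast
  have "norm ((u (x + s) + u (x - s) - s\<^sup>2 *\<^sub>R u2 x) - (u (x + 0) + u (x - 0) - 0\<^sup>2 *\<^sub>R u2 x))
      \<le> (2 * K * s ^ 3) * s"
  proof (rule vector_mvt_bound[OF s])
    show "((\<lambda>s. u (x + s) + u (x - s) - s\<^sup>2 *\<^sub>R u2 x) has_vector_derivative
        u1 (x + r) - u1 (x - r) - (2 * r) *\<^sub>R u2 x) (at r)" for r
      by (rule derivative_eq_intros has_vector_derivative_shift_add[OF d(1)] | simp)+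
    fix r assume r: "0 \<le> r" "r \<le> s"
    have "norm (u1 (x + r) - u1 (x - r) - (2 * r) *\<^sub>R u2 x) \<le> 2 * K * r ^ 3"
      by (rule central_difference_bound[OF d(2-4) K r(1)])
    also have "\<dots> \<le> 2 * K * s ^ 3" using r \<open>K \<ge> 0\<close> by (intro mult_left_mono power_mono) auto
    finally show "norm (u1 (x + r) - u1 (x - r) - (2 * r) *\<^sub>R u2 x) \<le> 2 * K * s ^ 3" .
  qed
  then show ?thesis by (simp add: eval_nat_numeral scaleR_2 algebra_simps)
qed

section \<open>The energy estimate\<close>

lemma perp_inner: "perp u \<bullet> perp v = u \<bullet> v"
  by (simp add: perp_def inner_vec_def sum_2)

lemma norm_perp [simp]: "norm (perp v) = norm v"
  by (simp add: norm_eq_sqrt_inner perp_inner)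

lemma perp_orthogonal [simp]: "perp v \<bullet> v = 0" "v \<bullet> perp v = 0"
  by (simp_all add: perp_def inner_vec_def sum_2)

lemma linear_perp: "linear perp"
  by (rule linearI) (simp_all add: perp_def vec_eq_iff forall_2)

lemmas perp_simps = linear_diff[OF linear_perp] linear_add[OF linear_perp] linear_cmul[OF linear_perp]

lemma seg_tan_eq_sgn: "seg_tan x j = sgn (x j - x (j - 1))"
  by (simp add: seg_tan_def seg_len_def sgn_div_norm)

lemma mid_tan_eq_sgn: "mid_tan x j = sgn (seg_tan x j + seg_tan x (j + 1))"
  by (simp add: mid_tan_def sgn_div_norm)

lemma norm_seg_tan: "seg_len x j \<noteq> 0 \<Longrightarrow> norm (seg_tan x j) = 1"
  by (auto simp: seg_tan_eq_sgn norm_sgn seg_len_def)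

lemma norm_mid_tan_le: "norm (mid_tan x j) \<le> 1"
  by (simp add: mid_tan_eq_sgn norm_sgn)

lemma mesh_pos: "N > 0 \<Longrightarrow> 0 < mesh N"
  by (simp add: mesh_def)

lemma mesh_times: "N > 0 \<Longrightarrow> real N * mesh N = 2 * pi"
  by (simp add: mesh_def)

text \<open>This is what summation by parts on a closed polygon rests on: there are no boundary
  terms, because index \<open>N + 1\<close> is index \<open>1\<close>.\<close>

lemma sum_periodic_shift:
  fixes a :: "int \<Rightarrow> 'a::ab_group_add"
  assumes per: "\<And>j. a (j + int N) = a j"
  shows "(\<Sum>j=1..int N. a (j + 1)) = (\<Sum>j=1..int N. a j)"
    and "(\<Sum>j=1..int N. a (j - 1)) = (\<Sum>j=1..int N. a j)"
proof -
  have *: "(\<Sum>j=1..int N. b (j + 1)) = (\<Sum>j=1..int N. b j)"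
    if "\<And>j. b (j + int N) = b j" for b :: "int \<Rightarrow> 'a"
  proof (cases "N = 0")
    case False
    have "(\<Sum>j=1..int N. b (j + 1)) = sum b {2..int N + 1}"
      by (rule sum.reindex_bij_witness[of _ "\<lambda>j. j - 1" "\<lambda>j. j + 1"]) auto
    also have "{2..int N + 1} = insert (int N + 1) {2..int N}" using False by auto
    also have "sum b \<dots> = b 1 + sum b {2..int N}" using that[of 1] by (simp add: add.commute)
    also have "\<dots> = sum b (insert 1 {2..int N})" by simp
    also have "insert 1 {2..int N} = {1..int N}" using False by auto
    finally show ?thesis .
  qed simp
  show "(\<Sum>j=1..int N. a (j + 1)) = (\<Sum>j=1..int N. a j)" by (rule *[where b = a, OF per])
  have "a (j + int N - 1) = a (j - 1)" for j using per[of "j - 1"] by (simp add: algebra_simps)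
  from *[of "\<lambda>j. a (j - 1)", OF this]
  show "(\<Sum>j=1..int N. a (j - 1)) = (\<Sum>j=1..int N. a j)" by simp
qed

lemma sum_square_le:
  fixes a b c d e k l :: real
  shows "(a + b + c + d + e + k + l)\<^sup>2 \<le> 7 * (a\<^sup>2 + b\<^sup>2 + c\<^sup>2 + d\<^sup>2 + e\<^sup>2 + k\<^sup>2 + l\<^sup>2)"
proof -
  \<comment> \<open>Lagrange's identity: the difference of the two sides is the sum of the squared
    pairwise differences.\<close>
  have "0 \<le> (a-b)\<^sup>2 + (a-c)\<^sup>2 + (a-d)\<^sup>2 + (a-e)\<^sup>2 + (a-k)\<^sup>2 + (a-l)\<^sup>2 + (b-c)\<^sup>2 + (b-d)\<^sup>2 + (b-e)\<^sup>2
     + (b-k)\<^sup>2 + (b-l)\<^sup>2 + (c-d)\<^sup>2 + (c-e)\<^sup>2 + (c-k)\<^sup>2 + (c-l)\<^sup>2 + (d-e)\<^sup>2 + (d-k)\<^sup>2 + (d-l)\<^sup>2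
     + (e-k)\<^sup>2 + (e-l)\<^sup>2 + (k-l)\<^sup>2"
    by (intro add_nonneg_nonneg zero_le_power2)
  then show ?thesis by (simp add: power2_eq_square algebra_simps)
qed

text \<open>The first term is Young's inequality for \<open>9 * M\<^sup>2 * (a * w)\<close> against
  \<open>c / 4 * a\<^sup>2\<close>; the other two bound, with some slack, the products that do not
  contain \<open>a\<close>.\<close>

definition rate_const :: "real \<Rightarrow> real \<Rightarrow> real" where
  "rate_const c M = 81 * M ^ 4 / c + 8 * M ^ 3 + 2 * M / c"

text \<open>The quadratic terms in \<open>a\<close> are absorbed by the dissipation \<open>p * a\<^sup>2\<close>, because the
  relative length errors \<open>d\<close>, \<open>d'\<close> are small.\<close>

lemma dissipation_absorbs:
  fixes a d d' s s' \<phi> k \<eta> p c M :: real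
  assumes nonneg: "0 \<le> a" "0 \<le> d" "0 \<le> d'" "0 \<le> s" "0 \<le> s'" "0 \<le> \<phi>" "0 \<le> k" "0 \<le> \<eta>"
    and "d + d' \<le> 1/2" "0 < c" "c / 2 \<le> p" "1 \<le> M"
  shows "- p * a\<^sup>2 + a * (M * (d + d') + 2 * M * (2 * M * (s + s') + \<phi>) + M\<^sup>2 * k) + M * s\<^sup>2 / 2
    + 2 * M / c * (d * s) + M * (d * k)
    + (d + d') * (M\<^sup>2 * (d + d') + M ^ 3 * k + 2 * M * (2 * M\<^sup>2 * (s + s') + M * \<phi> + 4 * M * a) + p * a\<^sup>2)
    + 2 * \<eta> * a
    \<le> rate_const c M * (d + d' + s + s' + \<phi> + k + \<eta>)\<^sup>2" (is "?L \<le> _")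
proof -
  define w where "w = d + d' + s + s' + \<phi> + k + \<eta>"
  have w: "0 \<le> w" "d + d' \<le> w" "s \<le> w" "d \<le> w" "k \<le> w" using nonneg by (simp_all add: w_def)
  have M: "M \<le> M\<^sup>2" "M\<^sup>2 \<le> M ^ 3" "M \<le> M ^ 3" "1 \<le> M\<^sup>2"
    using \<open>1 \<le> M\<close> power_increasing[of 1 2 M] power_increasing[of 2 3 M] power_increasing[of 1 3 M]
    power_increasing[of 0 2 M] by simp_all
  \<comment> \<open>Budget of the dissipation: since \<open>d + d' \<le> 1/2\<close>, one half pays
    for the term \<open>p * a\<^sup>2\<close> coming from the length rate. The other half, at least
    \<open>c / 4 * a\<^sup>2\<close>, pays for everything linear in \<open>a\<close>.\<close>
  have dis: "(d + d') * (p * a\<^sup>2) \<le> 1/2 * (p * a\<^sup>2)"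
    using assms by (intro mult_right_mono) auto
  have pa: "c / 4 * a\<^sup>2 \<le> 1/2 * (p * a\<^sup>2)"
    using mult_right_mono[OF \<open>c / 2 \<le> p\<close>, of "a\<^sup>2"] by simp
  have lin: "a * (M * (d + d') + 2 * M * (2 * M * (s + s') + \<phi>) + M\<^sup>2 * k) + 2 * \<eta> * a
      + (d + d') * (2 * M * (4 * M * a)) \<le> 9 * M\<^sup>2 * (a * w)"
  proof -
    have "M * (d + d') + 2 * M * (2 * M * (s + s') + \<phi>) + M\<^sup>2 * k + 2 * \<eta> + 8 * M\<^sup>2 * (d + d')
        \<le> M\<^sup>2 * (d + d') + 4 * M\<^sup>2 * (s + s') + 2 * M\<^sup>2 * \<phi> + M\<^sup>2 * k + 2 * M\<^sup>2 * \<eta> + 8 * M\<^sup>2 * (d + d')"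
    proof -
      have "M * (d + d') \<le> M\<^sup>2 * (d + d')" "M * \<phi> \<le> M\<^sup>2 * \<phi>" "1 * \<eta> \<le> M\<^sup>2 * \<eta>"
        using M nonneg by (intro mult_right_mono; simp)+
      then show ?thesis by (simp add: algebra_simps power2_eq_square)
    qed
    also have "\<dots> \<le> 9 * M\<^sup>2 * w"
    proof -
      have "0 \<le> M\<^sup>2 * s" "0 \<le> M\<^sup>2 * s'" "0 \<le> M\<^sup>2 * \<phi>" "0 \<le> M\<^sup>2 * k" "0 \<le> M\<^sup>2 * \<eta>"
        using nonneg by simp_all
      then show ?thesis by (simp add: w_def algebra_simps)
    qed
    finally have "a * (M * (d + d') + 2 * M * (2 * M * (s + s') + \<phi>) + M\<^sup>2 * k + 2 * \<eta> + 8 * M\<^sup>2 * (d + d'))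
        \<le> a * (9 * M\<^sup>2 * w)" by (rule mult_left_mono) fact
    then show ?thesis by (simp add: algebra_simps power2_eq_square)
  qed
  have quad1: "M * s\<^sup>2 / 2 \<le> M ^ 3 * w\<^sup>2"
  proof -
    have "M * s\<^sup>2 \<le> M ^ 3 * w\<^sup>2" using M w nonneg \<open>1 \<le> M\<close> by (intro mult_mono power_mono) auto
    moreover have "0 \<le> M * s\<^sup>2" using \<open>1 \<le> M\<close> by simp
    ultimately show ?thesis by linarith
  qed
  have quad2: "2 * M / c * (d * s) \<le> 2 * M / c * w\<^sup>2"
    unfolding power2_eq_square using w nonneg assms by (intro mult_left_mono mult_mono) auto
  have quad3: "M * (d * k) \<le> M ^ 3 * w\<^sup>2"
    unfolding power2_eq_square using w nonneg M order_trans[OF zero_le_one \<open>1 \<le> M\<close>] by (intro mult_mono) simp_all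
  have quad4: "(d + d') * (M\<^sup>2 * (d + d') + M ^ 3 * k + 2 * M * (2 * M\<^sup>2 * (s + s') + M * \<phi>)) \<le> w * (4 * M ^ 3 * w)"
  proof (intro mult_mono)
    have "M\<^sup>2 * (d + d') \<le> M ^ 3 * (d + d')" "M\<^sup>2 * \<phi> \<le> M ^ 3 * \<phi>"
        using M nonneg by (intro mult_right_mono; simp)+
    moreover have "0 \<le> M ^ 3 * d" "0 \<le> M ^ 3 * d'" "0 \<le> M ^ 3 * \<phi>" "0 \<le> M ^ 3 * k" "0 \<le> M ^ 3 * \<eta>"
        using nonneg \<open>1 \<le> M\<close> by simp_all
    ultimately show "M\<^sup>2 * (d + d') + M ^ 3 * k + 2 * M * (2 * M\<^sup>2 * (s + s') + M * \<phi>) \<le> 4 * M ^ 3 * w"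
      by (simp add: w_def algebra_simps power2_eq_square power3_eq_cube)
  next
    show "0 \<le> M\<^sup>2 * (d + d') + M ^ 3 * k + 2 * M * (2 * M\<^sup>2 * (s + s') + M * \<phi>)"
      using nonneg \<open>1 \<le> M\<close> by (intro add_nonneg_nonneg mult_nonneg_nonneg) auto
  qed (use w in auto)
  have young: "9 * M\<^sup>2 * (a * w) \<le> c / 4 * a\<^sup>2 + 81 * M ^ 4 / c * w\<^sup>2"
  proof -
    have "0 \<le> (c / 2 * a - 9 * M\<^sup>2 * w)\<^sup>2 / c" using \<open>0 < c\<close> by simp
    also have "\<dots> = c / 4 * a\<^sup>2 + 81 * M ^ 4 / c * w\<^sup>2 - 9 * M\<^sup>2 * (a * w)"
      using \<open>0 < c\<close> by (simp add: power2_diff field_simps eval_nat_numeral)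
    finally show ?thesis by simp
  qed
  have "?L = - p * a\<^sup>2 + (d + d') * (p * a\<^sup>2)
      + (a * (M * (d + d') + 2 * M * (2 * M * (s + s') + \<phi>) + M\<^sup>2 * k) + 2 * \<eta> * a
      + (d + d') * (2 * M * (4 * M * a)))
      + M * s\<^sup>2 / 2 + 2 * M / c * (d * s) + M * (d * k)
      + (d + d') * (M\<^sup>2 * (d + d') + M ^ 3 * k + 2 * M * (2 * M\<^sup>2 * (s + s') + M * \<phi>))"
    by (simp add: algebra_simps)
  also have "\<dots> \<le> 81 * M ^ 4 / c * w\<^sup>2 + M ^ 3 * w\<^sup>2 + 2 * M / c * w\<^sup>2 + M ^ 3 * w\<^sup>2 + w * (4 * M ^ 3 * w)"
    using dis pa lin young quad1 quad2 quad3 quad4 by linarith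
  also have "\<dots> \<le> rate_const c M * w\<^sup>2"
  proof -
    have "0 \<le> M ^ 3 * w\<^sup>2" using \<open>1 \<le> M\<close> by simp
    then show ?thesis
      unfolding rate_const_def distrib_right by (simp add: power2_eq_square algebra_simps)
  qed
  finally show ?thesis by (simp add: w_def)
qed

text \<open>\<open>V\<close> is the velocity of \<open>X\<close>. The last condition bounds the variation between neighbouring nodes of
  the tangential part of the residual; it is one order better than what the bound on the residual
  gives, and this is what makes the edge lengths second order accurate.\<close>

definition consistent ::
  "real \<Rightarrow> real \<Rightarrow> (real \<Rightarrow> real) \<Rightarrow> nat \<Rightarrow> (int \<Rightarrow> real^2) \<Rightarrow> (int \<Rightarrow> real^2) \<Rightarrow> bool" where
  "consistent c M f N X V \<longleftrightarrow> grid_fun N X \<and> grid_fun N V \<and> \<bar>f (discrete_len N X)\<bar> \<le> M \<and>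
     (\<forall>j. c * mesh N \<le> seg_len X j \<and> seg_len X j \<le> M * mesh N \<and>
        norm (V j) \<le> M \<and> norm (V j - V (j - 1)) \<le> M * mesh N \<and>
        1 \<le> norm (seg_tan X j + seg_tan X (j + 1)) \<and>
        norm (V j - scheme_rhs f N X j) \<le> M * (mesh N)\<^sup>2 \<and>
        \<bar>(seg_tan X j + seg_tan X (j + 1)) \<bullet> V j - (seg_tan X (j - 1) + seg_tan X j) \<bullet> V (j - 1)\<bar>
          \<le> M * mesh N ^ 3)"

text \<open>The first summand equals \<open>seg_len x j * (norm (seg_tan X j - seg_tan x j))\<^sup>2 / 2\<close>; in the form
  below it is easily differentiated in time.\<close>

definition grid_energy :: "nat \<Rightarrow> (int \<Rightarrow> real^2) \<Rightarrow> (int \<Rightarrow> real^2) \<Rightarrow> real" where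
  "grid_energy N X x = (\<Sum>j=1..int N. (seg_len x j - seg_tan X j \<bullet> (x j - x (j - 1)))
     + (seg_len X j - seg_len x j)\<^sup>2 / mesh N + mesh N * (norm (X j - x j))\<^sup>2)"

text \<open>The time derivative of \<open>grid_energy\<close> when \<open>X\<close> and
  \<open>x\<close> move with velocities \<open>V\<close> and \<open>U\<close>. As an algebraic
  expression it can be estimated for two fixed polygons; \<open>stays_near\<close> identifies it as
  the derivative.\<close>

definition grid_energy_rate ::
  "nat \<Rightarrow> (int \<Rightarrow> real^2) \<Rightarrow> (int \<Rightarrow> real^2) \<Rightarrow> (int \<Rightarrow> real^2) \<Rightarrow> (int \<Rightarrow> real^2) \<Rightarrow> real" where
  "grid_energy_rate N X V x U = (\<Sum>j=1..int N.
       (seg_tan x j \<bullet> (U j - U (j - 1)) - dsgn (X j - X (j - 1)) (V j - V (j - 1)) \<bullet> (x j - x (j - 1))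
         - seg_tan X j \<bullet> (U j - U (j - 1)))
     + 2 * (seg_len X j - seg_len x j) *
         (seg_tan X j \<bullet> (V j - V (j - 1)) - seg_tan x j \<bullet> (U j - U (j - 1))) / mesh N
     + 2 * mesh N * ((X j - x j) \<bullet> (V j - U j)))"

lemma grid_fun_seg:
  assumes "grid_fun N x"
  shows "seg_len x (j + int N) = seg_len x j" "seg_tan x (j + int N) = seg_tan x j"
    "x (j + int N) = x j" "x (j + int N - 1) = x (j - 1)" "seg_tan x (j + int N + 1) = seg_tan x (j + 1)"
    "seg_len x (j + int N + 1) = seg_len x (j + 1)"
proof -
  have *: "x (j + int N) = x j" for j using assms by (simp add: grid_fun_def)
  have m: "x (j + int N - 1) = x (j - 1)" for j using *[of "j - 1"] by (simp add: algebra_simps)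
  have 1: "seg_len x (j + int N) = seg_len x j" for j by (simp add: seg_len_def * m)
  have 2: "seg_tan x (j + int N) = seg_tan x j" for j by (simp add: seg_tan_def * m 1)
  have "j + int N + 1 = (j + 1) + int N" by simp
  then show "seg_len x (j + int N) = seg_len x j" "seg_tan x (j + int N) = seg_tan x j"
    "x (j + int N) = x j" "x (j + int N - 1) = x (j - 1)" "seg_tan x (j + int N + 1) = seg_tan x (j + 1)"
    "seg_len x (j + int N + 1) = seg_len x (j + 1)"
    by (simp_all only: * m 1 2)
qed

lemma scheme_rhs_periodic: "grid_fun N x \<Longrightarrow> scheme_rhs f N x (j + int N) = scheme_rhs f N x j"
  by (simp add: scheme_rhs_def mid_tan_def grid_fun_seg)

text \<open>The difference of two unit vectors is orthogonal to their sum, and so is the rotated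
  bisector. This exact absence of sliding along the bisector is what makes
  \<open>length_rate_identity\<close> possible.\<close>

lemma scheme_rhs_orthogonal:
  assumes "seg_len x j \<noteq> 0" "seg_len x (j + 1) \<noteq> 0"
  shows "scheme_rhs f N x j \<bullet> (seg_tan x j + seg_tan x (j + 1)) = 0"
proof -
  let ?m = "seg_tan x j + seg_tan x (j + 1)"
  have "(seg_tan x (j + 1) - seg_tan x j) \<bullet> ?m = 0"
    using norm_seg_tan[OF assms(1)] norm_seg_tan[OF assms(2)]
    by (simp add: inner_diff_left inner_add_right norm_eq_1 inner_commute[of "seg_tan x (j + 1)" "seg_tan x j"])
  moreover have "perp (mid_tan x j) \<bullet> ?m = 0"
    by (simp add: mid_tan_eq_sgn sgn_div_norm linear_cmul[OF linear_perp])
  ultimately show ?thesis by (simp add: scheme_rhs_def inner_diff_left)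
qed

text \<open>The scheme read backwards: a jump of the tangent is traded for a velocity times a mean
  edge length, a quantity of order h.\<close>

lemma scheme_rhs_tangent_diff:
  assumes "0 < seg_len x j + seg_len x (j + 1)"
  shows "seg_tan x (j + 1) - seg_tan x j = ((seg_len x j + seg_len x (j + 1)) / 2) *\<^sub>R
    (scheme_rhs f N x j + f (discrete_len N x) *\<^sub>R perp (mid_tan x j))"
proof -
  define r where "r = seg_len x j + seg_len x (j + 1)"
  have "(r / 2) * (2 / r) = 1" using assms by (simp add: r_def)
  then show ?thesis
    unfolding scheme_rhs_def r_def[symmetric] diff_add_cancel scaleR_scaleR by simp
qed

text \<open>The left side is the derivative of \<open>norm dv - sgn Dv \<bullet> dv\<close>. On the
  right the first term is the one to be summed by parts. The others are of second order in the
  errors, because \<open>1 - sgn Dv \<bullet> sgn dv\<close> is half a squared distance of unit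
  vectors and \<open>dsgn Dv W\<close> is orthogonal to \<open>sgn Dv\<close>.\<close>

lemma energy_term_eq:
  fixes Dv dv W w :: "'a::real_inner"
  assumes "Dv \<noteq> 0"
  shows "sgn dv \<bullet> w - dsgn Dv W \<bullet> dv - sgn Dv \<bullet> w
    = (sgn Dv - sgn dv) \<bullet> (W - w) - (sgn Dv \<bullet> W) * (1 - sgn Dv \<bullet> sgn dv)
      + (norm Dv - norm dv) * (dsgn Dv W \<bullet> sgn dv)"
proof -
  have 1: "dsgn Dv W \<bullet> dv = norm dv * (dsgn Dv W \<bullet> sgn dv)"
    by (cases "dv = 0") (simp_all add: sgn_div_norm)
  have 2: "norm Dv * (dsgn Dv W \<bullet> sgn dv) = W \<bullet> sgn dv - (sgn Dv \<bullet> W) * (sgn Dv \<bullet> sgn dv)"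
    using assms by (simp add: dsgn_def inner_diff_left)
  show ?thesis
    unfolding left_diff_distrib 1 2
    by (simp add: inner_diff_left inner_diff_right algebra_simps inner_commute)
qed

lemma unit_inner_deficit:
  fixes a b :: "'a::real_inner"
  assumes "norm a = 1" "norm b = 1"
  shows "1 - a \<bullet> b = (norm (a - b))\<^sup>2 / 2"
  using assms by (simp add: power2_norm_eq_inner norm_eq_1 inner_diff_left inner_diff_right inner_commute)

lemma dsgn_inner_sgn: "dsgn c s \<bullet> sgn c = 0"
proof (cases "c = 0")
  case False
  then have "sgn c \<bullet> sgn c = 1" by (simp add: norm_sgn flip: power2_norm_eq_inner)
  then show ?thesis by (simp add: dsgn_def inner_diff_left inner_commute[of s])
qed (simp add: dsgn_def)

lemma dsgn_inner_le: "\<bar>dsgn c s \<bullet> sgn b\<bar> \<le> 2 * norm s / norm c * norm (sgn c - sgn b)"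
proof -
  have "dsgn c s \<bullet> sgn b = - (dsgn c s \<bullet> (sgn c - sgn b))"
    by (simp add: inner_diff_right dsgn_inner_sgn)
  also have "\<bar>\<dots>\<bar> \<le> norm (dsgn c s) * norm (sgn c - sgn b)"
    by (simp add: Cauchy_Schwarz_ineq2)
  also have "\<dots> \<le> 2 * norm s / norm c * norm (sgn c - sgn b)"
    by (intro mult_right_mono norm_dsgn_le) simp
  finally show ?thesis .
qed

text \<open>Two polygons at one fixed time, with the hypothesis \<open>near\<close> of the
  continuity argument. The condition \<open>\<epsilon> \<le> c / 8\<close> keeps edges and tangents
  of \<open>x\<close> comparable to those of \<open>X\<close>;
  \<open>7 * \<Lambda> * \<epsilon> \<le> 1\<close> keeps the error of the forcing at most 1, as the
  total length error is at most \<open>2 * pi * \<epsilon>\<close> and 2 pi < 7.\<close>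

locale grid_pair =
  fixes f :: "real \<Rightarrow> real" and N :: nat and c M \<Lambda> \<epsilon> :: real and X V x :: "int \<Rightarrow> real^2"
  assumes N: "N > 0" and cons: "consistent c M f N X V" and x_per: "grid_fun N x"
    and lip: "\<And>a b. 0 < a \<Longrightarrow> 0 < b \<Longrightarrow> \<bar>f a - f b\<bar> \<le> \<Lambda> * \<bar>a - b\<bar>"
    and near: "\<And>j. norm ((X j - x j) - (X (j - 1) - x (j - 1))) \<le> \<epsilon> * mesh N"
    and c: "0 < c" "c \<le> 1" "1 \<le> M" and \<Lambda>: "0 \<le> \<Lambda>" and h1: "mesh N \<le> 1"
    and \<epsilon>: "0 < \<epsilon>" "\<epsilon> \<le> c / 8" "7 * \<Lambda> * \<epsilon> \<le> 1"
begin

abbreviation "h \<equiv> mesh N"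
abbreviation "Q \<equiv> seg_len X"
abbreviation "q \<equiv> seg_len x"
abbreviation "\<sigma> j \<equiv> seg_tan X j - seg_tan x j"
abbreviation "F \<equiv> f (discrete_len N X)"
abbreviation "g \<equiv> f (discrete_len N x)"

lemma h: "0 < h" using N by (rule mesh_pos)

lemma cons': "grid_fun N X" "grid_fun N V" "\<bar>F\<bar> \<le> M" "c * h \<le> Q j" "Q j \<le> M * h"
    "norm (V j) \<le> M" "norm (V j - V (j - 1)) \<le> M * h"
    "1 \<le> norm (seg_tan X j + seg_tan X (j + 1))"
    "norm (V j - scheme_rhs f N X j) \<le> M * h\<^sup>2"
    "\<bar>(seg_tan X j + seg_tan X (j + 1)) \<bullet> V j - (seg_tan X (j - 1) + seg_tan X j) \<bullet> V (j - 1)\<bar> \<le> M * h ^ 3"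
  using cons by (simp_all add: consistent_def)

lemma D_le: "\<bar>Q j - q j\<bar> \<le> norm ((X j - x j) - (X (j - 1) - x (j - 1)))" "\<bar>Q j - q j\<bar> \<le> \<epsilon> * h"
proof -
  have "\<bar>Q j - q j\<bar> \<le> norm ((X j - X (j - 1)) - (x j - x (j - 1)))"
    unfolding seg_len_def by (rule norm_triangle_ineq3)
  also have "(X j - X (j - 1)) - (x j - x (j - 1)) = (X j - x j) - (X (j - 1) - x (j - 1))" by simp
  finally show "\<bar>Q j - q j\<bar> \<le> norm ((X j - x j) - (X (j - 1) - x (j - 1)))" .
  with near[of j] show "\<bar>Q j - q j\<bar> \<le> \<epsilon> * h" by linarith
qed

lemma Q_pos: "0 < Q j" using cons'(4)[of j] h c by (smt (verit) mult_pos_pos)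

lemma q_bounds: "c / 2 * h \<le> q j" "q j \<le> 2 * M * h" "0 < q j"
proof -
  have "\<epsilon> * h \<le> c / 2 * h" "\<epsilon> * h \<le> M * h" using \<epsilon> h c by (intro mult_right_mono; linarith)+
  then show 1: "c / 2 * h \<le> q j" and "q j \<le> 2 * M * h"
    using D_le(2)[of j] cons'(4,5)[of j] by (simp_all add: algebra_simps abs_le_iff)
  show "0 < q j" using 1 h c by (smt (verit) mult_pos_pos half_gt_zero)
qed

text \<open>The factor 1/8 in the bound on \<open>\<epsilon>\<close> is chosen for this: two tangent
  errors of at most 1/4 leave half of the lower bound 1 for the sum of neighbouring exact tangents,
  see \<open>mid_ge\<close>.\<close>

lemma sigma_le: "norm (\<sigma> j) \<le> 1/4"
proof -
  have "norm (\<sigma> j) \<le> 2 * norm ((X j - X (j - 1)) - (x j - x (j - 1))) / Q j"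
    unfolding seg_tan_eq_sgn seg_len_def using Q_pos[of j]
    by (intro norm_sgn_diff_le) (auto simp: seg_len_def)
  also have "(X j - X (j - 1)) - (x j - x (j - 1)) = (X j - x j) - (X (j - 1) - x (j - 1))" by simp
  also have "2 * norm \<dots> / Q j \<le> 2 * (c / 8 * h) / (c * h)"
  proof (intro frac_le mult_left_mono cons'(4))
    have "\<epsilon> * h \<le> c / 8 * h" using \<epsilon> h by (intro mult_right_mono) auto
    then show "norm ((X j - x j) - (X (j - 1) - x (j - 1))) \<le> c / 8 * h" using near[of j] by linarith
  qed (use h c in auto)
  also have "\<dots> = 1/4" using h c by simp
  finally show ?thesis .
qed

lemma mid_ge: "1/2 \<le> norm (seg_tan x j + seg_tan x (j + 1))"
proof -
  have "norm (seg_tan X j + seg_tan X (j + 1)) \<le> norm (seg_tan x j + seg_tan x (j + 1)) + norm (\<sigma> j + \<sigma> (j + 1))"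
    using norm_triangle_ineq[of "seg_tan x j + seg_tan x (j + 1)" "\<sigma> j + \<sigma> (j + 1)"]
    by (simp add: algebra_simps)
  moreover have "norm (\<sigma> j + \<sigma> (j + 1)) \<le> 1/4 + 1/4"
    by (intro norm_triangle_mono sigma_le)
  ultimately show ?thesis using cons'(8)[of j] by linarith
qed

definition "\<phi> = \<Lambda> * (\<Sum>j=1..int N. \<bar>Q j - q j\<bar>)"

lemma len_pos: "0 < discrete_len N X" "0 < discrete_len N x"
  unfolding discrete_len_def using N Q_pos q_bounds(3) by (auto intro!: sum_pos)

lemma F_diff: "\<bar>F - g\<bar> \<le> \<phi>" "0 \<le> \<phi>" "\<phi> \<le> 1"
proof -
  have "\<bar>F - g\<bar> \<le> \<Lambda> * \<bar>discrete_len N X - discrete_len N x\<bar>" by (rule lip[OF len_pos])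
  also have "\<dots> \<le> \<phi>"
    unfolding \<phi>_def discrete_len_def sum_subtractf[symmetric]
    using \<Lambda> by (intro mult_left_mono sum_abs) auto
  finally show "\<bar>F - g\<bar> \<le> \<phi>" .
  show "0 \<le> \<phi>" unfolding \<phi>_def using \<Lambda> by (intro mult_nonneg_nonneg sum_nonneg) auto
  have "(\<Sum>j=1..int N. \<bar>Q j - q j\<bar>) \<le> (\<Sum>j=1..int N. \<epsilon> * h)" by (intro sum_mono D_le)
  also have "\<dots> = \<epsilon> * (2 * pi)" using mesh_times[OF N] by (simp add: mult.commute mult.left_commute)
  also have "\<dots> \<le> \<epsilon> * 7" using \<epsilon> pi_less_4 pi_approx by (intro mult_left_mono) auto
  finally have "\<phi> \<le> \<Lambda> * (\<epsilon> * 7)" unfolding \<phi>_def using \<Lambda> by (rule mult_left_mono)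
  then show "\<phi> \<le> 1" using \<epsilon> by (simp add: algebra_simps)
qed

text \<open>The perimeter couples all nodes, yet its error is affordable: Cauchy-Schwarz over the
  nodes costs a factor \<open>N\<close>, the sum over the nodes another one, and
  \<open>N * h = 2 * pi\<close> absorbs both.\<close>

lemma \<phi>_square: "h * (real N * \<phi>\<^sup>2) \<le> 4 * pi\<^sup>2 * \<Lambda>\<^sup>2 * (\<Sum>j=1..int N. (Q j - q j)\<^sup>2 / h)"
proof -
  have "(\<Sum>j=1..int N. 1 * \<bar>Q j - q j\<bar>)\<^sup>2 \<le> (\<Sum>j=1..int N. 1\<^sup>2) * (\<Sum>j=1..int N. \<bar>Q j - q j\<bar>\<^sup>2)"
    by (rule Cauchy_Schwarz_ineq_sum)
  then have "(\<Sum>j=1..int N. \<bar>Q j - q j\<bar>)\<^sup>2 \<le> real N * (\<Sum>j=1..int N. (Q j - q j)\<^sup>2)" by simp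
  then have "h * (real N * \<phi>\<^sup>2) \<le> h * (real N * (\<Lambda>\<^sup>2 * (real N * (\<Sum>j=1..int N. (Q j - q j)\<^sup>2))))"
    unfolding \<phi>_def power_mult_distrib using h by (intro mult_left_mono) auto
  also have "\<dots> = (real N * h)\<^sup>2 * \<Lambda>\<^sup>2 * ((\<Sum>j=1..int N. (Q j - q j)\<^sup>2) / h)"
    using h by (simp add: power2_eq_square field_simps)
  finally show ?thesis by (simp add: mesh_times[OF N] sum_divide_distrib power_mult_distrib)
qed

section \<open>Error equation for the tangents and the terms of the energy rate\<close>

abbreviation "U \<equiv> scheme_rhs f N x"
abbreviation "s j \<equiv> norm (\<sigma> j)"
abbreviation "\<delta> j \<equiv> \<bar>Q j - q j\<bar> / h"
abbreviation "\<eta> j \<equiv> norm (X j - x j)"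
abbreviation "a j \<equiv> norm (V j - U j)"
abbreviation "p j \<equiv> (q j + q (j + 1)) / 2"
abbreviation "P j \<equiv> (Q j + Q (j + 1)) / 2"
abbreviation "Z j \<equiv> F *\<^sub>R perp (mid_tan X j)"
abbreviation "z j \<equiv> g *\<^sub>R perp (mid_tan x j)"
abbreviation "R j \<equiv> V j - scheme_rhs f N X j"

lemma P_diff: "\<bar>P j - p j\<bar> \<le> h * ((\<delta> j + \<delta> (j + 1)) / 2)"
proof -
  have "\<bar>P j - p j\<bar> \<le> (\<bar>Q j - q j\<bar> + \<bar>Q (j + 1) - q (j + 1)\<bar>) / 2" by (simp add: field_simps abs_if)
  also have "\<dots> = h * ((\<delta> j + \<delta> (j + 1)) / 2)" using h by (simp add: field_simps)
  finally show ?thesis .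
qed

lemma P_bound: "P j \<le> M * h" "0 < P j" using cons'(5)[of j] cons'(5)[of "j + 1"] add_pos_pos[OF Q_pos Q_pos] by simp_all

lemma p_bound: "p j \<le> h * (2 * M)" "c / 2 * h \<le> p j" "0 < p j"
  using q_bounds[of j] q_bounds[of "j + 1"] by (simp_all add: algebra_simps)

lemma Z_diff: "norm (Z j - z j) \<le> 2 * M * (s j + s (j + 1)) + \<phi>"
proof -
  have "norm (mid_tan X j - mid_tan x j) \<le> 2 * norm ((seg_tan X j + seg_tan X (j + 1)) - (seg_tan x j + seg_tan x (j + 1)))
      / norm (seg_tan X j + seg_tan X (j + 1))"
    unfolding mid_tan_eq_sgn by (intro norm_sgn_diff_le) (use cons'(8)[of j] in auto)
  also have "\<dots> \<le> 2 * (s j + s (j + 1)) / 1"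
  proof (intro frac_le mult_left_mono cons'(8))
    have eq: "(seg_tan X j + seg_tan X (j + 1)) - (seg_tan x j + seg_tan x (j + 1)) = \<sigma> j + \<sigma> (j + 1)" by simp
    show "norm ((seg_tan X j + seg_tan X (j + 1)) - (seg_tan x j + seg_tan x (j + 1))) \<le> s j + s (j + 1)"
      unfolding eq by (rule norm_triangle_ineq)
  qed auto
  finally have 1: "norm (mid_tan X j - mid_tan x j) \<le> 2 * (s j + s (j + 1))" by simp
  have "Z j - z j = F *\<^sub>R perp (mid_tan X j - mid_tan x j) + (F - g) *\<^sub>R perp (mid_tan x j)"
    by (simp add: perp_simps algebra_simps)
  also have "norm \<dots> \<le> M * (2 * (s j + s (j + 1))) + \<phi> * 1"
    unfolding norm_scaleR norm_perp
  proof (intro norm_triangle_mono)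
    show "norm (F *\<^sub>R perp (mid_tan X j - mid_tan x j)) \<le> M * (2 * (s j + s (j + 1)))"
      unfolding norm_scaleR norm_perp using 1 cons'(3) c by (intro mult_mono) auto
    show "norm ((F - g) *\<^sub>R perp (mid_tan x j)) \<le> \<phi> * 1"
      unfolding norm_scaleR norm_perp using F_diff norm_mid_tan_le by (intro mult_mono) auto
  qed
  also have "M * (2 * (s j + s (j + 1))) + \<phi> * 1 = 2 * M * (s j + s (j + 1)) + \<phi>" by simp
  finally show ?thesis .
qed

lemma Z_bound: "norm (V j + Z j) \<le> 2 * M" "norm (z j) \<le> 2 * M"
proof -
  have "norm (Z j) \<le> M * 1" unfolding norm_scaleR norm_perp using cons'(3) norm_mid_tan_le[of X j] c by (intro mult_mono) auto
  with cons'(6)[of j] show "norm (V j + Z j) \<le> 2 * M" by (intro norm_triangle_le) simp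
  have "\<bar>g\<bar> \<le> 2 * M" using F_diff cons'(3) c by linarith
  then have "norm (z j) \<le> 2 * M * 1" unfolding norm_scaleR norm_perp using norm_mid_tan_le[of x j] by (intro mult_mono) auto
  then show "norm (z j) \<le> 2 * M" by simp
qed

lemma tan_diff_X: "seg_tan X (j + 1) - seg_tan X j = P j *\<^sub>R (V j + Z j - R j)"
proof -
  have "0 < Q j + Q (j + 1)" using Q_pos by (simp add: add_pos_pos)
  from scheme_rhs_tangent_diff[OF this, of f N] show ?thesis by simp
qed

lemma tan_diff_x: "seg_tan x (j + 1) - seg_tan x j = p j *\<^sub>R (U j + z j)"
proof -
  have "0 < q j + q (j + 1)" using q_bounds(3) by (simp add: add_pos_pos)
  from scheme_rhs_tangent_diff[OF this, of f N] show ?thesis by simp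
qed

text \<open>Error equation of the tangents. Paired with \<open>V j - U j\<close>, the part
  \<open>p j *\<^sub>R (V j - U j)\<close> yields the dissipation
  \<open>p j * (a j)\<^sup>2\<close>; the other terms are linear in the remaining errors or contain
  the residual \<open>R j\<close>.\<close>

lemma sigma_diff: "\<sigma> (j + 1) - \<sigma> j
    = (P j - p j) *\<^sub>R (V j + Z j) - P j *\<^sub>R R j + p j *\<^sub>R ((V j - U j) + (Z j - z j))"
proof -
  have "\<sigma> (j + 1) - \<sigma> j = (seg_tan X (j + 1) - seg_tan X j) - (seg_tan x (j + 1) - seg_tan x j)" by simp
  then show ?thesis unfolding tan_diff_X tan_diff_x
    by (simp only: scaleR_diff_left scaleR_diff_right scaleR_add_right scaleR_add_left) simp
qed

lemma PR_bound: "norm (P j *\<^sub>R R j) \<le> h * (M\<^sup>2 * h\<^sup>2)"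
proof -
  have "norm (P j *\<^sub>R R j) \<le> (M * h) * (M * h\<^sup>2)"
    unfolding norm_scaleR using P_bound[of j] cons'(9)[of j] h c by (intro mult_mono) auto
  then show ?thesis by (simp add: power2_eq_square algebra_simps)
qed

lemma PV_bound: "norm ((P j - p j) *\<^sub>R (V j + Z j)) \<le> h * (M * (\<delta> j + \<delta> (j + 1)))"
proof -
  have "norm ((P j - p j) *\<^sub>R (V j + Z j)) \<le> (h * ((\<delta> j + \<delta> (j + 1)) / 2)) * (2 * M)"
    unfolding norm_scaleR using P_diff[of j] Z_bound(1)[of j] h c by (intro mult_mono) auto
  moreover have "(h * (u / 2)) * (2 * M) = h * (M * u)" for u by simp
  ultimately show ?thesis by (simp only:)
qed

lemma velocity_term: "- ((\<sigma> (j + 1) - \<sigma> j) \<bullet> (V j - U j)) \<le>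
    h * (- (p j / h) * (a j)\<^sup>2 + a j * (M * (\<delta> j + \<delta> (j + 1)) + 2 * M * (2 * M * (s j + s (j + 1)) + \<phi>) + M\<^sup>2 * h\<^sup>2))"
proof -
  let ?w = "(P j - p j) *\<^sub>R (V j + Z j) - P j *\<^sub>R R j + p j *\<^sub>R (Z j - z j)"
  have w: "norm ?w \<le> h * (M * (\<delta> j + \<delta> (j + 1))) + h * (M\<^sup>2 * h\<^sup>2) + h * (2 * M) * (2 * M * (s j + s (j + 1)) + \<phi>)"
  proof (intro norm_triangle_mono norm_triangle_le_diff add_mono PV_bound PR_bound)
    show "norm (p j *\<^sub>R (Z j - z j)) \<le> h * (2 * M) * (2 * M * (s j + s (j + 1)) + \<phi>)"
      unfolding norm_scaleR using p_bound[of j] Z_diff[of j] h c by (intro mult_mono) auto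
  qed
  have "\<sigma> (j + 1) - \<sigma> j = p j *\<^sub>R (V j - U j) + ?w"
    unfolding sigma_diff by (simp add: scaleR_add_right)
  then have "- ((\<sigma> (j + 1) - \<sigma> j) \<bullet> (V j - U j)) = - (p j * (a j)\<^sup>2) - ?w \<bullet> (V j - U j)"
    by (simp only: inner_add_left inner_scaleR_left power2_norm_eq_inner)
  also have "\<dots> \<le> - (p j * (a j)\<^sup>2) + norm ?w * a j"
    using Cauchy_Schwarz_ineq2[of ?w "V j - U j"] by linarith
  also have "\<dots> \<le> - (p j * (a j)\<^sup>2) + (h * (M * (\<delta> j + \<delta> (j + 1))) + h * (M\<^sup>2 * h\<^sup>2) + h * (2 * M) * (2 * M * (s j + s (j + 1)) + \<phi>)) * a j"
    using w by (intro add_left_mono mult_right_mono) auto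
  also have "\<dots> = h * (- (p j / h) * (a j)\<^sup>2 + a j * (M * (\<delta> j + \<delta> (j + 1)) + 2 * M * (2 * M * (s j + s (j + 1)) + \<phi>) + M\<^sup>2 * h\<^sup>2))"
  proof -
    have "h * ((p j / h) * (a j)\<^sup>2) = p j * (a j)\<^sup>2" using h by simp
    then show ?thesis by (simp only: distrib_left distrib_right mult_minus_left mult_minus_right ac_simps)
  qed
  finally show ?thesis .
qed

abbreviation "G j \<equiv> (seg_tan X (j + 1) - seg_tan X j) \<bullet> V j - (seg_tan x (j + 1) - seg_tan x j) \<bullet> U j"

text \<open>An a priori bound is available for \<open>V\<close> but not for \<open>U\<close>, so
  \<open>U\<close> is replaced by \<open>V\<close> minus the velocity error throughout. The square
  of this error that appears is harmless only because \<open>G\<close> will be multiplied by a small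
  relative length error.\<close>

lemma G_bound: "\<bar>G j\<bar> \<le> h * (M\<^sup>2 * (\<delta> j + \<delta> (j + 1)) + M ^ 3 * h\<^sup>2
    + 2 * M * (2 * M\<^sup>2 * (s j + s (j + 1)) + M * \<phi> + 4 * M * a j) + p j / h * (a j)\<^sup>2)"
proof -
  define e where "e = V j - U j"
  have eq: "G j = ((P j - p j) *\<^sub>R (V j + Z j)) \<bullet> V j - (P j *\<^sub>R R j) \<bullet> V j
      + p j * ((Z j - z j) \<bullet> V j + 2 * (V j \<bullet> e) + z j \<bullet> e - e \<bullet> e)"
    unfolding tan_diff_X tan_diff_x e_def
    by (simp only: inner_add_left inner_diff_left inner_scaleR_left inner_add_right inner_diff_right
        inner_commute[of "U j" "V j"]) (simp only: algebra_simps)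
  have "\<bar>G j\<bar> \<le> h * (M * (\<delta> j + \<delta> (j + 1))) * M + h * (M\<^sup>2 * h\<^sup>2) * M
      + (h * (2 * M) * ((2 * M * (s j + s (j + 1)) + \<phi>) * M + 2 * (M * a j) + 2 * M * a j) + p j * (a j)\<^sup>2)"
  proof -
    have cs: "\<bar>u \<bullet> v\<bar> \<le> b * k" if "norm u \<le> b" "norm v \<le> k" for u v :: "real^2" and b k
      by (rule order_trans[OF Cauchy_Schwarz_ineq2])
        (intro mult_mono that norm_ge_zero order_trans[OF norm_ge_zero that(1)])
    have 1: "\<bar>((P j - p j) *\<^sub>R (V j + Z j)) \<bullet> V j\<bar> \<le> h * (M * (\<delta> j + \<delta> (j + 1))) * M"
      by (intro cs PV_bound cons')
    have 2: "\<bar>(P j *\<^sub>R R j) \<bullet> V j\<bar> \<le> h * (M\<^sup>2 * h\<^sup>2) * M"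
      by (intro cs PR_bound cons')
    have 3: "\<bar>(Z j - z j) \<bullet> V j\<bar> \<le> (2 * M * (s j + s (j + 1)) + \<phi>) * M"
      by (intro cs Z_diff cons')
    have 4: "\<bar>V j \<bullet> e\<bar> \<le> M * a j" "\<bar>z j \<bullet> e\<bar> \<le> 2 * M * a j"
      unfolding e_def by (intro cs Z_bound cons' order_refl)+
    have t: "\<bar>(Z j - z j) \<bullet> V j + 2 * (V j \<bullet> e) + z j \<bullet> e\<bar> \<le> (2 * M * (s j + s (j + 1)) + \<phi>) * M + 2 * (M * a j) + 2 * M * a j"
      using 3 4 by linarith
    have 5: "\<bar>p j * ((Z j - z j) \<bullet> V j + 2 * (V j \<bullet> e) + z j \<bullet> e)\<bar>
        \<le> h * (2 * M) * ((2 * M * (s j + s (j + 1)) + \<phi>) * M + 2 * (M * a j) + 2 * M * a j)"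
      unfolding abs_mult abs_of_pos[OF p_bound(3)]
      by (rule mult_mono[OF p_bound(1) t]) (use h c in simp_all)
    have 6: "\<bar>p j * (e \<bullet> e)\<bar> = p j * (a j)\<^sup>2"
      unfolding abs_mult abs_of_pos[OF p_bound(3)] by (simp add: e_def power2_norm_eq_inner)
    have "\<bar>t - t' + (u - u')\<bar> \<le> b + b' + (k + k')"
      if "\<bar>t\<bar> \<le> b" "\<bar>t'\<bar> \<le> b'" "\<bar>u\<bar> \<le> k" "\<bar>u'\<bar> = k'" for t t' u u' b b' k k' :: real
      using that by linarith
    from this[OF 1 2 5 6] show ?thesis unfolding eq right_diff_distrib[of "p j"] .
  qed
  also have "\<dots> = h * (M\<^sup>2 * (\<delta> j + \<delta> (j + 1)) + M ^ 3 * h\<^sup>2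
    + 2 * M * (2 * M\<^sup>2 * (s j + s (j + 1)) + M * \<phi> + 4 * M * a j) + p j / h * (a j)\<^sup>2)"
  proof -
    have 1: "h * ((p j / h) * (a j)\<^sup>2) = p j * (a j)\<^sup>2" using h by simp
    have 2: "(h * (M * u)) * M + (h * (M\<^sup>2 * k)) * M
      + (h * (2 * M) * ((2 * M * v + w) * M + 2 * (M * b) + 2 * M * b) + y)
      = h * (M\<^sup>2 * u + M ^ 3 * k + 2 * M * (2 * M\<^sup>2 * v + M * w + 4 * M * b)) + y" for u v w b k y
      by (simp add: algebra_simps power2_eq_square power3_eq_cube)
    show ?thesis unfolding distrib_left[of h _ "p j / h * (a j)\<^sup>2"] 1 by (rule 2)
  qed
  finally show ?thesis .
qed

text \<open>By \<open>scheme_rhs_orthogonal\<close> half of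
  \<open>(seg_tan x j + seg_tan x (j + 1)) \<bullet> U j = 0\<close> may be inserted at each end of
  the edge, which leaves tangent jumps paired with single velocities. For the exact polygon this
  orthogonality has a defect; its variation along the edge is the first term, of order h^3 by
  consistency.\<close>

lemma length_rate_identity:
  "seg_tan X j \<bullet> (V j - V (j - 1)) - seg_tan x j \<bullet> (U j - U (j - 1))
    = ((seg_tan X j + seg_tan X (j + 1)) \<bullet> V j - (seg_tan X (j - 1) + seg_tan X j) \<bullet> V (j - 1)) / 2
      - (G j + G (j - 1)) / 2"
proof -
  have orth: "(seg_tan x i + seg_tan x (i + 1)) \<bullet> U i = 0" for i
    unfolding inner_commute[of _ "U i"]
    by (rule scheme_rhs_orthogonal) (metis q_bounds(3) less_irrefl)+
  have gen: "T \<bullet> (A - B) - t \<bullet> (u - w)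
      = ((T + T1) \<bullet> A - (T0 + T) \<bullet> B) / 2 - (((T1 - T) \<bullet> A - (t1 - t) \<bullet> u) + ((T - T0) \<bullet> B - (t - t0) \<bullet> w)) / 2"
    if "(t + t1) \<bullet> u = 0" "(t0 + t) \<bullet> w = 0" for T T0 T1 t t0 t1 A B u w :: "real^2"
    using that by (simp add: inner_diff_left inner_diff_right inner_add_left field_simps)
  show ?thesis using gen[OF orth[of j] orth[of "j - 1", unfolded diff_add_cancel]] by simp
qed

lemma tangent_term: "seg_tan x j \<bullet> (U j - U (j - 1)) - dsgn (X j - X (j - 1)) (V j - V (j - 1)) \<bullet> (x j - x (j - 1))
    - seg_tan X j \<bullet> (U j - U (j - 1))
    \<le> \<sigma> j \<bullet> ((V j - U j) - (V (j - 1) - U (j - 1))) + h * (M * (s j)\<^sup>2 / 2 + 2 * M / c * (\<delta> j * s j))"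
proof -
  let ?Dv = "X j - X (j - 1)" and ?dv = "x j - x (j - 1)" and ?W = "V j - V (j - 1)"
  have Dv: "?Dv \<noteq> 0" using Q_pos[of j] by (auto simp: seg_len_def)
  have un: "norm (sgn ?Dv) = 1" "norm (sgn ?dv) = 1"
    using Q_pos[of j] q_bounds(3)[of j] by (auto simp: norm_sgn seg_len_def)
  have W: "\<bar>sgn ?Dv \<bullet> ?W\<bar> \<le> M * h"
    using abs_inner_sgn_le[of ?Dv ?W] cons'(7)[of j] by linarith
  have eq: "seg_tan x j \<bullet> (U j - U (j - 1)) - dsgn ?Dv ?W \<bullet> ?dv - seg_tan X j \<bullet> (U j - U (j - 1))
    = \<sigma> j \<bullet> (?W - (U j - U (j - 1))) - (sgn ?Dv \<bullet> ?W) * ((s j)\<^sup>2 / 2)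
      + (Q j - q j) * (dsgn ?Dv ?W \<bullet> sgn ?dv)"
    using energy_term_eq[OF Dv, of ?dv "U j - U (j - 1)" ?W] unit_inner_deficit[OF un]
    by (simp add: seg_tan_eq_sgn seg_len_def)
  have 1: "- ((sgn ?Dv \<bullet> ?W) * ((s j)\<^sup>2 / 2)) \<le> (M * h) * ((s j)\<^sup>2 / 2)"
    unfolding mult_minus_left[symmetric] using W by (intro mult_right_mono) auto
  have "\<bar>dsgn ?Dv ?W \<bullet> sgn ?dv\<bar> \<le> 2 * norm ?W / Q j * s j"
    using dsgn_inner_le[of ?Dv ?W ?dv] by (simp add: seg_tan_eq_sgn seg_len_def)
  also have "\<dots> \<le> 2 * (M * h) / (c * h) * s j"
    using cons'(4)[of j] cons'(7)[of j] h c by (intro mult_right_mono frac_le mult_left_mono) auto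
  also have "\<dots> = 2 * M / c * s j" using h by simp
  finally have 3: "\<bar>dsgn ?Dv ?W \<bullet> sgn ?dv\<bar> \<le> 2 * M / c * s j" .
  have "(Q j - q j) * (dsgn ?Dv ?W \<bullet> sgn ?dv) \<le> \<bar>Q j - q j\<bar> * \<bar>dsgn ?Dv ?W \<bullet> sgn ?dv\<bar>"
    by (simp flip: abs_mult)
  also have "\<dots> \<le> \<bar>Q j - q j\<bar> * (2 * M / c * s j)" by (intro mult_left_mono 3) simp
  also have "\<dots> = h * (2 * M / c * (\<delta> j * s j))" using h by simp
  finally have 2: "(Q j - q j) * (dsgn ?Dv ?W \<bullet> sgn ?dv) \<le> h * (2 * M / c * (\<delta> j * s j))" .
  have 4: "A - B + C \<le> A + h * (b + d)" if "- B \<le> (M * h) * b'" "C \<le> h * d" "M * h * b' = h * b" for A B C b b' d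
    using that by (simp add: distrib_left)
  have "(V j - U j) - (V (j - 1) - U (j - 1)) = ?W - (U j - U (j - 1))" by simp
  then show ?thesis unfolding eq by (simp only:) (rule 4[OF 1 2], simp)
qed

lemma length_term: "2 * (Q j - q j) * (seg_tan X j \<bullet> (V j - V (j - 1)) - seg_tan x j \<bullet> (U j - U (j - 1))) / h
    \<le> \<delta> j * (M * h ^ 3 + \<bar>G j\<bar> + \<bar>G (j - 1)\<bar>)"
proof -
  let ?r = "seg_tan X j \<bullet> (V j - V (j - 1)) - seg_tan x j \<bullet> (U j - U (j - 1))"
  have r: "2 * \<bar>?r\<bar> \<le> M * h ^ 3 + \<bar>G j\<bar> + \<bar>G (j - 1)\<bar>"
  proof -
    have "2 * \<bar>S / 2 - (y + y') / 2\<bar> \<le> k + \<bar>y\<bar> + \<bar>y'\<bar>" if "\<bar>S\<bar> \<le> k" for S y y' k :: real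
    proof -
      have "S / 2 - (y + y') / 2 = (S - y - y') / 2" by (simp add: field_simps)
      then have "2 * \<bar>S / 2 - (y + y') / 2\<bar> = \<bar>S - y - y'\<bar>" by (simp only: abs_divide) simp
      then show ?thesis using that by linarith
    qed
    from this[OF cons'(10)[of j]] show ?thesis unfolding length_rate_identity .
  qed
  have "2 * (Q j - q j) * ?r / h \<le> \<bar>2 * (Q j - q j) * ?r / h\<bar>" by (rule abs_ge_self)
  also have "\<dots> = \<delta> j * (2 * \<bar>?r\<bar>)"
    unfolding abs_mult abs_divide abs_of_pos[OF h] by (simp only: ac_simps times_divide_eq_right times_divide_eq_left abs_numeral)
  also have "\<dots> \<le> \<delta> j * (M * h ^ 3 + \<bar>G j\<bar> + \<bar>G (j - 1)\<bar>)"
    using r h by (intro mult_left_mono) auto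
  finally show ?thesis .
qed

lemma position_term: "2 * h * ((X j - x j) \<bullet> (V j - U j)) \<le> h * (2 * \<eta> j * a j)"
  using Cauchy_Schwarz_ineq2[of "X j - x j" "V j - U j"] h by simp

lemma grid_energy_lower: "c / 4 * (h * (s j)\<^sup>2) \<le> q j - seg_tan X j \<bullet> (x j - x (j - 1))"
proof -
  have un: "norm (seg_tan X j) = 1" "norm (seg_tan x j) = 1"
    using Q_pos[of j] q_bounds(3)[of j] by (auto simp: norm_seg_tan)
  have "x j - x (j - 1) = q j *\<^sub>R seg_tan x j" using q_bounds(3)[of j] by (simp add: seg_tan_def)
  then have "q j - seg_tan X j \<bullet> (x j - x (j - 1)) = q j * (1 - seg_tan X j \<bullet> seg_tan x j)"
    by (simp add: algebra_simps)
  also have "\<dots> = q j * ((s j)\<^sup>2 / 2)" by (simp add: unit_inner_deficit[OF un])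
  also have "\<dots> \<ge> (c / 2 * h) * ((s j)\<^sup>2 / 2)" by (intro mult_right_mono q_bounds) auto
  finally show ?thesis by simp
qed

lemma grid_energy_bounds:
  "(\<Sum>j=1..int N. c / 4 * (h * (s j)\<^sup>2) + h * (\<delta> j)\<^sup>2 + h * (\<eta> j)\<^sup>2) \<le> grid_energy N X x"
  unfolding grid_energy_def
proof (rule sum_mono)
  fix j
  have "h * (\<delta> j)\<^sup>2 = (Q j - q j)\<^sup>2 / h" using h by (simp add: power_divide power2_eq_square)
  then show "c / 4 * (h * (s j)\<^sup>2) + h * (\<delta> j)\<^sup>2 + h * (\<eta> j)\<^sup>2
    \<le> q j - seg_tan X j \<bullet> (x j - x (j - 1)) + (Q j - q j)\<^sup>2 / h + h * (norm (X j - x j))\<^sup>2"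
    using grid_energy_lower[of j] by simp
qed

lemmas U_periodic = scheme_rhs_periodic[OF x_per, where f = f]

lemmas periodic = grid_fun_seg[OF x_per] grid_fun_seg[OF cons'(1)] U_periodic
  grid_fun_seg(3,4)[OF cons'(2)]

lemma rate_by_local_terms: "grid_energy_rate N X V x U \<le> (\<Sum>j=1..int N.
    h * (rate_const c M * (\<delta> j + \<delta> (j + 1) + s j + s (j + 1) + \<phi> + h\<^sup>2 + \<eta> j)\<^sup>2))"
proof -
  define e where "e = (\<lambda>j. V j - U j)"
  define t where "t = (\<lambda>j. h * (M * (s j)\<^sup>2 / 2 + 2 * M / c * (\<delta> j * s j)) + \<delta> j * (M * h ^ 3) + h * (2 * \<eta> j * a j))"
  have pe: "e (j + int N) = e j" for j by (simp add: e_def periodic)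
  define Gf where "Gf = (\<lambda>j. G j)"
  have pG: "Gf (j + int N - 1) = Gf (j - 1)" for j
    using U_periodic[of "j - 1"] grid_fun_seg(2)[OF x_per, of "j - 1"] grid_fun_seg(2)[OF cons'(1), of "j - 1"]
    by (simp add: periodic diff_add_eq Gf_def)
  have pe1: "e (j + int N - 1) = e (j - 1)" for j
    using pe[of "j - 1"] by (simp add: diff_add_eq)
  \<comment> \<open>Summation by parts: the difference passes from the velocity error to the tangent
    error, where \<open>sigma_diff\<close> applies.\<close>
  have shift1: "(\<Sum>j=1..int N. \<sigma> j \<bullet> e (j - 1)) = (\<Sum>j=1..int N. \<sigma> (j + 1) \<bullet> e j)"
    using sum_periodic_shift(1)[where a = "\<lambda>j. \<sigma> j \<bullet> e (j - 1)" and N = N]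
    unfolding pe1 periodic by simp
  \<comment> \<open>The same shift gathers all occurrences of \<open>G j\<close>, hence of
    \<open>a j\<close>, at node \<open>j\<close>, where the dissipation of that node can absorb
    them.\<close>
  have "(\<Sum>j=1..int N. \<delta> j * \<bar>Gf (j - 1)\<bar>) = (\<Sum>j=1..int N. \<delta> (j + 1) * \<bar>Gf j\<bar>)"
    using sum_periodic_shift(1)[where a = "\<lambda>j. \<delta> j * \<bar>Gf (j - 1)\<bar>" and N = N]
    unfolding pG periodic by simp
  then have shift2: "(\<Sum>j=1..int N. \<delta> j * \<bar>G (j - 1)\<bar>) = (\<Sum>j=1..int N. \<delta> (j + 1) * \<bar>G j\<bar>)"
    unfolding Gf_def .
  have "grid_energy_rate N X V x U \<le>
    (\<Sum>j=1..int N. (\<sigma> j \<bullet> e j - \<sigma> j \<bullet> e (j - 1)) + t j + (\<delta> j * \<bar>G j\<bar> + \<delta> j * \<bar>G (j - 1)\<bar>))"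
    unfolding grid_energy_rate_def
  proof (rule sum_mono)
    fix j
    show "(seg_tan x j \<bullet> (U j - U (j - 1)) - dsgn (X j - X (j - 1)) (V j - V (j - 1)) \<bullet> (x j - x (j - 1))
         - seg_tan X j \<bullet> (U j - U (j - 1)))
       + 2 * (Q j - q j) * (seg_tan X j \<bullet> (V j - V (j - 1)) - seg_tan x j \<bullet> (U j - U (j - 1))) / h
       + 2 * h * ((X j - x j) \<bullet> (V j - U j))
      \<le> (\<sigma> j \<bullet> e j - \<sigma> j \<bullet> e (j - 1)) + t j + (\<delta> j * \<bar>G j\<bar> + \<delta> j * \<bar>G (j - 1)\<bar>)"
      using tangent_term[of j] length_term[of j] position_term[of j]
      unfolding t_def e_def inner_diff_right[of "\<sigma> j" "V j - U j"] distrib_left[of "\<delta> j"] by linarith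
  qed
  also have "\<dots> = (\<Sum>j=1..int N. \<sigma> j \<bullet> e j) - (\<Sum>j=1..int N. \<sigma> j \<bullet> e (j - 1)) + (\<Sum>j=1..int N. t j)
      + ((\<Sum>j=1..int N. \<delta> j * \<bar>G j\<bar>) + (\<Sum>j=1..int N. \<delta> j * \<bar>G (j - 1)\<bar>))"
    by (simp only: sum.distrib sum_subtractf)
  also have "\<dots> = (\<Sum>j=1..int N. \<sigma> j \<bullet> e j) - (\<Sum>j=1..int N. \<sigma> (j + 1) \<bullet> e j) + (\<Sum>j=1..int N. t j)
      + ((\<Sum>j=1..int N. \<delta> j * \<bar>G j\<bar>) + (\<Sum>j=1..int N. \<delta> (j + 1) * \<bar>G j\<bar>))"
    by (simp only: shift1 shift2)
  also have "\<dots> = (\<Sum>j=1..int N. - ((\<sigma> (j + 1) - \<sigma> j) \<bullet> e j) + t j + (\<delta> j + \<delta> (j + 1)) * \<bar>G j\<bar>)"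
    by (simp only: sum.distrib[symmetric] sum_subtractf[symmetric] inner_diff_left[of "\<sigma> _"]
        distrib_right[of "\<delta> _"] minus_diff_eq)
  also have "\<dots> \<le> (\<Sum>j=1..int N. h * (rate_const c M * (\<delta> j + \<delta> (j + 1) + s j + s (j + 1) + \<phi> + h\<^sup>2 + \<eta> j)\<^sup>2))"
  proof (rule sum_mono)
    fix j
    let ?B = "M\<^sup>2 * (\<delta> j + \<delta> (j + 1)) + M ^ 3 * h\<^sup>2
      + 2 * M * (2 * M\<^sup>2 * (s j + s (j + 1)) + M * \<phi> + 4 * M * a j) + p j / h * (a j)\<^sup>2"
    let ?A = "- (p j / h) * (a j)\<^sup>2 + a j * (M * (\<delta> j + \<delta> (j + 1)) + 2 * M * (2 * M * (s j + s (j + 1)) + \<phi>) + M\<^sup>2 * h\<^sup>2)"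
    have "\<delta> i \<le> \<epsilon>" for i using D_le(2)[of i] h by (simp add: divide_le_eq)
    from this[of j] this[of "j + 1"] have dd: "\<delta> j + \<delta> (j + 1) \<le> 1/2" using \<epsilon> c by linarith
    have 0: "0 \<le> \<delta> i" for i using h by simp
    have "(\<delta> j + \<delta> (j + 1)) * \<bar>G j\<bar> \<le> (\<delta> j + \<delta> (j + 1)) * (h * ?B)"
      by (intro mult_left_mono G_bound add_nonneg_nonneg 0)
    then have "- ((\<sigma> (j + 1) - \<sigma> j) \<bullet> e j) + t j + (\<delta> j + \<delta> (j + 1)) * \<bar>G j\<bar>
        \<le> h * ?A + t j + (\<delta> j + \<delta> (j + 1)) * (h * ?B)"
      unfolding e_def by (intro add_mono velocity_term order_refl)
    also have "\<dots> = h * (?A + M * (s j)\<^sup>2 / 2 + 2 * M / c * (\<delta> j * s j) + M * (\<delta> j * h\<^sup>2)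
        + (\<delta> j + \<delta> (j + 1)) * ?B + 2 * \<eta> j * a j)"
    proof -
      have "h * A + (h * (b1 + b2) + d * (M * h ^ 3) + h * b3) + dd * (h * B)
        = h * (A + b1 + b2 + M * (d * h\<^sup>2) + dd * B + b3)" for A b1 b2 b3 d dd B
        by (simp add: algebra_simps power2_eq_square power3_eq_cube)
      then show ?thesis unfolding t_def .
    qed
    also have "\<dots> \<le> h * (rate_const c M * (\<delta> j + \<delta> (j + 1) + s j + s (j + 1) + \<phi> + h\<^sup>2 + \<eta> j)\<^sup>2)"
    proof (intro mult_left_mono)
      have "c / 2 \<le> p j / h" using p_bound(2)[of j] h by (simp add: pos_le_divide_eq)
      from dissipation_absorbs[OF _ 0 0 _ _ F_diff(2) _ _ dd c(1) this c(3), of "a j" "s j" "s (j + 1)" "h\<^sup>2" "\<eta> j"]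
      show "?A + M * (s j)\<^sup>2 / 2 + 2 * M / c * (\<delta> j * s j) + M * (\<delta> j * h\<^sup>2)
        + (\<delta> j + \<delta> (j + 1)) * ?B + 2 * \<eta> j * a j
        \<le> rate_const c M * (\<delta> j + \<delta> (j + 1) + s j + s (j + 1) + \<phi> + h\<^sup>2 + \<eta> j)\<^sup>2" by simp
    qed (use h in simp)
    finally show "- ((\<sigma> (j + 1) - \<sigma> j) \<bullet> e j) + t j + (\<delta> j + \<delta> (j + 1)) * \<bar>G j\<bar>
      \<le> h * (rate_const c M * (\<delta> j + \<delta> (j + 1) + s j + s (j + 1) + \<phi> + h\<^sup>2 + \<eta> j)\<^sup>2)" .
  qed
  finally show ?thesis .
qed

text \<open>The factor 7 is that of \<open>sum_square_le\<close>. In the bracket, 3 counts two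
  length errors and one position error, \<open>8 / c\<close> is two tangent errors of
  \<open>4 / c\<close> each, \<open>4 * pi\<^sup>2 * \<Lambda>\<^sup>2\<close> is the forcing, and
  \<open>2 * pi\<close> is the squared residual \<open>h ^ 4\<close> summed with weight
  \<open>h\<close>.\<close>

lemma energy_rate_bound:
  "grid_energy_rate N X V x U
    \<le> 7 * rate_const c M * (3 + 8 / c + 4 * pi\<^sup>2 * \<Lambda>\<^sup>2 + 2 * pi) * (grid_energy N X x + h ^ 4)"
proof -
  let ?K = "rate_const c M" and ?E = "grid_energy N X x"
  have K: "0 \<le> ?K" unfolding rate_const_def using c by simp
  have hn: "h * real N = 2 * pi" using mesh_times[OF N] by (simp add: mult.commute)
  define fd fs fe where "fd = (\<lambda>j. h * (\<delta> j)\<^sup>2)" and "fs = (\<lambda>j. h * (s j)\<^sup>2)"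
    and "fe = (\<lambda>j. h * (\<eta> j)\<^sup>2)"
  define Sd Ss Se where "Sd = sum fd {1..int N}" and "Ss = sum fs {1..int N}" and "Se = sum fe {1..int N}"
  have nn: "0 \<le> Sd" "0 \<le> Ss" "0 \<le> Se"
    unfolding Sd_def Ss_def Se_def fd_def fs_def fe_def using h by (auto intro!: sum_nonneg)
  have E: "c / 4 * Ss + Sd + Se \<le> ?E"
    using grid_energy_bounds unfolding Sd_def Ss_def Se_def fd_def fs_def fe_def
    by (simp only: sum.distrib sum_distrib_left)
  have "fd (j + int N) = fd j" "fs (j + int N) = fs j" for j
    unfolding fd_def fs_def by (simp_all only: periodic)
  then have shift: "(\<Sum>j=1..int N. fd (j + 1)) = Sd" "(\<Sum>j=1..int N. fs (j + 1)) = Ss"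
    unfolding Sd_def Ss_def by (intro sum_periodic_shift(1); simp)+
  have phi: "h * (real N * \<phi>\<^sup>2) \<le> 4 * pi\<^sup>2 * \<Lambda>\<^sup>2 * Sd"
  proof -
    have "fd j = (Q j - q j)\<^sup>2 / h" for j
      unfolding fd_def using h by (simp add: power_divide power2_eq_square)
    then have "Sd = (\<Sum>j=1..int N. (Q j - q j)\<^sup>2 / h)" unfolding Sd_def by (intro sum.cong) auto
    then show ?thesis using \<phi>_square by (simp only:)
  qed
  have "grid_energy_rate N X V x U \<le> (\<Sum>j=1..int N. 7 * ?K * (fd j + fd (j + 1)
      + fs j + fs (j + 1) + h * \<phi>\<^sup>2 + h * h ^ 4 + fe j))"
  proof (rule order_trans[OF rate_by_local_terms], rule sum_mono)
    fix j
    have "h * (?K * (\<delta> j + \<delta> (j + 1) + s j + s (j + 1) + \<phi> + h\<^sup>2 + \<eta> j)\<^sup>2)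
      \<le> h * (?K * (7 * ((\<delta> j)\<^sup>2 + (\<delta> (j + 1))\<^sup>2 + (s j)\<^sup>2 + (s (j + 1))\<^sup>2 + \<phi>\<^sup>2 + (h\<^sup>2)\<^sup>2 + (\<eta> j)\<^sup>2)))"
      using h K by (intro mult_left_mono sum_square_le) auto
    moreover have "h * (K * (7 * (b1 + b2 + b3 + b4 + b5 + (h\<^sup>2)\<^sup>2 + b7)))
      = 7 * K * (h * b1 + h * b2 + h * b3 + h * b4 + h * b5 + h * h ^ 4 + h * b7)" for K b1 b2 b3 b4 b5 b7
      by (simp add: algebra_simps)
    ultimately show "h * (?K * (\<delta> j + \<delta> (j + 1) + s j + s (j + 1) + \<phi> + h\<^sup>2 + \<eta> j)\<^sup>2)
      \<le> 7 * ?K * (fd j + fd (j + 1) + fs j + fs (j + 1) + h * \<phi>\<^sup>2 + h * h ^ 4 + fe j)"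
      unfolding fd_def fs_def fe_def by (simp only:)
  qed
  also have "\<dots> = 7 * ?K * (Sd + Sd + Ss + Ss + h * (real N * \<phi>\<^sup>2) + h * real N * h ^ 4 + Se)"
    unfolding sum_distrib_left[of "7 * ?K", symmetric] sum.distrib shift Sd_def Ss_def Se_def
    by simp
  also have "\<dots> \<le> 7 * ?K * ((3 + 8 / c + 4 * pi\<^sup>2 * \<Lambda>\<^sup>2 + 2 * pi) * (?E + h ^ 4))"
  proof (rule mult_left_mono)
    have Ss: "Ss \<le> 4 / c * ?E"
    proof -
      have "c * Ss \<le> 4 * ?E" using E nn by linarith
      then show ?thesis using c by (simp add: field_simps)
    qed
    have "Sd \<le> ?E" "Se \<le> ?E"
      using E nn c mult_nonneg_nonneg[of "c / 4" Ss] by linarith+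
    have w: "4 * pi\<^sup>2 * \<Lambda>\<^sup>2 * Sd \<le> 4 * pi\<^sup>2 * \<Lambda>\<^sup>2 * ?E"
      using \<open>Sd \<le> ?E\<close> by (intro mult_left_mono) auto
    have "sd + sd + ss + ss + ph + y + se \<le> (3 + 2 * u + w) * E + y"
      if "ss \<le> u * E" "sd \<le> E" "se \<le> E" "w * sd \<le> w * E" "ph \<le> w * sd" for sd ss se ph y u w E :: real
      unfolding distrib_right mult.assoc[of 2 u] using that by linarith
    note 1 = this[OF Ss \<open>Sd \<le> ?E\<close> \<open>Se \<le> ?E\<close> w phi, of "h * real N * h ^ 4", unfolded hn]
    have E0: "0 \<le> ?E" using \<open>Sd \<le> ?E\<close> nn by linarith
    have "0 \<le> 2 * pi * ?E" "0 \<le> (3 + 8 / c + 4 * pi\<^sup>2 * \<Lambda>\<^sup>2) * h ^ 4" using E0 c h by simp_all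
    then have 2: "(3 + 8 / c + 4 * pi\<^sup>2 * \<Lambda>\<^sup>2) * ?E + 2 * pi * h ^ 4
        \<le> (3 + 8 / c + 4 * pi\<^sup>2 * \<Lambda>\<^sup>2 + 2 * pi) * (?E + h ^ 4)"
      by (simp add: distrib_left distrib_right)
    have "2 * (4 / c) = 8 / c" by simp
    from order_trans[OF 1[unfolded this] 2] show "Sd + Sd + Ss + Ss + h * (real N * \<phi>\<^sup>2) + h * real N * h ^ 4 + Se
        \<le> (3 + 8 / c + 4 * pi\<^sup>2 * \<Lambda>\<^sup>2 + 2 * pi) * (?E + h ^ 4)"
      unfolding hn .
  qed (use K in simp)
  finally show ?thesis by (simp only: mult.assoc)
qed

text \<open>An edge difference is the length error along the exact tangent plus \<open>q j\<close>
  times the tangent error. The energy carries the square of the first with weight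
  \<open>1 / h\<close> and that of the tangent error with weight \<open>q j / 2\<close>, so in both
  cases a factor \<open>h\<close> is gained.\<close>

lemma energy_controls_difference:
  "(\<Sum>j=1..int N. (norm ((X j - x j) - (X (j - 1) - x (j - 1))))\<^sup>2) \<le> 8 * M * h * grid_energy N X x"
  unfolding grid_energy_def sum_distrib_left
proof (rule sum_mono)
  fix j
  let ?L = "q j - seg_tan X j \<bullet> (x j - x (j - 1))" and ?D = "(Q j - q j)\<^sup>2 / h"
  have un: "norm (seg_tan X j) = 1" "norm (seg_tan x j) = 1"
    using Q_pos[of j] q_bounds(3)[of j] by (auto simp: norm_seg_tan)
  have dx: "x j - x (j - 1) = q j *\<^sub>R seg_tan x j" and dX: "X j - X (j - 1) = Q j *\<^sub>R seg_tan X j"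
    using q_bounds(3)[of j] Q_pos[of j] by (simp_all add: seg_tan_def)
  have L: "?L = q j * ((s j)\<^sup>2 / 2)"
    unfolding dx unit_inner_deficit[OF un, symmetric] by (simp add: algebra_simps)
  have "(X j - x j) - (X (j - 1) - x (j - 1)) = (Q j - q j) *\<^sub>R seg_tan X j + q j *\<^sub>R \<sigma> j"
    using dx dX by (simp add: algebra_simps)
  then have "norm ((X j - x j) - (X (j - 1) - x (j - 1))) \<le> \<bar>Q j - q j\<bar> + q j * s j"
    using norm_triangle_ineq[of "(Q j - q j) *\<^sub>R seg_tan X j" "q j *\<^sub>R \<sigma> j"] un q_bounds(3)[of j]
    by simp
  then have "(norm ((X j - x j) - (X (j - 1) - x (j - 1))))\<^sup>2 \<le> (\<bar>Q j - q j\<bar> + q j * s j)\<^sup>2"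
    by (intro power_mono) auto
  also have "\<dots> \<le> 2 * (Q j - q j)\<^sup>2 + 2 * (q j * s j)\<^sup>2"
    using sum_squares_bound[of "\<bar>Q j - q j\<bar>" "q j * s j"] by (simp add: power2_sum)
  also have "\<dots> = 2 * h * ?D + 4 * q j * ?L"
    unfolding L using h by (simp add: power2_eq_square)
  also have "\<dots> \<le> 8 * M * h * ?D + 4 * (2 * M * h) * ?L"
  proof (intro add_mono mult_right_mono mult_left_mono q_bounds)
    show "2 \<le> 8 * M" using c by simp
    show "0 \<le> ?L" unfolding L using q_bounds(3)[of j] by simp
  qed (use h in auto)
  also have "\<dots> \<le> 8 * M * h * (?L + ?D + h * (\<eta> j)\<^sup>2)"
    using h c by (simp add: algebra_simps)
  finally show "(norm ((X j - x j) - (X (j - 1) - x (j - 1))))\<^sup>2 \<le> 8 * M * h * (?L + ?D + h * (\<eta> j)\<^sup>2)" .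
qed

lemma scheme_defined_near: "scheme_defined N x"
proof -
  have "seg_tan x j + seg_tan x (j + 1) \<noteq> 0" for j
    using mid_ge[of j] by (metis half_gt_zero less_le_not_le norm_zero zero_less_one)
  then show ?thesis unfolding scheme_defined_def by (auto simp: less_imp_neq[OF q_bounds(3), symmetric])
qed

end

section \<open>Time derivatives of norms and unit vectors; reduction of indices\<close>

lemma has_real_derivative_norm:
  fixes y :: "real \<Rightarrow> 'a::real_inner"
  assumes "(y has_vector_derivative y') (at t within S)" "y t \<noteq> 0"
  shows "((\<lambda>t. norm (y t)) has_real_derivative sgn (y t) \<bullet> y') (at t within S)"
proof -
  have "((\<lambda>t. norm (y t)) has_derivative (\<lambda>h. (h *\<^sub>R y') \<bullet> sgn (y t))) (at t within S)"
    using has_derivative_compose[OF assms(1)[unfolded has_vector_derivative_def] has_derivative_norm[OF assms(2)]] .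
  then show ?thesis
    by (rule has_derivative_imp_has_field_derivative) (simp add: inner_commute)
qed

lemma has_real_derivative_inner:
  fixes y z :: "real \<Rightarrow> 'a::real_inner"
  assumes "(y has_vector_derivative y') (at t within S)" "(z has_vector_derivative z') (at t within S)"
  shows "((\<lambda>t. y t \<bullet> z t) has_real_derivative y t \<bullet> z' + y' \<bullet> z t) (at t within S)"
  by (rule has_derivative_imp_has_field_derivative[OF has_derivative_inner[OF assms[unfolded has_vector_derivative_def]]])
    (simp add: distrib_left)

lemma has_vector_derivative_sgn:
  fixes y :: "real \<Rightarrow> 'a::real_inner"
  assumes "(y has_vector_derivative y') (at t within S)" "y t \<noteq> 0"
  shows "((\<lambda>t. sgn (y t)) has_vector_derivative dsgn (y t) y') (at t within S)"
proof -
  have "((\<lambda>t. inverse (norm (y t)) *\<^sub>R y t) has_vector_derivative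
      inverse (norm (y t)) *\<^sub>R y' + (- (inverse (norm (y t)) * (sgn (y t) \<bullet> y') * inverse (norm (y t)))) *\<^sub>R y t)
      (at t within S)"
    using assms
    by (intro has_vector_derivative_scaleR DERIV_inverse' has_real_derivative_norm) auto
  then show ?thesis by (simp add: sgn_div_norm dsgn_def algebra_simps)
qed

lemma periodic_reduce:
  fixes a :: "int \<Rightarrow> 'a"
  assumes per: "\<And>j. a (j + int N) = a j"
  shows "a j = a ((j - 1) mod int N + 1)"
proof -
  have nat: "a (j + int N * int k) = a j" for j k
  proof (induction k)
    case (Suc k)
    have "a (j + int N * int (Suc k)) = a ((j + int N * int k) + int N)" by (simp add: algebra_simps)
    then show ?case using per Suc by simp
  qed simp
  have "a (j + int N * k) = a j" for j k
    using nat[of j "nat k"] nat[of "j + int N * k" "nat (- k)"] by (cases "0 \<le> k") auto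
  from this[of "(j - 1) mod int N + 1" "(j - 1) div int N"]
  show ?thesis by (simp add: add.commute add.left_commute)
qed

lemma mod_index_range: "N > 0 \<Longrightarrow> (j - 1) mod int N + 1 \<in> {1..int N}"
  using pos_mod_bound[of "int N" "j - 1"] pos_mod_sign[of "int N" "j - 1"]
  unfolding atLeastAtMost_iff by linarith

text \<open>A sum of squares instead of a maximum: it is visibly continuous in time and is exactly
  what \<open>energy_controls_difference\<close> bounds. The loss against the maximum is affordable,
  since the sum will be of order h^5, far below the threshold
  \<open>(\<epsilon> * h)\<^sup>2\<close>.\<close>

definition closeness :: "nat \<Rightarrow> (int \<Rightarrow> real^2) \<Rightarrow> (int \<Rightarrow> real^2) \<Rightarrow> real" where
  "closeness N X x = (\<Sum>j=1..int N. (norm ((X j - x j) - (X (j - 1) - x (j - 1))))\<^sup>2)"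

lemma closeness_near:
  assumes "N > 0" "grid_fun N X" "grid_fun N x" "closeness N X x \<le> r\<^sup>2" "0 \<le> r"
  shows "norm ((X j - x j) - (X (j - 1) - x (j - 1))) \<le> r"
proof -
  define a where "a = (\<lambda>j. norm ((X j - x j) - (X (j - 1) - x (j - 1))))"
  define i where "i = (j - 1) mod int N + 1"
  have "a (j + int N) = a j" for j
    unfolding a_def by (simp only: grid_fun_seg[OF assms(2)] grid_fun_seg[OF assms(3)])
  then have "a j = a i" unfolding i_def by (rule periodic_reduce)
  have i: "i \<in> {1..int N}" unfolding i_def by (rule mod_index_range) fact
  have "(a i)\<^sup>2 \<le> (\<Sum>j=1..int N. (a j)\<^sup>2)"
    by (rule member_le_sum[OF i]) auto
  also have "\<dots> \<le> r\<^sup>2" using assms(4) by (simp add: closeness_def a_def)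
  finally have "a i \<le> r" by (rule power2_le_imp_le) fact
  then show ?thesis using \<open>a j = a i\<close> by (simp add: a_def)
qed

locale moving_grid =
  fixes f :: "real \<Rightarrow> real" and N :: nat and c M \<Lambda> \<epsilon> C T :: real and X V :: "int \<Rightarrow> real \<Rightarrow> real^2"
  assumes N: "N > 0" and T: "0 < T"
    and cons: "\<And>t. t \<in> {0..T} \<Longrightarrow> consistent c M f N (\<lambda>j. X j t) (\<lambda>j. V j t)"
    and dX: "\<And>j t. t \<in> {0..T} \<Longrightarrow> (X j has_vector_derivative V j t) (at t within {0..T})"
    and lip: "\<And>a b. 0 < a \<Longrightarrow> 0 < b \<Longrightarrow> \<bar>f a - f b\<bar> \<le> \<Lambda> * \<bar>a - b\<bar>"
    and c: "0 < c" "c \<le> 1" "1 \<le> M" and \<Lambda>: "0 \<le> \<Lambda>" and h1: "mesh N \<le> 1"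
    and \<epsilon>: "0 < \<epsilon>" "\<epsilon> \<le> c / 8" "7 * \<Lambda> * \<epsilon> \<le> 1"
    and C_def: "C = 7 * rate_const c M * (3 + 8 / c + 4 * pi\<^sup>2 * \<Lambda>\<^sup>2 + 2 * pi)"
    and small: "8 * M * exp (C * T) * mesh N < \<epsilon>\<^sup>2"
begin

abbreviation "h \<equiv> mesh N"

definition near :: "(int \<Rightarrow> real \<Rightarrow> real^2) \<Rightarrow> real \<Rightarrow> bool" where
  "near x t \<longleftrightarrow> closeness N (\<lambda>j. X j t) (\<lambda>j. x j t) \<le> (\<epsilon> * h)\<^sup>2"

lemma h: "0 < h" using N by (rule mesh_pos)

lemma C_nonneg: "0 \<le> C"
  unfolding C_def rate_const_def using c by (intro mult_nonneg_nonneg add_nonneg_nonneg) auto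

lemma grid_pair_near:
  assumes "t \<in> {0..T}" "grid_fun N (\<lambda>j. x j t)" "near x t"
  shows "grid_pair f N c M \<Lambda> \<epsilon> (\<lambda>j. X j t) (\<lambda>j. V j t) (\<lambda>j. x j t)"
proof (unfold_locales)
  have "grid_fun N (\<lambda>j. X j t)" using cons[OF assms(1)] by (simp add: consistent_def)
  from closeness_near[OF N this assms(2) assms(3)[unfolded near_def]] \<epsilon> h
  show "norm (X j t - x j t - (X (j - 1) t - x (j - 1) t)) \<le> \<epsilon> * h" for j by simp
qed (use assms N cons lip c \<Lambda> h1 \<epsilon> in auto)

text \<open>The equation is assumed only at times when \<open>x\<close> is near. The lemma therefore
  applies both to the solution of the truncated system, which is known to obey the scheme only
  there, and to an arbitrary solution of the scheme: the first use gives existence, the second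
  uniqueness.\<close>

lemma stays_near:
  assumes per: "\<And>t. t \<in> {0..T} \<Longrightarrow> grid_fun N (\<lambda>j. x j t)"
    and cont: "\<And>j. continuous_on {0..T} (x j)" and init: "\<And>j. x j 0 = X j 0"
    and ode: "\<And>j t. t \<in> {0<..T} \<Longrightarrow> near x t \<Longrightarrow>
      (x j has_vector_derivative scheme_rhs f N (\<lambda>i. x i t) j) (at t within {0..T})"
    and t: "t \<in> {0..T}"
  shows "near x t \<and> grid_energy N (\<lambda>j. X j t) (\<lambda>j. x j t) \<le> exp (C * T) * h ^ 4"
proof -
  define E where "E = (\<lambda>t. grid_energy N (\<lambda>j. X j t) (\<lambda>j. x j t))"
  define m where "m = (\<lambda>t. closeness N (\<lambda>j. X j t) (\<lambda>j. x j t))"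
  have contX: "continuous_on {0..T} (X j)" for j by (rule continuous_on_vector_derivative[OF dX])
  have contm: "continuous_on {0..T} m"
    unfolding m_def closeness_def by (intro continuous_intros contX cont)
  have X0: "X j t - X (j - 1) t \<noteq> 0" if "t \<in> {0..T}" for j t
    using cons[OF that] c h unfolding consistent_def seg_len_def
    by (metis mult_pos_pos norm_zero not_less)
  have E0: "E 0 = 0"
    unfolding E_def grid_energy_def init seg_tan_eq_sgn seg_len_def
    by (simp add: sgn_inner_self)
  have bound: "E s \<le> exp (C * T) * h ^ 4" and step: "m s < (\<epsilon> * h)\<^sup>2"
    if s: "s \<in> {0..T}" and nr: "\<forall>t\<in>{0..s}. m t \<le> (\<epsilon> * h)\<^sup>2" for s
  proof -
    have gp: "grid_pair f N c M \<Lambda> \<epsilon> (\<lambda>j. X j t) (\<lambda>j. V j t) (\<lambda>j. x j t)" if "t \<in> {0..s}" for t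
      using that s nr by (intro grid_pair_near per) (auto simp: near_def m_def)
    have "E s + h ^ 4 \<le> exp (C * (s - 0)) * (E 0 + h ^ 4)"
    proof (rule gronwall_affine)
      show "0 \<le> s" using s by simp
      show "continuous_on {0..s} E"
        unfolding E_def grid_energy_def seg_tan_def seg_len_def
        using s h X0 by (intro continuous_intros continuous_on_subset[OF contX] continuous_on_subset[OF cont]) auto
      fix t assume t: "0 < t" "t < s"
      then have tT: "t \<in> {0..T}" "t \<in> {0<..T}" "t \<in> {0..s}" "t < T" using s by auto
      have at: "at t within {0..T} = at t" using t tT by (simp add: at_within_Icc_at)
      have "near x t" using nr tT by (simp add: near_def m_def)
      have x0: "x j t - x (j - 1) t \<noteq> 0" for j
        using grid_pair.q_bounds(3)[OF gp[OF tT(3)], of j] by (auto simp: seg_len_def)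
      define U where "U = (\<lambda>j. scheme_rhs f N (\<lambda>i. x i t) j)"
      note dx = ode[OF tT(2) \<open>near x t\<close>, unfolded at, folded U_def]
      note dX' = dX[OF tT(1), unfolded at]
      show "(E has_real_derivative grid_energy_rate N (\<lambda>j. X j t) (\<lambda>j. V j t) (\<lambda>j. x j t) U) (at t)"
        unfolding E_def grid_energy_def grid_energy_rate_def seg_tan_eq_sgn seg_len_def
      proof (rule DERIV_sum)
        fix j
        let ?X = "\<lambda>t. X j t - X (j - 1) t" and ?x = "\<lambda>t. x j t - x (j - 1) t"
        let ?V = "V j t - V (j - 1) t" and ?U = "U j - U (j - 1)"
        have dDX: "(?X has_vector_derivative ?V) (at t)" by (intro has_vector_derivative_diff dX')
        have dDx: "(?x has_vector_derivative ?U) (at t)" by (intro has_vector_derivative_diff dx)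
        have de: "((\<lambda>t. X j t - x j t) has_vector_derivative V j t - U j) (at t)"
          by (intro has_vector_derivative_diff dX' dx)
        note dn = has_real_derivative_norm[OF dDx x0] has_real_derivative_norm[OF dDX X0[OF tT(1)]]
        note di = has_real_derivative_inner[OF has_vector_derivative_sgn[OF dDX X0[OF tT(1)]] dDx]
        have "((\<lambda>t. (norm (?x t) - sgn (?X t) \<bullet> ?x t) + (norm (?X t) - norm (?x t))\<^sup>2 / h
            + h * ((X j t - x j t) \<bullet> (X j t - x j t)))
          has_real_derivative (sgn (?x t) \<bullet> ?U - (sgn (?X t) \<bullet> ?U + dsgn (?X t) ?V \<bullet> ?x t))
            + (of_nat 2 * ((sgn (?X t) \<bullet> ?V - sgn (?x t) \<bullet> ?U) * (norm (?X t) - norm (?x t)) ^ (2 - Suc 0))) / h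
            + ((X j t - x j t) \<bullet> (V j t - U j) + (V j t - U j) \<bullet> (X j t - x j t)) * h) (at t)"
          by (intro DERIV_add DERIV_diff DERIV_cdivide DERIV_power DERIV_cmult_right dn di has_real_derivative_inner[OF de de]
             DERIV_cong[OF DERIV_cmult[OF has_real_derivative_inner[OF de de]] mult.commute])
        then show "((\<lambda>t. (norm (?x t) - sgn (?X t) \<bullet> ?x t) + (norm (?X t) - norm (?x t))\<^sup>2 / h
            + h * (norm (X j t - x j t))\<^sup>2)
          has_real_derivative sgn (?x t) \<bullet> ?U - dsgn (?X t) ?V \<bullet> ?x t - sgn (?X t) \<bullet> ?U
            + 2 * (norm (?X t) - norm (?x t)) * (sgn (?X t) \<bullet> ?V - sgn (?x t) \<bullet> ?U) / h
            + 2 * h * ((X j t - x j t) \<bullet> (V j t - U j))) (at t)"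
          unfolding power2_norm_eq_inner
          by (rule DERIV_cong) (simp add: inner_commute[of "V j t - U j"])
      qed
      show "grid_energy_rate N (\<lambda>j. X j t) (\<lambda>j. V j t) (\<lambda>j. x j t) U \<le> C * (E t + h ^ 4)"
        using grid_pair.energy_rate_bound[OF gp[OF tT(3)]] unfolding C_def E_def U_def .
    qed
    also have "\<dots> \<le> exp (C * T) * h ^ 4"
      using s C_nonneg E0 h by (auto intro!: mult_right_mono mult_left_mono)
    finally have 1: "E s + h ^ 4 \<le> exp (C * T) * h ^ 4" .
    moreover have "0 < h ^ 4" using h by simp
    ultimately show 2: "E s \<le> exp (C * T) * h ^ 4" by linarith
    have "m s \<le> 8 * M * h * E s"
      using grid_pair.energy_controls_difference[OF gp, of s] s unfolding m_def closeness_def E_def by simp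
    also have "\<dots> \<le> 8 * M * h * (exp (C * T) * h ^ 4)"
      using 2 h c by (intro mult_left_mono) auto
    \<comment> \<open>The target is \<open>\<epsilon>\<^sup>2 * h\<^sup>2\<close>, so three powers
      of \<open>h\<close> are to spare: one meets the condition \<open>small\<close>, the other two
      are discarded by \<open>h \<le> 1\<close>.\<close>
    also have "\<dots> = (8 * M * exp (C * T) * h) * (h\<^sup>2 * h\<^sup>2)" by (simp add: power2_eq_square eval_nat_numeral)
    also have "\<dots> < \<epsilon>\<^sup>2 * (h\<^sup>2 * h\<^sup>2)" using small h by (intro mult_strict_right_mono) auto
    also have "\<dots> \<le> \<epsilon>\<^sup>2 * (h\<^sup>2 * 1)" using h h1 by (intro mult_left_mono) (auto simp: power_le_one)
    finally show "m s < (\<epsilon> * h)\<^sup>2" by (simp add: power_mult_distrib)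
  qed
  have "\<forall>t\<in>{0..T}. m t < (\<epsilon> * h)\<^sup>2"
  proof (rule continuity_bootstrap[OF contm _ step])
    show "m 0 < (\<epsilon> * h)\<^sup>2" using \<epsilon> h by (simp add: m_def closeness_def init)
  qed
  then show ?thesis using t bound[of t] by (force simp: near_def m_def E_def)
qed

end

section \<open>The truncated scheme\<close>

text \<open>Lipschitz continuity for the supremum distance, expressed through a common bound
  \<open>d\<close> of the coordinate distances, so that the sequences need be neither bounded nor
  periodic.\<close>

definition sup_lip :: "((int \<Rightarrow> 'a::real_normed_vector) \<Rightarrow> 'b::real_normed_vector) \<Rightarrow> bool" where
  "sup_lip \<phi> \<longleftrightarrow> (\<exists>L\<ge>0. \<forall>x y d. (\<forall>i. norm (x i - y i) \<le> d) \<longrightarrow> norm (\<phi> x - \<phi> y) \<le> L * d)"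

definition bounded_fun :: "('a \<Rightarrow> 'b::real_normed_vector) \<Rightarrow> bool" where
  "bounded_fun \<phi> \<longleftrightarrow> (\<exists>B. \<forall>x. norm (\<phi> x) \<le> B)"

lemma sup_lipI:
  assumes "0 \<le> L" "\<And>x y d. 0 \<le> d \<Longrightarrow> (\<And>i. norm (x i - y i) \<le> d) \<Longrightarrow> norm (\<phi> x - \<phi> y) \<le> L * d"
  shows "sup_lip \<phi>"
  unfolding sup_lip_def using assms by (meson norm_ge_zero order_trans)

lemma sup_lip_const: "sup_lip (\<lambda>x. c)"
  by (rule sup_lipI[of 0]) auto

lemma sup_lip_apply: "sup_lip (\<lambda>x. x j)"
  by (rule sup_lipI[of 1]) auto

lemma sup_lip_comp:
  assumes "sup_lip \<phi>" and lip: "0 \<le> K" "\<And>a b. norm (g a - g b) \<le> K * norm (a - b)"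
  shows "sup_lip (\<lambda>x. g (\<phi> x))"
proof -
  obtain L where L: "0 \<le> L"
    "\<And>x y d. (\<And>i. norm (x i - y i) \<le> d) \<Longrightarrow> norm (\<phi> x - \<phi> y) \<le> L * d" using assms(1) unfolding sup_lip_def by blast
  show ?thesis
  proof (rule sup_lipI[of "K * L"])
    fix x y :: "int \<Rightarrow> 'a" and d assume "\<And>i. norm (x i - y i) \<le> d"
    then have "K * norm (\<phi> x - \<phi> y) \<le> K * (L * d)" using L lip by (intro mult_left_mono) auto
    with lip(2)[of "\<phi> x" "\<phi> y"] show "norm (g (\<phi> x) - g (\<phi> y)) \<le> K * L * d" by simp
  qed (use L lip in auto)
qed

lemma sup_lip_add:
  assumes "sup_lip \<phi>" "sup_lip \<psi>"
  shows "sup_lip (\<lambda>x. \<phi> x + \<psi> x)"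
proof -
  obtain L where L: "0 \<le> L"
    "\<And>x y d. (\<And>i. norm (x i - y i) \<le> d) \<Longrightarrow> norm (\<phi> x - \<phi> y) \<le> L * d" using assms(1) unfolding sup_lip_def by blast
  obtain L' where L': "0 \<le> L'"
    "\<And>x y d. (\<And>i. norm (x i - y i) \<le> d) \<Longrightarrow> norm (\<psi> x - \<psi> y) \<le> L' * d" using assms(2) unfolding sup_lip_def by blast
  show ?thesis
  proof (rule sup_lipI[of "L + L'"])
    fix x y :: "int \<Rightarrow> 'a" and d assume "\<And>i. norm (x i - y i) \<le> d"
    then have "norm ((\<phi> x - \<phi> y) + (\<psi> x - \<psi> y)) \<le> L * d + L' * d"
      by (intro norm_triangle_mono L L')
    then show "norm (\<phi> x + \<psi> x - (\<phi> y + \<psi> y)) \<le> (L + L') * d" by (simp add: algebra_simps)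
  qed (use L L' in auto)
qed

lemma sup_lip_minus: "sup_lip \<phi> \<Longrightarrow> sup_lip (\<lambda>x. - \<phi> x)"
  by (rule sup_lip_comp[where K = 1 and g = uminus]) (auto simp: norm_minus_commute)

lemma sup_lip_diff: "sup_lip \<phi> \<Longrightarrow> sup_lip \<psi> \<Longrightarrow> sup_lip (\<lambda>x. \<phi> x - \<psi> x)"
  using sup_lip_add[of \<phi> "\<lambda>x. - \<psi> x"] sup_lip_minus[of \<psi>] by simp

lemma sup_lip_sum: "finite I \<Longrightarrow> (\<And>i. i \<in> I \<Longrightarrow> sup_lip (\<phi> i)) \<Longrightarrow> sup_lip (\<lambda>x. \<Sum>i\<in>I. \<phi> i x)"
  by (induction I rule: finite_induct) (auto intro: sup_lip_const sup_lip_add)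

lemma sup_lip_norm: "sup_lip \<phi> \<Longrightarrow> sup_lip (\<lambda>x. norm (\<phi> x))"
  by (rule sup_lip_comp[where K = 1 and g = norm]) (auto intro: norm_triangle_ineq3)

lemma sup_lip_scaleR:
  assumes "sup_lip \<phi>" "sup_lip \<psi>" "bounded_fun \<phi>" "bounded_fun \<psi>"
  shows "sup_lip (\<lambda>x. \<phi> x *\<^sub>R \<psi> x)"
proof -
  obtain L where L: "0 \<le> L"
    "\<And>x y d. (\<And>i. norm (x i - y i) \<le> d) \<Longrightarrow> norm (\<phi> x - \<phi> y) \<le> L * d" using assms(1) unfolding sup_lip_def by blast
  obtain L' where L': "0 \<le> L'"
    "\<And>x y d. (\<And>i. norm (x i - y i) \<le> d) \<Longrightarrow> norm (\<psi> x - \<psi> y) \<le> L' * d" using assms(2) unfolding sup_lip_def by blast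
  from assms(3,4) obtain A B where AB: "\<And>x. norm (\<phi> x) \<le> A" "\<And>x. norm (\<psi> x) \<le> B"
    unfolding bounded_fun_def by blast
  have nn: "0 \<le> A" "0 \<le> B" using AB norm_ge_zero order_trans by blast+
  show ?thesis
  proof (rule sup_lipI[of "L * B + A * L'"])
    fix x y :: "int \<Rightarrow> 'a" and d assume d: "0 \<le> d" "\<And>i. norm (x i - y i) \<le> d"
    have "norm ((\<phi> x - \<phi> y) *\<^sub>R \<psi> x + \<phi> y *\<^sub>R (\<psi> x - \<psi> y)) \<le> (L * d) * B + A * (L' * d)"
    proof (intro norm_triangle_mono)
      show "norm ((\<phi> x - \<phi> y) *\<^sub>R \<psi> x) \<le> (L * d) * B"
        unfolding norm_scaleR using L(2)[OF d(2)] AB(2) L(1) d by (intro mult_mono) auto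
      show "norm (\<phi> y *\<^sub>R (\<psi> x - \<psi> y)) \<le> A * (L' * d)"
        unfolding norm_scaleR using L'(2)[OF d(2)] AB(1)[of y] nn by (intro mult_mono) auto
    qed
    then show "norm (\<phi> x *\<^sub>R \<psi> x - \<phi> y *\<^sub>R \<psi> y) \<le> (L * B + A * L') * d" by (simp add: algebra_simps)
  qed (use L L' nn in auto)
qed

lemma bounded_fun_scaleR:
  assumes "bounded_fun \<phi>" "bounded_fun \<psi>" shows "bounded_fun (\<lambda>x. \<phi> x *\<^sub>R \<psi> x)"
proof -
  from assms obtain A B where AB: "\<And>x. norm (\<phi> x) \<le> A" "\<And>x. norm (\<psi> x) \<le> B"
    unfolding bounded_fun_def by blast
  have "norm (\<phi> x *\<^sub>R \<psi> x) \<le> A * B" for x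
    unfolding norm_scaleR using AB[of x] norm_ge_zero[of "\<phi> x"] by (intro mult_mono) auto
  then show ?thesis unfolding bounded_fun_def by blast
qed

lemma bounded_fun_diff: "bounded_fun \<phi> \<Longrightarrow> bounded_fun \<psi> \<Longrightarrow> bounded_fun (\<lambda>x. \<phi> x - \<psi> x)"
  unfolding bounded_fun_def by (meson norm_triangle_le_diff add_mono)

section \<open>Truncated reciprocals and unit vectors\<close>

definition inv_max :: "real \<Rightarrow> real \<Rightarrow> real" where
  "inv_max \<kappa> r = inverse (max \<kappa> r)"

lemma inv_max_bounds: "0 < \<kappa> \<Longrightarrow> \<bar>inv_max \<kappa> r\<bar> \<le> inverse \<kappa>"
  by (simp add: inv_max_def le_imp_inverse_le)

lemma inv_max_lip:
  assumes "0 < \<kappa>"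
  shows "\<bar>inv_max \<kappa> a - inv_max \<kappa> b\<bar> \<le> (1 / \<kappa>\<^sup>2) * \<bar>a - b\<bar>"
proof -
  have pos: "0 < max \<kappa> a" "0 < max \<kappa> b" using assms by auto
  have "inv_max \<kappa> a - inv_max \<kappa> b = (max \<kappa> b - max \<kappa> a) / (max \<kappa> a * max \<kappa> b)"
    unfolding inv_max_def using pos by (simp add: field_simps del: max_less_iff_conj)
  also have "\<bar>\<dots>\<bar> \<le> \<bar>a - b\<bar> / (\<kappa> * \<kappa>)"
    using assms by (intro abs_divide_le mult_mono) auto
  finally show ?thesis by (simp add: power2_eq_square)
qed

lemma sup_lip_inv_max: "0 < \<kappa> \<Longrightarrow> sup_lip \<phi> \<Longrightarrow> sup_lip (\<lambda>x. inv_max \<kappa> (\<phi> x))"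
  using inv_max_lip by (intro sup_lip_comp[where K = "1 / \<kappa>\<^sup>2" and g = "inv_max \<kappa>"]) auto

definition trunc_sgn :: "real \<Rightarrow> 'a::real_normed_vector \<Rightarrow> 'a" where
  "trunc_sgn \<kappa> v = inv_max \<kappa> (norm v) *\<^sub>R v"

lemma trunc_sgn_eq: "\<kappa> \<le> norm v \<Longrightarrow> trunc_sgn \<kappa> v = sgn v"
  by (simp add: trunc_sgn_def inv_max_def sgn_div_norm max_absorb2)

lemma trunc_sgn_bounded: "0 < \<kappa> \<Longrightarrow> norm (trunc_sgn \<kappa> v) \<le> 1"
  by (simp add: trunc_sgn_def inv_max_def field_simps)

text \<open>The product rule \<open>sup_lip_scaleR\<close> asks for bounded factors, but
  \<open>v\<close> is unbounded. Here the factor \<open>norm w\<close> is compensated by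
  \<open>max \<kappa> (norm w)\<close> in the denominator of the difference of the
  reciprocals.\<close>

lemma trunc_sgn_lip:
  assumes "0 < \<kappa>"
  shows "norm (trunc_sgn \<kappa> v - trunc_sgn \<kappa> w) \<le> (2 / \<kappa>) * norm (v - w)"
proof -
  have "\<bar>inv_max \<kappa> (norm v) - inv_max \<kappa> (norm w)\<bar> * norm w \<le> norm (v - w) / \<kappa>"
  proof -
    have pos: "0 < max \<kappa> (norm v)" "0 < max \<kappa> (norm w)" using assms by auto
    have "inv_max \<kappa> (norm v) - inv_max \<kappa> (norm w) = (max \<kappa> (norm w) - max \<kappa> (norm v)) / (max \<kappa> (norm v) * max \<kappa> (norm w))"
      unfolding inv_max_def using pos by (simp add: field_simps del: max_less_iff_conj)
    then have "\<bar>inv_max \<kappa> (norm v) - inv_max \<kappa> (norm w)\<bar> * norm w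
        = (\<bar>max \<kappa> (norm w) - max \<kappa> (norm v)\<bar> / max \<kappa> (norm v)) * (norm w / max \<kappa> (norm w))"
      using pos by (simp add: abs_mult)
    also have "\<dots> \<le> (norm (v - w) / \<kappa>) * 1"
    proof (intro mult_mono frac_le)
      have "\<bar>norm w - norm v\<bar> \<le> norm (v - w)" by (metis norm_minus_commute norm_triangle_ineq3)
      then show "\<bar>max \<kappa> (norm w) - max \<kappa> (norm v)\<bar> \<le> norm (v - w)" by linarith
    qed (use assms pos in \<open>auto simp: divide_le_eq_1\<close>)
    finally show ?thesis by simp
  qed
  then have 1: "norm ((inv_max \<kappa> (norm v) - inv_max \<kappa> (norm w)) *\<^sub>R w) \<le> norm (v - w) / \<kappa>" by simp
  have "\<bar>inv_max \<kappa> (norm v)\<bar> * norm (v - w) \<le> inverse \<kappa> * norm (v - w)"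
    by (intro mult_right_mono inv_max_bounds assms) simp
  then have 2: "norm (inv_max \<kappa> (norm v) *\<^sub>R (v - w)) \<le> norm (v - w) / \<kappa>"
    by (simp add: divide_inverse mult.commute)
  have eq: "trunc_sgn \<kappa> v - trunc_sgn \<kappa> w
      = inv_max \<kappa> (norm v) *\<^sub>R (v - w) + (inv_max \<kappa> (norm v) - inv_max \<kappa> (norm w)) *\<^sub>R w"
    by (simp add: trunc_sgn_def algebra_simps)
  show ?thesis unfolding eq using norm_triangle_mono[OF 2 1] by simp
qed

lemma sup_lip_trunc_sgn: "0 < \<kappa> \<Longrightarrow> sup_lip \<phi> \<Longrightarrow> sup_lip (\<lambda>x. trunc_sgn \<kappa> (\<phi> x))"
  using trunc_sgn_lip by (intro sup_lip_comp[where K = "2 / \<kappa>" and g = "trunc_sgn \<kappa>"]) auto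

lemma bounded_fun_trunc_sgn: "0 < \<kappa> \<Longrightarrow> bounded_fun (\<lambda>x. trunc_sgn \<kappa> (\<phi> x))"
  unfolding bounded_fun_def using trunc_sgn_bounded by blast

text \<open>The denominators are bounded below and the argument of \<open>f\<close> is confined to a compact interval, so
  that the truncated right-hand side is globally Lipschitz; close to the smooth curve the truncation
  is inactive.\<close>

definition trunc_rhs :: "(real \<Rightarrow> real) \<Rightarrow> real \<Rightarrow> real \<Rightarrow> real \<Rightarrow> nat \<Rightarrow> (int \<Rightarrow> real^2) \<Rightarrow> int \<Rightarrow> real^2" where
  "trunc_rhs f \<kappa> lo hi N x j =
     (2 * inv_max \<kappa> (seg_len x j + seg_len x (j + 1))) *\<^sub>R
       (trunc_sgn \<kappa> (x (j + 1) - x j) - trunc_sgn \<kappa> (x j - x (j - 1)))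
     - f (max lo (min hi (discrete_len N x))) *\<^sub>R
       perp (trunc_sgn (1/2) (trunc_sgn \<kappa> (x j - x (j - 1)) + trunc_sgn \<kappa> (x (j + 1) - x j)))"

lemma sup_lip_trunc_rhs:
  assumes "0 < \<kappa>" "0 < lo" "lo \<le> hi" and lip: "\<And>a b. 0 < a \<Longrightarrow> 0 < b \<Longrightarrow> \<bar>f a - f b\<bar> \<le> \<Lambda> * \<bar>a - b\<bar>"
    and "0 \<le> \<Lambda>"
  shows "sup_lip (\<lambda>x. trunc_rhs f \<kappa> lo hi N x j)" "bounded_fun (\<lambda>x. trunc_rhs f \<kappa> lo hi N x j)"
proof -
  have T: "sup_lip (\<lambda>x :: int \<Rightarrow> real^2. trunc_sgn \<kappa> (x i - x k))" "bounded_fun (\<lambda>x :: int \<Rightarrow> real^2. trunc_sgn \<kappa> (x i - x k))" for i k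
    by (intro sup_lip_trunc_sgn bounded_fun_trunc_sgn sup_lip_diff sup_lip_apply assms)+
  have Ql: "sup_lip (\<lambda>x. seg_len x i)" for i
    unfolding seg_len_def by (intro sup_lip_norm sup_lip_diff sup_lip_apply)
  have P: "sup_lip (\<lambda>x. perp (\<phi> x))" if "sup_lip \<phi>" for \<phi> :: "(int \<Rightarrow> real^2) \<Rightarrow> real^2"
    using that by (rule sup_lip_comp[where K = 1 and g = perp]) (simp_all flip: linear_diff[OF linear_perp])
  have cl: "\<bar>f (max lo (min hi a)) - f (max lo (min hi b))\<bar> \<le> \<Lambda> * \<bar>a - b\<bar>" for a b
  proof -
    have "\<bar>f (max lo (min hi a)) - f (max lo (min hi b))\<bar> \<le> \<Lambda> * \<bar>max lo (min hi a) - max lo (min hi b)\<bar>"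
      using assms by (intro lip) auto
    also have "\<dots> \<le> \<Lambda> * \<bar>a - b\<bar>" using assms by (intro mult_left_mono) auto
    finally show ?thesis .
  qed
  have F: "sup_lip (\<lambda>x. f (max lo (min hi (discrete_len N x))))"
    unfolding discrete_len_def
    by (rule sup_lip_comp[where K = \<Lambda> and g = "\<lambda>r. f (max lo (min hi r))"])
      (use cl assms in \<open>auto intro!: sup_lip_sum Ql\<close>)
  have Fb: "bounded_fun (\<lambda>x. f (max lo (min hi (discrete_len N x))))"
  proof -
    have "\<bar>f (max lo (min hi a))\<bar> \<le> \<bar>f lo\<bar> + \<Lambda> * (hi - lo)" for a
    proof -
      have "\<bar>f (max lo (min hi a)) - f lo\<bar> \<le> \<Lambda> * \<bar>max lo (min hi a) - lo\<bar>"
        using assms by (intro lip) auto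
      also have "\<dots> \<le> \<Lambda> * (hi - lo)" using assms by (intro mult_left_mono) auto
      finally show ?thesis by linarith
    qed
    then show ?thesis unfolding bounded_fun_def by auto
  qed
  have I: "sup_lip (\<lambda>x. 2 * inv_max \<kappa> (seg_len x j + seg_len x (j + 1)))"
  proof (rule sup_lip_comp[where K = 2 and g = "\<lambda>r. 2 * r"])
    show "sup_lip (\<lambda>x. inv_max \<kappa> (seg_len x j + seg_len x (j + 1)))"
      by (intro sup_lip_inv_max sup_lip_add Ql assms)
    show "norm (2 * a - 2 * b) \<le> 2 * norm (a - b)" for a b :: real
      unfolding right_diff_distrib[symmetric] norm_mult by simp
  qed simp
  have Ib: "bounded_fun (\<lambda>x. 2 * inv_max \<kappa> (seg_len x j + seg_len x (j + 1)))"
    unfolding bounded_fun_def using inv_max_bounds[OF assms(1)]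
    by (intro exI[of _ "2 * inverse \<kappa>"]) (simp add: abs_mult)
  have Pb: "bounded_fun (\<lambda>x. perp (trunc_sgn (1/2) (\<phi> x)))" for \<phi> :: "(int \<Rightarrow> real^2) \<Rightarrow> real^2"
    unfolding bounded_fun_def using trunc_sgn_bounded[of "1/2"] by auto
  show "sup_lip (\<lambda>x. trunc_rhs f \<kappa> lo hi N x j)" "bounded_fun (\<lambda>x. trunc_rhs f \<kappa> lo hi N x j)"
    unfolding trunc_rhs_def
    by (intro sup_lip_diff sup_lip_scaleR bounded_fun_diff bounded_fun_scaleR T F Fb I Ib P Pb
        sup_lip_trunc_sgn sup_lip_add half_gt_zero zero_less_one)+
qed

text \<open>The thresholds are the bounds known for a nearby polygon: \<open>c / 2 * h\<close> from
  \<open>q_bounds\<close>, \<open>1/2\<close> from \<open>mid_ge\<close>, and \<open>pi * c\<close>,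
  \<open>4 * pi * M\<close> from the edge bounds summed over \<open>N\<close> edges with
  \<open>N * h = 2 * pi\<close>.\<close>

lemma (in grid_pair) trunc_rhs_eq:
  "trunc_rhs f (c / 2 * h) (pi * c) (4 * pi * M) N x j = scheme_rhs f N x j"
proof -
  have T: "trunc_sgn (c / 2 * h) (x i - x (i - 1)) = seg_tan x i" for i
    unfolding seg_tan_eq_sgn using q_bounds(1)[of i] by (intro trunc_sgn_eq) (simp add: seg_len_def)
  have m: "trunc_sgn (1/2) (seg_tan x j + seg_tan x (j + 1)) = mid_tan x j"
    unfolding mid_tan_eq_sgn by (intro trunc_sgn_eq mid_ge)
  have len: "real N * (c / 2 * h) \<le> discrete_len N x" "discrete_len N x \<le> real N * (2 * M * h)"
    unfolding discrete_len_def
    using sum_bounded_below[of "{1..int N}" "c / 2 * h" q] sum_bounded_above[of "{1..int N}" q "2 * M * h"] q_bounds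
    by simp_all
  have "pi * c \<le> discrete_len N x" "discrete_len N x \<le> 4 * pi * M"
  proof -
    have gen: "n * (c / 2 * r) = pi * c" "n * (2 * M * r) = 4 * pi * M" if "n * r = 2 * pi" for n r :: real
    proof -
      have "n * (c / 2 * r) = c / 2 * (n * r)" "n * (2 * M * r) = 2 * M * (n * r)" by algebra+
      then show "n * (c / 2 * r) = pi * c" "n * (2 * M * r) = 4 * pi * M" unfolding that by simp_all
    qed
    show "pi * c \<le> discrete_len N x" "discrete_len N x \<le> 4 * pi * M"
      using len unfolding gen[OF mesh_times[OF N]] .
  qed
  then have l: "max (pi * c) (min (4 * pi * M) (discrete_len N x)) = discrete_len N x"
    by (simp only: min_absorb2 max_absorb2)
  have I: "inv_max (c / 2 * h) (q j + q (j + 1)) = inverse (q j + q (j + 1))"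
    unfolding inv_max_def
    using max_absorb2[of "c / 2 * h" "q j + q (j + 1)"] q_bounds(1)[of j] q_bounds(3)[of "j + 1"] by linarith
  have T1: "trunc_sgn (c / 2 * h) (x (j + 1) - x j) = seg_tan x (j + 1)"
    using T[of "j + 1"] by simp
  show ?thesis
    unfolding trunc_rhs_def scheme_rhs_def T T1 m l I by (simp only: divide_inverse)
qed

text \<open>Bounded functions on the grid, under the supremum norm, serve as the phase space of
  \<open>lipschitz_ode_solution\<close>, which has to be a Banach space.\<close>

instance bcontfun :: (metric_space, banach) banach ..

lemma trunc_rhs_periodic:
  assumes "grid_fun N x"
  shows "trunc_rhs f \<kappa> lo hi N x (j + int N) = trunc_rhs f \<kappa> lo hi N x j"
proof -
  have "x (j + int N + 1) = x (j + 1)" using assms by (metis grid_fun_def add.assoc add.commute)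
  then show ?thesis by (simp add: trunc_rhs_def grid_fun_seg[OF assms])
qed

lemma grid_fun_reduce: "grid_fun N x \<Longrightarrow> x j = x ((j - 1) mod int N + 1)"
  unfolding grid_fun_def by (rule periodic_reduce) simp

lemma scheme_solution_all:
  assumes sol: "scheme_solution f T X0 N x" and N: "N > 0"
  shows "continuous_on {0..T} (x j)"
    and "t \<in> {0<..T} \<Longrightarrow> (x j has_vector_derivative scheme_rhs f N (\<lambda>i. x i t) j) (at t within {0..T})"
proof -
  define i where "i = (j - 1) mod int N + 1"
  have i: "i \<in> {1..int N}" unfolding i_def by (rule mod_index_range[OF N])
  have per: "grid_fun N (\<lambda>j. x j t)" if "t \<in> {0..T}" for t using sol that by (simp add: scheme_solution_def)
  have eq: "x j t = x i t" if "t \<in> {0..T}" for t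
    unfolding i_def using grid_fun_reduce[OF per[OF that]] .
  have "continuous_on {0..T} (x i)" using sol i by (simp add: scheme_solution_def)
  then show "continuous_on {0..T} (x j)" using continuous_on_cong[of "{0..T}" "{0..T}" "x j" "x i"] eq by simp
  assume t: "t \<in> {0<..T}"
  then have t': "t \<in> {0..T}" by simp
  have A: "scheme_rhs f N (\<lambda>i. x i t) j = scheme_rhs f N (\<lambda>i. x i t) i"
    unfolding i_def by (rule periodic_reduce) (rule scheme_rhs_periodic[OF per[OF t']])
  have B: "(x i has_vector_derivative scheme_rhs f N (\<lambda>i. x i t) i) (at t within {0..T})"
    using sol i t by (simp add: scheme_solution_def)
  show "(x j has_vector_derivative scheme_rhs f N (\<lambda>i. x i t) j) (at t within {0..T})"
    unfolding A by (rule has_vector_derivative_transform[OF t' eq B])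
qed

section \<open>Solving the truncated system and returning to the scheme\<close>

context moving_grid begin

abbreviation "R \<equiv> trunc_rhs f (c / 2 * h) (pi * c) (4 * pi * M) N"

lemma R_lip: "sup_lip (\<lambda>x. R x j)" "bounded_fun (\<lambda>x. R x j)"
proof -
  have "c \<le> 4 * M" using c by linarith
  then have "pi * c \<le> 4 * pi * M" by simp
  then show "sup_lip (\<lambda>x. R x j)" "bounded_fun (\<lambda>x. R x j)"
    using c h \<Lambda> by (intro sup_lip_trunc_rhs[OF _ _ _ lip]; simp)+
qed

lemma R_uniform_lip:
  "\<exists>L>0. \<forall>j\<in>{1..int N}. \<forall>x y d. (\<forall>i. norm (x i - y i) \<le> d) \<longrightarrow> norm (R x j - R y j) \<le> L * d"
proof -
  have "\<exists>L\<ge>0. \<forall>x y d. (\<forall>i. norm (x i - y i) \<le> d) \<longrightarrow> norm (R x j - R y j) \<le> L * d" for j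
    using R_lip(1)[of j] unfolding sup_lip_def .
  then obtain L where L: "\<And>j. 0 \<le> L j"
    "\<And>j x y d. \<forall>i. norm (x i - y i) \<le> d \<Longrightarrow> norm (R x j - R y j) \<le> L j * d" by metis
  have "0 \<le> (\<Sum>j=1..int N. L j)" by (intro sum_nonneg L)
  show ?thesis
  \<comment> \<open>The sum dominates the finitely many constants; adding 1 makes it positive, as
    \<open>lipschitz_ode_solution\<close> requires.\<close>
  proof (intro exI[of _ "1 + (\<Sum>j=1..int N. L j)"] conjI ballI allI impI)
    fix j and x y :: "int \<Rightarrow> real^2" and d
    assume j: "j \<in> {1..int N}" and d: "\<forall>i. norm (x i - y i) \<le> d"
    have "0 \<le> d" using order_trans[OF norm_ge_zero d[rule_format]] .
    have "L j \<le> (\<Sum>j=1..int N. L j)" by (rule member_le_sum[OF j]) (use L in auto)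
    then have "L j * d \<le> (1 + (\<Sum>j=1..int N. L j)) * d"
      by (intro mult_right_mono) (use \<open>0 \<le> d\<close> in auto)
    then show "norm (R x j - R y j) \<le> (1 + (\<Sum>j=1..int N. L j)) * d" using L(2)[OF d, of j] by linarith
  qed (use \<open>0 \<le> (\<Sum>j=1..int N. L j)\<close> in auto)
qed

text \<open>The grid is modelled by \<open>int discrete\<close>, since completeness of \<open>bcontfun\<close> requires a metric on the
  domain and \<open>int\<close> has none.\<close>

lemma truncated_solution_exists:
  "\<exists>x. (\<forall>t. grid_fun N (\<lambda>j. x j t)) \<and> (\<forall>j. x j 0 = X j 0) \<and>
    (\<forall>j. \<forall>t\<in>{0..T}. (x j has_vector_derivative R (\<lambda>i. x i t) j) (at t within {0..T}))"
proof -
  define r where "r = (\<lambda>j. (j - 1) mod int N + 1)"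
  have r: "r j \<in> {1..int N}" for j unfolding r_def by (rule mod_index_range[OF N])
  have rN: "r (j + int N) = r j" for j
  proof -
    have "j + int N - 1 = (j - 1) + int N" by simp
    then show ?thesis unfolding r_def by (simp only: mod_add_self2)
  qed
  obtain L where L: "0 < L"
    "\<And>j x y d. j \<in> {1..int N} \<Longrightarrow> \<forall>i. norm (x i - y i) \<le> d \<Longrightarrow> norm (R x j - R y j) \<le> L * d"
    using R_uniform_lip by blast
  have bfI: "(\<lambda>j. g (r (of_discrete j))) \<in> bcontfun" for g :: "int \<Rightarrow> real^2"
  proof (rule bcontfun_normI)
    fix j
    show "norm (g (r (of_discrete j))) \<le> (\<Sum>j=1..int N. norm (g j))" by (rule member_le_sum[OF r]) auto
  qed (simp add: continuous_on_open_vimage open_discrete)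
  \<comment> \<open>Both the argument and the index are folded to the representatives
    \<open>1\<close> to \<open>N\<close>. Each value of \<open>F\<close> then has only
    \<open>N\<close> entries, hence is a bounded function, and periodicity of the solution is built
    in.\<close>
  define F where "F = (\<lambda>y. Bcontfun (\<lambda>j. R (\<lambda>i. apply_bcontfun y (discrete (r i))) (r (of_discrete j))))"
  have F: "apply_bcontfun (F y) j = R (\<lambda>i. apply_bcontfun y (discrete (r i))) (r (of_discrete j))" for y j
    unfolding F_def by (simp add: Bcontfun_inverse[OF bfI])
  define x0 where "x0 = Bcontfun (\<lambda>j. X (r (of_discrete j)) 0)"
  have x0: "apply_bcontfun x0 j = X (r (of_discrete j)) 0" for j
    unfolding x0_def by (simp add: Bcontfun_inverse[OF bfI[of "\<lambda>j. X j 0"]])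
  have "norm (F y - F z) \<le> L * norm (y - z)" for y z
  proof (rule norm_bound)
    fix j
    have "\<forall>i. norm (apply_bcontfun y (discrete (r i)) - apply_bcontfun z (discrete (r i))) \<le> norm (y - z)"
      using norm_bounded[of "y - z"] by simp
    from L(2)[OF r this] show "norm (apply_bcontfun (F y - F z) j) \<le> L * norm (y - z)"
      by (simp add: F)
  qed
  then obtain Y where Y: "Y 0 = x0" "\<And>t. t \<in> {0..T} \<Longrightarrow> (Y has_vector_derivative F (Y t)) (at t within {0..T})"
    using lipschitz_ode_solution[of F L T x0] L T by (metis less_imp_le)
  define x where "x = (\<lambda>j t. apply_bcontfun (Y t) (discrete (r j)))"
  have bl: "bounded_linear (\<lambda>y :: int discrete \<Rightarrow>\<^sub>C (real^2). apply_bcontfun y j)" for j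
    by (rule bounded_linear_intro[of _ 1]) (auto simp: norm_bounded)
  show ?thesis
  proof (intro exI[of _ x] conjI allI ballI)
    show per: "grid_fun N (\<lambda>j. x j t)" for t by (simp add: grid_fun_def x_def rN)
    show "x j 0 = X j 0" for j
    proof -
      have "grid_fun N (\<lambda>j. X j 0)" using cons[of 0] T by (simp add: consistent_def)
      from grid_fun_reduce[OF this, of j] show ?thesis
        unfolding x_def Y(1) x0 by (simp add: r_def discrete_inverse)
    qed
    fix j t assume t: "t \<in> {0..T}"
    have "(x j has_vector_derivative R (\<lambda>i. x i t) (r (r j))) (at t within {0..T})"
      using bounded_linear.has_vector_derivative[OF bl Y(2)[OF t], of "discrete (r j)"]
      unfolding x_def F by (simp add: discrete_inverse)
    moreover have "R (\<lambda>i. x i t) j = R (\<lambda>i. x i t) (r j)"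
      unfolding r_def by (rule periodic_reduce) (rule trunc_rhs_periodic[OF per])
    moreover have "r (r j) = r j" by (simp add: r_def)
    ultimately show "(x j has_vector_derivative R (\<lambda>i. x i t) j) (at t within {0..T})" by simp
  qed
qed

text \<open>Gronwall for the sum of the squared distances. The rate \<open>2 * L * real N\<close>
  depends on the grid, which is harmless because the sum vanishes initially. The equations are asked
  for on \<open>{0<..T}\<close>, as in \<open>scheme_solution\<close>.\<close>

lemma truncated_solution_unique:
  assumes per: "\<And>t. t \<in> {0..T} \<Longrightarrow> grid_fun N (\<lambda>j. x j t)" "\<And>t. t \<in> {0..T} \<Longrightarrow> grid_fun N (\<lambda>j. y j t)"
    and cont: "\<And>j. continuous_on {0..T} (x j)" "\<And>j. continuous_on {0..T} (y j)"
    and init: "\<And>j. x j 0 = y j 0"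
    and dx: "\<And>j t. t \<in> {0<..T} \<Longrightarrow> (x j has_vector_derivative R (\<lambda>i. x i t) j) (at t within {0..T})"
    and dy: "\<And>j t. t \<in> {0<..T} \<Longrightarrow> (y j has_vector_derivative R (\<lambda>i. y i t) j) (at t within {0..T})"
    and t: "t \<in> {0..T}"
  shows "x j t = y j t"
proof -
  obtain L where L: "0 < L"
    "\<And>j x y d. j \<in> {1..int N} \<Longrightarrow> \<forall>i. norm (x i - y i) \<le> d \<Longrightarrow> norm (R x j - R y j) \<le> L * d"
    using R_uniform_lip by blast
  define w where "w = (\<lambda>t. \<Sum>j=1..int N. (norm (x j t - y j t))\<^sup>2)"
  define w' where "w' = (\<lambda>t. \<Sum>j=1..int N. 2 * ((x j t - y j t) \<bullet> (R (\<lambda>i. x i t) j - R (\<lambda>i. y i t) j)))"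
  have "w t + 0 \<le> exp ((2 * L * real N) * (t - 0)) * (w 0 + 0)"
  proof (rule gronwall_affine)
    show "continuous_on {0..t} w"
      unfolding w_def using t
      by (intro continuous_intros continuous_on_subset[OF cont(1)] continuous_on_subset[OF cont(2)]) auto
    fix s assume s: "0 < s" "s < t"
    then have sT: "s \<in> {0<..T}" "s \<in> {0..T}" "s < T" using t by auto
    have at: "at s within {0..T} = at s" using s sT by (simp add: at_within_Icc_at)
    note d = has_vector_derivative_diff[OF dx[OF sT(1), unfolded at] dy[OF sT(1), unfolded at]]
    show "(w has_real_derivative w' s) (at s)"
      unfolding w_def w'_def power2_norm_eq_inner
      by (intro DERIV_sum DERIV_cong[OF has_real_derivative_inner[OF d d]])
        (simp add: inner_commute)
    \<comment> \<open>\<open>S\<close> is a common bound for all coordinate distances, as the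
      Lipschitz condition wants, and its square is at most \<open>N\<close> times
      \<open>w s\<close>.\<close>
    define S where "S = (\<Sum>i=1..int N. norm (x i s - y i s))"
    have S: "norm (x i s - y i s) \<le> S" for i
    proof -
      let ?i = "(i - 1) mod int N + 1"
      have "norm (x ?i s - y ?i s) \<le> S" unfolding S_def
        by (rule member_le_sum[OF mod_index_range[OF N]]) auto
      then show ?thesis
        using grid_fun_reduce[OF per(1)[OF sT(2)], of i] grid_fun_reduce[OF per(2)[OF sT(2)], of i] by simp
    qed
    have "w' s \<le> (\<Sum>j=1..int N. 2 * (norm (x j s - y j s) * (L * S)))"
      unfolding w'_def
    proof (intro sum_mono mult_left_mono)
      fix j assume j: "j \<in> {1..int N}"
      have "(x j s - y j s) \<bullet> (R (\<lambda>i. x i s) j - R (\<lambda>i. y i s) j)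
          \<le> norm (x j s - y j s) * norm (R (\<lambda>i. x i s) j - R (\<lambda>i. y i s) j)" by (rule norm_cauchy_schwarz)
      also have "\<dots> \<le> norm (x j s - y j s) * (L * S)" by (intro mult_left_mono L(2) j S allI) auto
      finally show "(x j s - y j s) \<bullet> (R (\<lambda>i. x i s) j - R (\<lambda>i. y i s) j) \<le> norm (x j s - y j s) * (L * S)" .
    qed simp
    also have "\<dots> = 2 * L * S\<^sup>2"
      unfolding S_def power2_eq_square sum_distrib_left[symmetric] sum_distrib_right[symmetric] by simp
    also have "\<dots> \<le> 2 * L * (real N * w s)"
    proof (intro mult_left_mono)
      have "(\<Sum>j=1..int N. 1 * norm (x j s - y j s))\<^sup>2 \<le> (\<Sum>j=1..int N. 1\<^sup>2) * (\<Sum>j=1..int N. (norm (x j s - y j s))\<^sup>2)"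
        by (rule Cauchy_Schwarz_ineq_sum)
      then show "S\<^sup>2 \<le> real N * w s" by (simp add: S_def w_def)
    qed (use L in auto)
    finally show "w' s \<le> 2 * L * real N * (w s + 0)" by simp
  qed (use t in auto)
  also have "w 0 = 0" by (simp add: w_def init)
  finally have "w t \<le> 0" by simp
  then have "w t = 0" unfolding w_def by (intro antisym sum_nonneg) auto
  then have eq: "x i t = y i t" if "i \<in> {1..int N}" for i
    using that unfolding w_def by (subst (asm) sum_nonneg_eq_0_iff) auto
  show ?thesis
    using grid_fun_reduce[OF per(1)[OF t], of j] grid_fun_reduce[OF per(2)[OF t], of j]
      eq[OF mod_index_range[OF N]] by simp
qed

lemma R_eq: "t \<in> {0..T} \<Longrightarrow> grid_fun N (\<lambda>j. x j t) \<Longrightarrow> near x t \<Longrightarrow> R (\<lambda>i. x i t) j = scheme_rhs f N (\<lambda>i. x i t) j"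
  by (rule grid_pair.trunc_rhs_eq[OF grid_pair_near])

text \<open>Existence: the truncated solution stays near the exact one, where the truncation is
  inactive. Uniqueness: any scheme solution also stays near, so it solves the truncated system as
  well, and Lipschitz uniqueness applies although the scheme itself is singular at degenerate
  polygons.\<close>

theorem scheme_converges:
  assumes X0: "\<And>j. X j 0 = X0 (grid_pt N j)"
  shows "\<exists>x. scheme_solution f T X0 N x \<and>
    (\<forall>y. scheme_solution f T X0 N y \<longrightarrow> (\<forall>j. \<forall>t\<in>{0..T}. y j t = x j t)) \<and>
    (\<forall>t\<in>{0..T}. H1G_norm N (\<lambda>j. X j t - x j t) \<le> sqrt ((1 + 8 * M) * exp (C * T)) * h\<^sup>2)"
proof -
  obtain x where x: "\<And>t. grid_fun N (\<lambda>j. x j t)" "\<And>j. x j 0 = X j 0"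
    "\<And>j t. t \<in> {0..T} \<Longrightarrow> (x j has_vector_derivative R (\<lambda>i. x i t) j) (at t within {0..T})"
    using truncated_solution_exists by blast
  have contx: "continuous_on {0..T} (x j)" for j by (rule continuous_on_vector_derivative[OF x(3)])
  have nearx: "near x t" "grid_energy N (\<lambda>j. X j t) (\<lambda>j. x j t) \<le> exp (C * T) * h ^ 4" if t: "t \<in> {0..T}" for t
  proof -
    have "(x j has_vector_derivative scheme_rhs f N (\<lambda>i. x i t) j) (at t within {0..T})"
      if "t \<in> {0<..T}" "near x t" for j t
      using x(3)[of t j] R_eq[of t x j] that x(1) by simp
    from stays_near[OF x(1) contx x(2) this t]
    show "near x t" "grid_energy N (\<lambda>j. X j t) (\<lambda>j. x j t) \<le> exp (C * T) * h ^ 4" by auto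
  qed
  have sol: "scheme_solution f T X0 N x"
    unfolding scheme_solution_def
  proof (intro conjI ballI)
    fix t j assume t: "t \<in> {0<..T}"
    then have t': "t \<in> {0..T}" by simp
    show "scheme_defined N (\<lambda>i. x i t)"
      by (rule grid_pair.scheme_defined_near[OF grid_pair_near[OF t' x(1) nearx(1)[OF t']]])
    show "(x j has_vector_derivative scheme_rhs f N (\<lambda>i. x i t) j) (at t within {0..T})"
      using x(3)[OF t', of j] R_eq[OF t' x(1) nearx(1)[OF t'], of j] by simp
  qed (use x contx X0 in auto)
  moreover have "y j t = x j t" if y: "scheme_solution f T X0 N y" and t: "t \<in> {0..T}" for y j t
  proof -
    have pery: "grid_fun N (\<lambda>j. y j t)" if "t \<in> {0..T}" for t
      using y that by (simp add: scheme_solution_def)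
    have y0: "y j 0 = X j 0" for j
    proof -
      let ?i = "(j - 1) mod int N + 1"
      have "grid_fun N (\<lambda>j. X j 0)" using cons[of 0] T by (simp add: consistent_def)
      moreover have "y ?i 0 = X ?i 0"
        using y mod_index_range[OF N, of j] X0 by (simp add: scheme_solution_def)
      ultimately show ?thesis
        using grid_fun_reduce[of N "\<lambda>j. X j 0" j] grid_fun_reduce[OF pery[of 0], of j] T by simp
    qed
    have neary: "near y t" if "t \<in> {0..T}" for t
      using stays_near[OF pery scheme_solution_all(1)[OF y N] y0 scheme_solution_all(2)[OF y N] that] by auto
    show ?thesis
    proof (rule truncated_solution_unique[OF pery x(1) scheme_solution_all(1)[OF y N] contx _ _ _ t])
      show "y j 0 = x j 0" for j by (simp add: y0 x(2))
      fix j t assume s: "t \<in> {0<..T}"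
      then have s': "t \<in> {0..T}" by simp
      show "(y j has_vector_derivative R (\<lambda>i. y i t) j) (at t within {0..T})"
        using scheme_solution_all(2)[OF y N s, of j] R_eq[OF s' pery[OF s'] neary[OF s'], of j] by simp
      show "(x j has_vector_derivative R (\<lambda>i. x i t) j) (at t within {0..T})" by (rule x(3)[OF s'])
    qed
  qed
  moreover have "H1G_norm N (\<lambda>j. X j t - x j t) \<le> sqrt ((1 + 8 * M) * exp (C * T)) * h\<^sup>2" if t: "t \<in> {0..T}" for t
  proof -
    let ?X = "\<lambda>j. X j t" and ?x = "\<lambda>j. x j t" and ?E = "grid_energy N (\<lambda>j. X j t) (\<lambda>j. x j t)"
    interpret gp: grid_pair f N c M \<Lambda> \<epsilon> ?X "\<lambda>j. V j t" ?x
      by (rule grid_pair_near[OF t x(1) nearx(1)[OF t]])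
    let ?S = "\<Sum>j=1..int N. (norm (X j t - x j t))\<^sup>2"
    let ?D = "\<Sum>j=1..int N. (norm ((X j t - x j t) - (X (j - 1) t - x (j - 1) t)))\<^sup>2"
    have 1: "h * ?S \<le> ?E"
    proof -
      have "h * ?S \<le> (\<Sum>j=1..int N. c / 4 * (h * (gp.s j)\<^sup>2) + h * (gp.\<delta> j)\<^sup>2 + h * (gp.\<eta> j)\<^sup>2)"
        unfolding sum_distrib_left using h c by (intro sum_mono) auto
      then show ?thesis using gp.grid_energy_bounds by linarith
    qed
    \<comment> \<open>In the norm the difference quotients carry the weight
      \<open>h / h\<^sup>2\<close>; the factor \<open>h\<close> gained in
      \<open>energy_controls_difference\<close> cancels it, so the H^1 part costs no power of
      \<open>h\<close>.\<close>
    have 2: "?D / h \<le> 8 * M * ?E"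
      using gp.energy_controls_difference h by (simp add: divide_le_eq mult.assoc mult.commute mult.left_commute)
    have "h * (\<Sum>j=1..int N. (norm (X j t - x j t))\<^sup>2 + (norm ((X j t - x j t - (X (j - 1) t - x (j - 1) t)) /\<^sub>R h))\<^sup>2)
        = h * ?S + ?D / h"
    proof -
      have "(norm (v /\<^sub>R h))\<^sup>2 = (norm v)\<^sup>2 / h\<^sup>2" for v :: "real^2"
        using h by (simp add: power_mult_distrib power_inverse divide_inverse mult.commute)
      then show ?thesis
        using h by (simp add: sum.distrib distrib_left power2_eq_square flip: sum_divide_distrib)
    qed
    also have "\<dots> \<le> (1 + 8 * M) * ?E" using 1 2 by (simp add: distrib_right)
    also have "\<dots> \<le> (1 + 8 * M) * (exp (C * T) * h ^ 4)"
      using nearx(2)[OF t] c by (intro mult_left_mono) auto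
    also have "\<dots> = ((1 + 8 * M) * exp (C * T)) * (h\<^sup>2)\<^sup>2" by simp
    finally have "H1G_norm N (\<lambda>j. X j t - x j t) \<le> sqrt (((1 + 8 * M) * exp (C * T)) * (h\<^sup>2)\<^sup>2)"
      unfolding H1G_norm_def by (rule real_sqrt_le_mono)
    also have "\<dots> = sqrt ((1 + 8 * M) * exp (C * T)) * h\<^sup>2"
      unfolding real_sqrt_mult by (simp only: real_sqrt_abs abs_power2)
    finally show ?thesis .
  qed
  ultimately show ?thesis by blast
qed

end

section \<open>Consistency\<close>

text \<open>The summands are the errors in \<open>residual_bound\<close>: length times velocity,
  tangent jump, length times forcing, and finally the error of the forcing together with that of the
  middle tangent. The factor \<open>4 * M\<close> is the price of dividing by a mean edge length of
  at least \<open>h / (4 * M)\<close>.\<close>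

definition residual_const :: "real \<Rightarrow> real \<Rightarrow> real \<Rightarrow> real" where
  "residual_const M B D = 4 * M * (2 * M ^ 4 + 140 * M ^ 6 + 2 * M ^ 3 * B + M * (D + 44 * M ^ 4 * B))"

definition length_const :: "real \<Rightarrow> real \<Rightarrow> real" where
  "length_const M \<Lambda> = \<Lambda> * (4 * pi * M ^ 5)"

text \<open>A sum rather than a maximum, so that each constant needed in \<open>consistent\<close>
  is visibly below it.\<close>

definition consistency_const :: "real \<Rightarrow> real \<Rightarrow> real \<Rightarrow> real" where
  "consistency_const M \<Lambda> B = 300 * M ^ 7 + residual_const M B (length_const M \<Lambda>) + B + length_const M \<Lambda> + M"

text \<open>A snapshot of the flow: \<open>u\<close> is the curve, \<open>v\<close> its velocity.
  One constant \<open>M \<ge> 1\<close> bounds the derivatives and, as \<open>1 / M\<close>, the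
  speed from below, so that error terms can be merged into the highest power of
  \<open>M\<close>.\<close>

locale smooth_curve =
  fixes u u1 u2 u3 u4 v v1 v2 v3 :: "real \<Rightarrow> real^2" and M :: real
  assumes du: "\<And>x. (u has_vector_derivative u1 x) (at x)" "\<And>x. (u1 has_vector_derivative u2 x) (at x)"
      "\<And>x. (u2 has_vector_derivative u3 x) (at x)" "\<And>x. (u3 has_vector_derivative u4 x) (at x)"
    and dv: "\<And>x. (v has_vector_derivative v1 x) (at x)" "\<And>x. (v1 has_vector_derivative v2 x) (at x)"
      "\<And>x. (v2 has_vector_derivative v3 x) (at x)"
    and bu: "\<And>x. norm (u1 x) \<le> M" "\<And>x. norm (u2 x) \<le> M" "\<And>x. norm (u3 x) \<le> M" "\<And>x. norm (u4 x) \<le> M"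
    and bv: "\<And>x. norm (v x) \<le> M" "\<And>x. norm (v1 x) \<le> M" "\<And>x. norm (v2 x) \<le> M" "\<And>x. norm (v3 x) \<le> M"
    and M: "1 \<le> M" and lower: "\<And>x. 1 / M \<le> norm (u1 x)"
begin

abbreviation "n x \<equiv> sgn (u1 x)"
abbreviation "w x \<equiv> dsgn (u1 x) (u2 x)"

lemma M_powers: "1 \<le> M ^ k" "i \<le> k \<Longrightarrow> M ^ i \<le> M ^ k"
  using M by (auto intro: power_increasing one_le_power)

lemma u1_nz: "u1 x \<noteq> 0" "0 < norm (u1 x)"
proof -
  show "0 < norm (u1 x)" using lower[of x] M by (smt (verit) zero_less_divide_iff)
  then show "u1 x \<noteq> 0" by auto
qed

lemma norm_n [simp]: "norm (n x) = 1"
  using u1_nz by (simp add: norm_sgn)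

lemma le_over_norm:
  assumes "a \<le> b" "0 \<le> b" "1 / k \<le> norm (z :: real^2)" "0 < k"
  shows "a / norm z \<le> b * k"
proof -
  have "a / norm z \<le> b / (1 / k)"
    using assms by (intro frac_le) auto
  then show ?thesis by simp
qed

lemma sgn_n_diff: "norm (sgn z - n x) \<le> 2 * M * norm (z - u1 x)"
proof -
  have "norm (n x - sgn z) \<le> 2 * norm (u1 x - z) / norm (u1 x)" by (rule norm_sgn_diff_le[OF u1_nz(1)])
  also have "\<dots> \<le> (2 * norm (u1 x - z)) * M"
    using M lower by (intro le_over_norm) auto
  finally show ?thesis by (simp add: norm_minus_commute mult.commute mult.left_commute)
qed

lemma n_lip: "norm (n x - n y) \<le> 2 * M\<^sup>2 * \<bar>x - y\<bar>"
proof -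
  have "norm (n x - n y) \<le> 2 * M * norm (u1 x - u1 y)" by (rule sgn_n_diff)
  also have "\<dots> \<le> 2 * M * (M * \<bar>x - y\<bar>)"
    using M by (intro mult_left_mono vector_lipschitz[OF du(2) bu(2)]) auto
  finally show ?thesis by (simp add: power2_eq_square)
qed

section \<open>Difference quotients at a fixed mesh width\<close>

context
  fixes h :: real
  assumes h: "0 < h" and hM: "44 * M ^ 4 * h \<le> 1"
begin

text \<open>The number 44 is the constant of \<open>tangent_sum\<close>; it makes the sum of
  neighbouring tangents at least 1 in length, see \<open>tangent_sum_ge\<close>. The weaker
  consequences collected here keep difference quotients away from zero.\<close>

lemma h_small: "4 * M\<^sup>2 * h \<le> 1" "h \<le> 1" "M * h \<le> 1 / (4 * M)"
proof -
  have "M\<^sup>2 * h \<le> M ^ 4 * h" "1 * h \<le> M ^ 4 * h" using h M_powers(2)[of 2 4] M_powers(1)[of 4] by (auto intro!: mult_right_mono)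
  moreover have "0 \<le> M ^ 4 * h" using h M by simp
  ultimately show 1: "4 * M\<^sup>2 * h \<le> 1" and "h \<le> 1" using hM by linarith+
  show "M * h \<le> 1 / (4 * M)" using 1 M by (simp add: field_simps power2_eq_square)
qed

text \<open>The one-sided difference quotients are \<open>cc x + ss x\<close> and
  \<open>cc x - ss x\<close>. Since \<open>cc x\<close> is \<open>u1 x\<close> up to order h^2 and
  \<open>ss x\<close> is \<open>(h / 2) *\<^sub>R u2 x\<close> up to order h^3, the even and odd
  parts of \<open>sgn\<close> about \<open>cc x\<close> separate the orders in h.\<close>

definition "cc x = (1 / (2 * h)) *\<^sub>R (u (x + h) - u (x - h))"
definition "ss x = (1 / (2 * h)) *\<^sub>R (u (x + h) + u (x - h) - 2 *\<^sub>R u x)"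

lemma cc_ss: "u (x + h) - u x = h *\<^sub>R (cc x + ss x)" "u x - u (x - h) = h *\<^sub>R (cc x - ss x)"
proof -
  have "(u (x + h) - u (x - h)) + (u (x + h) + u (x - h) - 2 *\<^sub>R u x) = 2 *\<^sub>R (u (x + h) - u x)"
    "(u (x + h) - u (x - h)) - (u (x + h) + u (x - h) - 2 *\<^sub>R u x) = 2 *\<^sub>R (u x - u (x - h))"
    by (simp_all add: scaleR_2)
  then show "u (x + h) - u x = h *\<^sub>R (cc x + ss x)" "u x - u (x - h) = h *\<^sub>R (cc x - ss x)"
    unfolding cc_def ss_def scaleR_add_right[symmetric]
      scaleR_diff_right[symmetric] using h by simp_all
qed

lemma norm_half_scale: "norm ((1 / (2 * h)) *\<^sub>R z) = norm z / (2 * h)" for z :: "real^2"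
  using h by simp

lemma cc_bound: "norm (cc x - u1 x) \<le> M * h\<^sup>2"
proof -
  have eq: "cc x - u1 x = (1 / (2 * h)) *\<^sub>R (u (x + h) - u (x - h) - (2 * h) *\<^sub>R u1 x)"
    unfolding cc_def using h by (simp add: scaleR_diff_right)
  have "norm (cc x - u1 x) = norm (u (x + h) - u (x - h) - (2 * h) *\<^sub>R u1 x) / (2 * h)"
    unfolding eq by (rule norm_half_scale)
  also have "\<dots> \<le> (2 * M * h ^ 3) / (2 * h)"
    using h by (intro divide_right_mono central_difference_bound[OF du(1-3) bu(3)]) auto
  also have "\<dots> = M * h\<^sup>2" using h by (simp add: power2_eq_square power3_eq_cube)
  finally show ?thesis .
qed

lemma ss_bound: "norm (ss x - (h / 2) *\<^sub>R u2 x) \<le> M * h ^ 3" "norm (ss x) \<le> M * h"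
proof -
  have eq: "ss x - (h / 2) *\<^sub>R u2 x = (1 / (2 * h)) *\<^sub>R (u (x + h) + u (x - h) - 2 *\<^sub>R u x - h\<^sup>2 *\<^sub>R u2 x)"
  proof -
    have "(1 / (2 * h)) * h\<^sup>2 = h / 2" using h by (simp add: power2_eq_square)
    then show ?thesis unfolding ss_def scaleR_diff_right[of "1 / (2 * h)" _ "h\<^sup>2 *\<^sub>R u2 x"] scaleR_scaleR by simp
  qed
  have "norm (ss x - (h / 2) *\<^sub>R u2 x) = norm (u (x + h) + u (x - h) - 2 *\<^sub>R u x - h\<^sup>2 *\<^sub>R u2 x) / (2 * h)"
    unfolding eq by (rule norm_half_scale)
  also have "\<dots> \<le> (2 * M * h ^ 4) / (2 * h)"
    using h by (intro divide_right_mono second_difference_expansion[OF du bu(4)]) auto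
  also have "\<dots> = M * h ^ 3" using h by (simp add: eval_nat_numeral)
  finally show "norm (ss x - (h / 2) *\<^sub>R u2 x) \<le> M * h ^ 3" .
  have "norm (ss x) = norm (u (x + h) + u (x - h) - 2 *\<^sub>R u x) / (2 * h)"
    unfolding ss_def by (rule norm_half_scale)
  also have "\<dots> \<le> (2 * M * h\<^sup>2) / (2 * h)"
    using h by (intro divide_right_mono second_difference_bound[OF du(1,2) bu(2)]) auto
  also have "\<dots> = M * h" using h by (simp add: power2_eq_square)
  finally show "norm (ss x) \<le> M * h" .
qed

lemma near_u1:
  assumes "norm (z - u1 x) \<le> M * h"
  shows "1 / (2 * M) \<le> norm z" "z \<noteq> 0"
proof -
  have "norm (u1 x) \<le> norm z + norm (z - u1 x)"
    by (metis norm_minus_commute norm_triangle_sub)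
  moreover have "M * h \<le> 1 / M / 4" using h_small(3) by simp
  moreover have "1 / (2 * M) = 1 / M / 2" "0 < 1 / M" using M by simp_all
  ultimately have "1 / M / 2 \<le> norm z" using assms lower[of x] by linarith
  then show 1: "1 / (2 * M) \<le> norm z" by simp
  have "0 < 1 / (2 * M)" using M by simp
  with 1 have "0 < norm z" by linarith
  then show "z \<noteq> 0" by simp
qed

lemma h_sq: "M * h\<^sup>2 \<le> M * h"
  using h h_small(2) M by (simp add: power2_eq_square mult_left_le)

lemma cc_lower: "1 / (2 * M) \<le> norm (cc x)" "cc x \<noteq> 0"
  using near_u1[of "cc x" x] cc_bound[of x] h_sq by auto

lemma ss_le: "norm (ss x) \<le> norm (cc x) / 2"
  using ss_bound(2)[of x] h_small(3) cc_lower(1)[of x] by simp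

lemma sgn_forward: "sgn (u (x + h) - u x) = sgn (cc x + ss x)" "sgn (u x - u (x - h)) = sgn (cc x - ss x)"
  unfolding cc_ss using h by (simp_all add: sgn_scaleR)

lemma power_over_norm:
  assumes "norm s \<le> b" "1 / (2 * M) \<le> norm z"
  shows "norm s ^ k / norm (z :: real^2) ^ k \<le> (b * (2 * M)) ^ k"
  unfolding power_divide[symmetric]
  using assms M order_trans[OF norm_ge_zero assms(1)] by (intro power_mono le_over_norm) auto

text \<open>The odd part of \<open>sgn\<close> about \<open>cc x\<close> leaves
  \<open>2 *\<^sub>R dsgn (cc x) (ss x)\<close>. Moving the base point to \<open>u1 x\<close> costs
  h^2 times h, moving the direction to \<open>(h / 2) *\<^sub>R u2 x\<close> costs h^3 and takes the
  fourth derivative. The constants add up as 112 + 24 + 4.\<close>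

lemma tangent_difference:
  "norm (sgn (u (x + h) - u x) - sgn (u x - u (x - h)) - h *\<^sub>R w x) \<le> 140 * M ^ 6 * h ^ 3"
proof -
  let ?c = "cc x" and ?s = "ss x"
  have 1: "norm (sgn (?c + ?s) - sgn (?c - ?s) - 2 *\<^sub>R dsgn ?c ?s) \<le> 112 * M ^ 6 * h ^ 3"
  proof -
    have "norm (sgn (?c + ?s) - sgn (?c - ?s) - 2 *\<^sub>R dsgn ?c ?s) \<le> 14 * (norm ?s ^ 3 / norm ?c ^ 3)"
      using sgn_odd_part[OF cc_lower(2) ss_le, of x] by simp
    also have "\<dots> \<le> 14 * (M * h * (2 * M)) ^ 3"
      by (intro mult_left_mono power_over_norm ss_bound cc_lower) auto
    finally show ?thesis by (simp add: eval_nat_numeral algebra_simps)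
  qed
  have 2: "norm (2 *\<^sub>R (dsgn ?c ?s - dsgn (u1 x) ?s)) \<le> 24 * M ^ 6 * h ^ 3"
  proof -
    have "norm (dsgn ?c ?s - dsgn (u1 x) ?s) \<le> 6 * norm (?c - u1 x) * norm ?s / (norm ?c * norm (u1 x))"
      by (rule norm_dsgn_diff_le[OF u1_nz(1) cc_lower(2)])
    also have "\<dots> \<le> 6 * (M * h\<^sup>2) * (M * h) / (1 / (2 * M) * (1 / M))"
      using M h cc_lower(1)[of x] lower[of x] u1_nz(2)[of x]
      by (intro frac_le mult_mono cc_bound ss_bound) auto
    also have "\<dots> = 12 * (M ^ 4 * h ^ 3)" using M by (simp add: eval_nat_numeral field_simps)
    also have "\<dots> \<le> 12 * (M ^ 6 * h ^ 3)" using h M_powers by (intro mult_left_mono mult_right_mono) auto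
    finally show ?thesis by (simp add: mult.commute mult.left_commute)
  qed
  have 3: "norm (2 *\<^sub>R dsgn (u1 x) (?s - (h / 2) *\<^sub>R u2 x)) \<le> 4 * M ^ 6 * h ^ 3"
  proof -
    have "norm (dsgn (u1 x) (?s - (h / 2) *\<^sub>R u2 x)) \<le> 2 * norm (?s - (h / 2) *\<^sub>R u2 x) / norm (u1 x)"
      by (rule norm_dsgn_le)
    also have "\<dots> \<le> (2 * (M * h ^ 3)) * M"
      using M h lower by (intro le_over_norm mult_left_mono ss_bound) auto
    also have "\<dots> = 2 * (M\<^sup>2 * h ^ 3)" by (simp add: power2_eq_square)
    also have "\<dots> \<le> 2 * (M ^ 6 * h ^ 3)" using h M_powers by (intro mult_left_mono mult_right_mono) auto
    finally show ?thesis by (simp add: mult.commute mult.left_commute)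
  qed
  have eq: "sgn (?c + ?s) - sgn (?c - ?s) - h *\<^sub>R w x =
      (sgn (?c + ?s) - sgn (?c - ?s) - 2 *\<^sub>R dsgn ?c ?s) + 2 *\<^sub>R (dsgn ?c ?s - dsgn (u1 x) ?s)
      + 2 *\<^sub>R dsgn (u1 x) (?s - (h / 2) *\<^sub>R u2 x)"
    unfolding dsgn_diff[symmetric] dsgn_scale by (simp add: algebra_simps)
  show ?thesis
    unfolding sgn_forward eq using norm_triangle_mono[OF norm_triangle_mono[OF 1 2] 3] by (simp add: mult.commute mult.left_commute)
qed

text \<open>Only the even part enters, hence there is no term of first order in h; 44 is 40 for the
  even part plus 4 for moving from \<open>cc x\<close> to \<open>u1 x\<close>.\<close>

lemma tangent_sum:
  "norm (sgn (u (x + h) - u x) + sgn (u x - u (x - h)) - 2 *\<^sub>R n x) \<le> 44 * M ^ 4 * h\<^sup>2"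
proof -
  let ?c = "cc x" and ?s = "ss x"
  have 1: "norm (sgn (?c + ?s) + sgn (?c - ?s) - 2 *\<^sub>R sgn ?c) \<le> 40 * (M ^ 4 * h\<^sup>2)"
  proof -
    have "norm (sgn (?c + ?s) + sgn (?c - ?s) - 2 *\<^sub>R sgn ?c) \<le> 10 * (norm ?s ^ 2 / norm ?c ^ 2)"
      using sgn_even_part[OF cc_lower(2) ss_le, of x] by simp
    also have "\<dots> \<le> 10 * (M * h * (2 * M)) ^ 2"
      by (intro mult_left_mono power_over_norm ss_bound cc_lower) auto
    finally show ?thesis by (simp add: eval_nat_numeral algebra_simps)
  qed
  have 2: "norm (2 *\<^sub>R (sgn ?c - n x)) \<le> 4 * (M ^ 4 * h\<^sup>2)"
  proof -
    have "norm (sgn ?c - n x) \<le> 2 * M * (M * h\<^sup>2)"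
      using sgn_n_diff[of ?c x] M mult_left_mono[OF cc_bound[of x], of "2 * M"] by linarith
    also have "\<dots> = 2 * (M\<^sup>2 * h\<^sup>2)" by (simp add: power2_eq_square)
    also have "\<dots> \<le> 2 * (M ^ 4 * h\<^sup>2)" using h M_powers by (intro mult_left_mono mult_right_mono) auto
    finally show ?thesis by (simp add: mult.commute mult.left_commute)
  qed
  have eq: "sgn (?c + ?s) + sgn (?c - ?s) - 2 *\<^sub>R n x
      = (sgn (?c + ?s) + sgn (?c - ?s) - 2 *\<^sub>R sgn ?c) + 2 *\<^sub>R (sgn ?c - n x)" by (simp add: algebra_simps)
  show ?thesis unfolding sgn_forward eq using norm_triangle_mono[OF 1 2] by (simp add: mult.commute mult.left_commute)
qed

lemma tangent_sum_ge: "1 \<le> norm (sgn (u (x + h) - u x) + sgn (u x - u (x - h)))"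
proof -
  have "44 * M ^ 4 * h\<^sup>2 \<le> 1 * h"
    using mult_right_mono[OF hM, of h] h by (simp add: power2_eq_square)
  then have "norm (sgn (u (x + h) - u x) + sgn (u x - u (x - h)) - 2 *\<^sub>R n x) \<le> 1"
    using tangent_sum[of x] h_small(2) by linarith
  moreover have "norm (2 *\<^sub>R n x) = 2" by simp
  ultimately show ?thesis
    using norm_triangle_ineq2[of "2 *\<^sub>R n x" "sgn (u (x + h) - u x) + sgn (u x - u (x - h))"]
    unfolding norm_minus_commute[of "2 *\<^sub>R n x"] by linarith
qed

lemma mid_tangent: "norm (sgn (sgn (u (x + h) - u x) + sgn (u x - u (x - h))) - n x) \<le> 44 * M ^ 4 * h\<^sup>2"
proof -
  let ?z = "sgn (u (x + h) - u x) + sgn (u x - u (x - h))"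
  have "norm (sgn (2 *\<^sub>R n x) - sgn ?z) \<le> 2 * norm (2 *\<^sub>R n x - ?z) / norm (2 *\<^sub>R n x)"
    using u1_nz by (intro norm_sgn_diff_le) (simp add: sgn_zero_iff)
  moreover have "sgn (n x) = n x" by (subst sgn_div_norm) simp
  ultimately show ?thesis using tangent_sum[of x] by (simp add: sgn_scaleR norm_minus_commute)
qed

text \<open>A single chord deviates from \<open>h * norm (u1 x)\<close> by order h^2 in general; in
  the mean of the two adjacent chords this order cancels, by \<open>norm_sum_sym\<close> and
  \<open>norm_sum_sym_le\<close>.\<close>

lemma length_sum:
  "\<bar>(norm (u (x + h) - u x) + norm (u x - u (x - h))) / 2 - h * norm (u1 x)\<bar> \<le> 2 * M ^ 3 * h ^ 3"
proof -
  let ?c = "cc x" and ?s = "ss x"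
  have e: "(norm (u (x + h) - u x) + norm (u x - u (x - h))) / 2 = h * ((norm (?c + ?s) + norm (?c - ?s)) / 2)"
  proof -
    have "norm (h *\<^sub>R z) = h * norm z" for z :: "real^2" using h by simp
    then show ?thesis unfolding cc_ss by (simp only: distrib_left times_divide_eq_right)
  qed
  have "norm ?s ^ 2 / norm ?c \<le> (M * h)\<^sup>2 * (2 * M)" (is "?q \<le> _")
    using M h cc_lower by (intro le_over_norm power_mono ss_bound) auto
  then have "?q \<le> 2 * (M ^ 3 * h\<^sup>2)"
    by (simp add: power_mult_distrib power3_eq_cube power2_eq_square mult.commute mult.left_commute)
  then have 1: "\<bar>(norm (?c + ?s) + norm (?c - ?s)) / 2 - norm ?c\<bar> \<le> M ^ 3 * h\<^sup>2"
  proof -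
    have "\<bar>A / 2 - R\<bar> \<le> X" if "q \<le> 2 * X" "2 * R \<le> A" "A \<le> 2 * R + q" "0 \<le> X" for A R X q :: real
      using that by linarith
    from this[OF \<open>?q \<le> 2 * (M ^ 3 * h\<^sup>2)\<close> norm_sum_sym[OF cc_lower(2) ss_le] norm_sum_sym_le[OF cc_lower(2) ss_le]]
    show ?thesis using M by simp
  qed
  have "\<bar>norm ?c - norm (u1 x)\<bar> \<le> M * h\<^sup>2"
    using norm_triangle_ineq3[of ?c "u1 x"] cc_bound[of x] by linarith
  also have "\<dots> \<le> M ^ 3 * h\<^sup>2" using M_powers(2)[of 1 3] by (intro mult_right_mono) auto
  finally have "\<bar>(norm (?c + ?s) + norm (?c - ?s)) / 2 - norm (u1 x)\<bar> \<le> 2 * (M ^ 3 * h\<^sup>2)"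
    using 1 by linarith
  then have "h * \<bar>(norm (?c + ?s) + norm (?c - ?s)) / 2 - norm (u1 x)\<bar> \<le> h * (2 * (M ^ 3 * h\<^sup>2))"
    using h by (intro mult_left_mono) auto
  moreover have "\<bar>h * ((norm (?c + ?s) + norm (?c - ?s)) / 2) - h * norm (u1 x)\<bar> = h * \<bar>(norm (?c + ?s) + norm (?c - ?s)) / 2 - norm (u1 x)\<bar>"
    unfolding right_diff_distrib[symmetric] abs_mult using h by simp
  ultimately show ?thesis unfolding e by (simp add: power2_eq_square power3_eq_cube algebra_simps)
qed

lemma chord_bounds: "norm (u x - u (x - h)) \<le> M * h" "1 / (4 * M) * h \<le> norm (u x - u (x - h))"
proof -
  show "norm (u x - u (x - h)) \<le> M * h" using vector_lipschitz[OF du(1) bu(1), of x "x - h"] h by simp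
  have "1 / (4 * M) \<le> norm (cc x - ss x)"
    using norm_triangle_ineq2[of "cc x" "ss x"] ss_le[of x] cc_lower(1)[of x] by simp
  then show "1 / (4 * M) * h \<le> norm (u x - u (x - h))"
    unfolding cc_ss using h mult_right_mono[of "1 / (4 * M)" "norm (cc x - ss x)" h] by (simp add: mult.commute)
qed

text \<open>A chord is a central difference about the midpoint of its parameter interval, so its
  direction is accurate to second order there.\<close>

lemma chord_tangent: "norm (sgn (u x - u (x - h)) - n (x - h / 2)) \<le> M\<^sup>2 * h\<^sup>2"
proof -
  have "norm (u (x - h / 2 + h / 2) - u (x - h / 2 - h / 2) - (2 * (h / 2)) *\<^sub>R u1 (x - h / 2)) \<le> 2 * M * (h / 2) ^ 3"
    using h by (intro central_difference_bound[OF du(1-3) bu(3)]) auto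
  then have "norm (u x - u (x - h) - h *\<^sub>R u1 (x - h / 2)) \<le> h * (M * h\<^sup>2 / 4)"
    by (simp add: power2_eq_square power3_eq_cube mult.commute mult.left_commute)
  moreover have "u x - u (x - h) - h *\<^sub>R u1 (x - h / 2) = h *\<^sub>R ((1 / h) *\<^sub>R (u x - u (x - h)) - u1 (x - h / 2))"
    using h by (simp add: scaleR_diff_right)
  ultimately have "norm ((1 / h) *\<^sub>R (u x - u (x - h)) - u1 (x - h / 2)) \<le> M * h\<^sup>2 / 4"
    using h by simp
  moreover have "sgn (u x - u (x - h)) = sgn ((1 / h) *\<^sub>R (u x - u (x - h)))" using h by (simp add: sgn_scaleR)
  ultimately have "norm (sgn (u x - u (x - h)) - n (x - h / 2)) \<le> 2 * M * (M * h\<^sup>2 / 4)"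
    using sgn_n_diff[of "(1 / h) *\<^sub>R (u x - u (x - h))" "x - h / 2"] M
      mult_left_mono[of _ "M * h\<^sup>2 / 4" "2 * M"] by (smt (verit))
  also have "\<dots> \<le> M\<^sup>2 * h\<^sup>2" using M h by (simp add: power2_eq_square)
  finally show ?thesis .
qed

lemma symmetric_mean:
  "norm (n (x + h / 2) + n (x - h / 2) - 2 *\<^sub>R n x) \<le> 11 * M ^ 4 * h\<^sup>2"
proof -
  define a b where "a = u1 (x + h / 2)" and "b = u1 (x - h / 2)"
  define c s where "c = (1/2) *\<^sub>R (a + b)" and "s = (1/2) *\<^sub>R (a - b)"
  have cs: "c + s = a" "c - s = b"
  proof -
    have "(a + b) + (a - b) = 2 *\<^sub>R a" "(a + b) - (a - b) = 2 *\<^sub>R b" by (simp_all add: scaleR_2)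
    then show "c + s = a" "c - s = b"
      unfolding c_def s_def scaleR_add_right[symmetric] scaleR_diff_right[symmetric] by simp_all
  qed
  have ab: "norm (a + b - 2 *\<^sub>R u1 x) \<le> 2 * M * (h / 2)\<^sup>2"
    unfolding a_def b_def using h by (intro second_difference_bound[OF du(2,3) bu(3)]) auto
  have e: "c - u1 x = (1/2) *\<^sub>R (a + b - 2 *\<^sub>R u1 x)" by (simp add: c_def scaleR_diff_right)
  have c: "norm (c - u1 x) \<le> M * h\<^sup>2 / 4"
    unfolding e norm_scaleR using ab by (simp add: power_divide)
  have "0 \<le> M * h\<^sup>2" using M by simp
  with c have "norm (c - u1 x) \<le> M * h" using h_sq by linarith
  note cl = near_u1[OF this]
  have "norm (a - b) \<le> M * \<bar>(x + h / 2) - (x - h / 2)\<bar>" unfolding a_def b_def by (rule vector_lipschitz[OF du(2) bu(2)])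
  then have s: "norm s \<le> M * h / 2" unfolding s_def using h by simp
  have sc: "norm s \<le> norm c / 2"
  proof -
    have "1 / (2 * M) = 2 * (1 / (4 * M))" "0 \<le> 1 / (4 * M)" using M by simp_all
    then show ?thesis using s cl(1) h_small(3) by linarith
  qed
  have "norm (sgn (c + s) + sgn (c - s) - 2 *\<^sub>R sgn c) \<le> 10 * (norm s ^ 2 / norm c ^ 2)"
    using sgn_even_part[OF cl(2) sc] by simp
  also have "\<dots> \<le> 10 * (M * h / 2 * (2 * M)) ^ 2"
    by (intro mult_left_mono power_over_norm s cl) auto
  also have "\<dots> = 10 * (M ^ 4 * h\<^sup>2)" by (simp add: power_mult_distrib power2_eq_square eval_nat_numeral)
  finally have 1: "norm (sgn (c + s) + sgn (c - s) - 2 *\<^sub>R sgn c) \<le> 10 * (M ^ 4 * h\<^sup>2)" .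
  have "norm (sgn c - n x) \<le> 2 * M * (M * h\<^sup>2 / 4)"
    using sgn_n_diff[of c x] M mult_left_mono[OF c, of "2 * M"] by linarith
  also have "\<dots> = 1/2 * (M\<^sup>2 * h\<^sup>2)" by (simp add: power2_eq_square)
  also have "\<dots> \<le> 1/2 * (M ^ 4 * h\<^sup>2)" using h M_powers(2)[of 2 4] by (intro mult_left_mono mult_right_mono) auto
  finally have 2: "norm (2 *\<^sub>R (sgn c - n x)) \<le> 1 * (M ^ 4 * h\<^sup>2)" by simp
  have eq: "n (x + h / 2) + n (x - h / 2) - 2 *\<^sub>R n x
      = (sgn (c + s) + sgn (c - s) - 2 *\<^sub>R sgn c) + 2 *\<^sub>R (sgn c - n x)"
    unfolding cs a_def b_def by (simp add: scaleR_diff_right)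
  show ?thesis unfolding eq using norm_triangle_mono[OF 1 2] by (simp only: distrib_right[symmetric]) simp
qed

text \<open>Expanding the product of means avoids second derivatives of \<open>n\<close>.\<close>

lemma trapezoid_midpoint:
  "\<bar>n (x + h / 2) \<bullet> v1 (x + h / 2) + n (x - h / 2) \<bullet> v1 (x - h / 2) - 2 * (n x \<bullet> v1 x)\<bar> \<le> 13 * M ^ 5 * h\<^sup>2"
proof -
  define p m q r where "p = n (x + h / 2)" and "m = n (x - h / 2)" and "q = v1 (x + h / 2)" and "r = v1 (x - h / 2)"
  have 1: "\<bar>(p + m - 2 *\<^sub>R n x) \<bullet> (q + r)\<bar> \<le> (11 * M ^ 4 * h\<^sup>2) * (M + M)"
    unfolding p_def m_def q_def r_def
    by (rule order_trans[OF Cauchy_Schwarz_ineq2])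
      (intro mult_mono symmetric_mean norm_triangle_mono bv norm_ge_zero mult_nonneg_nonneg; use M in simp)
  have "norm (q + r - 2 *\<^sub>R v1 x) \<le> 2 * M * (h / 2)\<^sup>2"
    unfolding q_def r_def using h by (intro second_difference_bound[OF dv(2,3) bv(4)]) auto
  then have 2: "\<bar>n x \<bullet> (q + r - 2 *\<^sub>R v1 x)\<bar> \<le> 1 * (2 * M * (h / 2)\<^sup>2)"
    by (intro order_trans[OF Cauchy_Schwarz_ineq2] mult_mono) auto
  have 3: "\<bar>(p - m) \<bullet> (q - r)\<bar> \<le> (2 * M\<^sup>2 * h) * (M * h)"
  proof (rule order_trans[OF Cauchy_Schwarz_ineq2], intro mult_mono)
    show "norm (p - m) \<le> 2 * M\<^sup>2 * h" unfolding p_def m_def using n_lip[of "x + h / 2" "x - h / 2"] h by simp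
    show "norm (q - r) \<le> M * h" unfolding q_def r_def
      using vector_lipschitz[OF dv(2) bv(3), of "x + h / 2" "x - h / 2"] h by simp
  qed (use h M in auto)
  have "p \<bullet> q + m \<bullet> r - 2 * (n x \<bullet> v1 x) = ((p + m - 2 *\<^sub>R n x) \<bullet> (q + r)) / 2 + n x \<bullet> (q + r - 2 *\<^sub>R v1 x)
      + ((p - m) \<bullet> (q - r)) / 2"
    by (simp add: inner_add_left inner_add_right inner_diff_left inner_diff_right field_simps)
  also have "\<bar>\<dots>\<bar> \<le> (11 * M ^ 4 * h\<^sup>2) * (M + M) / 2 + 1 * (2 * M * (h / 2)\<^sup>2) + (2 * M\<^sup>2 * h) * (M * h) / 2"
    using 1 2 3 by linarith
  also have "\<dots> = 11 * (M ^ 5 * h\<^sup>2) + 1/2 * (M ^ 1 * h\<^sup>2) + M ^ 3 * h\<^sup>2"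
    by (simp add: power2_eq_square eval_nat_numeral)
  also have "\<dots> \<le> 11 * (M ^ 5 * h\<^sup>2) + 1/2 * (M ^ 5 * h\<^sup>2) + M ^ 5 * h\<^sup>2"
    by (intro add_mono mult_left_mono mult_right_mono M_powers) auto
  also have "\<dots> \<le> 13 * M ^ 5 * h\<^sup>2" using M by simp
  finally show ?thesis unfolding p_def m_def q_def r_def .
qed

text \<open>The expression is twice \<open>T\<close> times the increment of \<open>v\<close>, plus
  the two tangent jumps times \<open>v\<close> at the end points. To leading order this is
  \<open>2 * h\<close> times \<open>n \<bullet> v1\<close> at the midpoint plus \<open>h\<close>
  times \<open>w \<bullet> v\<close> at both ends. By \<open>orth\<close> what remains is the
  midpoint rule against the trapezoidal rule, of order h^3.\<close>

lemma tangential_variation: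
  assumes orth: "\<And>x. w x \<bullet> v x = - (n x \<bullet> v1 x)"
  shows "\<bar>(sgn (u x - u (x - h)) + sgn (u (x + h) - u x)) \<bullet> v x
      - (sgn (u (x - h) - u (x - h - h)) + sgn (u x - u (x - h))) \<bullet> v (x - h)\<bar> \<le> 300 * M ^ 7 * h ^ 3"
proof -
  define T0 T T1 where "T0 = sgn (u (x - h) - u (x - h - h))" and "T = sgn (u x - u (x - h))" and "T1 = sgn (u (x + h) - u x)"
  let ?m = "x - h / 2"
  have cs: "\<bar>a \<bullet> b\<bar> \<le> k * l" if "norm a \<le> k" "norm b \<le> l" for a b :: "real^2" and k l
    by (rule order_trans[OF Cauchy_Schwarz_ineq2]) (intro mult_mono that norm_ge_zero order_trans[OF norm_ge_zero that(1)])
  have t1: "\<bar>(T1 - T - h *\<^sub>R w x) \<bullet> v x\<bar> \<le> (140 * M ^ 6 * h ^ 3) * M"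
    unfolding T1_def T_def by (intro cs tangent_difference bv)
  have "norm (sgn (u (x - h + h) - u (x - h)) - sgn (u (x - h) - u (x - h - h)) - h *\<^sub>R w (x - h)) \<le> 140 * M ^ 6 * h ^ 3"
    by (rule tangent_difference)
  then have t0: "\<bar>(T - T0 - h *\<^sub>R w (x - h)) \<bullet> v (x - h)\<bar> \<le> (140 * M ^ 6 * h ^ 3) * M"
    unfolding T0_def T_def by (intro cs bv) simp
  have "norm (v (?m + h / 2) - v (?m - h / 2) - (2 * (h / 2)) *\<^sub>R v1 ?m) \<le> 2 * M * (h / 2) ^ 3"
    using h by (intro central_difference_bound[OF dv bv(4)]) auto
  then have dV: "norm (v x - v (x - h) - h *\<^sub>R v1 ?m) \<le> M * h ^ 3 / 4" by (simp add: power3_eq_cube)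
  have s1: "\<bar>(T - n ?m) \<bullet> (v x - v (x - h))\<bar> \<le> (M\<^sup>2 * h\<^sup>2) * (M * h)"
    unfolding T_def using vector_lipschitz[OF dv(1) bv(2), of x "x - h"] h
    by (intro cs chord_tangent) simp
  have s2: "\<bar>n ?m \<bullet> (v x - v (x - h) - h *\<^sub>R v1 ?m)\<bar> \<le> 1 * (M * h ^ 3 / 4)"
    by (intro cs dV) simp
  have "\<bar>n (?m + h / 2) \<bullet> v1 (?m + h / 2) + n (?m - h / 2) \<bullet> v1 (?m - h / 2) - 2 * (n ?m \<bullet> v1 ?m)\<bar> \<le> 13 * M ^ 5 * h\<^sup>2"
    by (rule trapezoid_midpoint)
  then have "\<bar>n x \<bullet> v1 x + n (x - h) \<bullet> v1 (x - h) - 2 * (n ?m \<bullet> v1 ?m)\<bar> \<le> 13 * M ^ 5 * h\<^sup>2" by simp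
  then have "h * \<bar>n x \<bullet> v1 x + n (x - h) \<bullet> v1 (x - h) - 2 * (n ?m \<bullet> v1 ?m)\<bar> \<le> h * (13 * M ^ 5 * h\<^sup>2)"
    using h by (intro mult_left_mono) auto
  then have z: "\<bar>h * (n x \<bullet> v1 x + n (x - h) \<bullet> v1 (x - h) - 2 * (n ?m \<bullet> v1 ?m))\<bar> \<le> h * (13 * M ^ 5 * h\<^sup>2)"
    unfolding abs_mult using h by simp
  have "(T + T1) \<bullet> v x - (T0 + T) \<bullet> v (x - h)
    = 2 * ((T - n ?m) \<bullet> (v x - v (x - h))) + 2 * (n ?m \<bullet> (v x - v (x - h) - h *\<^sub>R v1 ?m))
      + (T1 - T - h *\<^sub>R w x) \<bullet> v x + (T - T0 - h *\<^sub>R w (x - h)) \<bullet> v (x - h)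
      + (h * (2 * (n ?m \<bullet> v1 ?m)) + h * (w x \<bullet> v x) + h * (w (x - h) \<bullet> v (x - h)))"
    by (simp add: inner_add_left inner_diff_left inner_diff_right)
  also have "\<dots> = 2 * ((T - n ?m) \<bullet> (v x - v (x - h))) + 2 * (n ?m \<bullet> (v x - v (x - h) - h *\<^sub>R v1 ?m))
      + (T1 - T - h *\<^sub>R w x) \<bullet> v x + (T - T0 - h *\<^sub>R w (x - h)) \<bullet> v (x - h)
      - h * (n x \<bullet> v1 x + n (x - h) \<bullet> v1 (x - h) - 2 * (n ?m \<bullet> v1 ?m))"
    unfolding orth by (simp only: algebra_simps)
  finally have eq: "(T + T1) \<bullet> v x - (T0 + T) \<bullet> v (x - h) = \<dots>" .
  have "\<bar>2 * a + 2 * b + c + d - e\<bar> \<le> 2 * a' + 2 * b' + c' + d' + e'"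
    if "\<bar>a\<bar> \<le> a'" "\<bar>b\<bar> \<le> b'" "\<bar>c\<bar> \<le> c'" "\<bar>d\<bar> \<le> d'" "\<bar>e\<bar> \<le> e'" for a b c d e a' b' c' d' e' :: real
    using that by linarith
  note this[OF s1 s2 t1 t0 z]
  also have "2 * (M\<^sup>2 * h\<^sup>2 * (M * h)) + 2 * (1 * (M * h ^ 3 / 4)) + 140 * M ^ 6 * h ^ 3 * M + 140 * M ^ 6 * h ^ 3 * M + h * (13 * M ^ 5 * h\<^sup>2)
     = 2 * (M ^ 3 * h ^ 3) + 1/2 * (M ^ 1 * h ^ 3) + 280 * (M ^ 7 * h ^ 3) + 13 * (M ^ 5 * h ^ 3)"
    by (simp add: eval_nat_numeral)
  also have "\<dots> \<le> 2 * (M ^ 7 * h ^ 3) + 1/2 * (M ^ 7 * h ^ 3) + 280 * (M ^ 7 * h ^ 3) + 13 * (M ^ 7 * h ^ 3)"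
    using h by (intro add_mono mult_left_mono mult_right_mono M_powers) auto
  also have "\<dots> \<le> 300 * M ^ 7 * h ^ 3" using M h by simp
  finally show ?thesis unfolding eq[unfolded T0_def T_def T1_def] unfolding T0_def T_def T1_def .
qed

text \<open>Multiplying by the mean edge length \<open>P\<close> clears the denominators of the
  scheme, and the flow equation times \<open>h * norm (u1 x)\<close> can be subtracted. Each error
  is then of order h^3, and dividing by \<open>P\<close>, which is at least
  \<open>h / (4 * M)\<close>, leaves h^2.\<close>

lemma residual_bound:
  assumes flow: "v x = (1 / norm (u1 x)) *\<^sub>R w x - F0 *\<^sub>R perp (n x)"
    and B: "\<bar>F0\<bar> \<le> B" and D: "\<bar>F - F0\<bar> \<le> D * h\<^sup>2"
  shows "norm (v x - ((2 / (norm (u x - u (x - h)) + norm (u (x + h) - u x))) *\<^sub>R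
      (sgn (u (x + h) - u x) - sgn (u x - u (x - h)))
      - F *\<^sub>R perp (sgn (sgn (u x - u (x - h)) + sgn (u (x + h) - u x))))) \<le> residual_const M B D * h\<^sup>2"
proof -
  define T T1 where "T = sgn (u x - u (x - h))" and "T1 = sgn (u (x + h) - u x)"
  define P where "P = (norm (u (x + h) - u x) + norm (u x - u (x - h))) / 2"
  define m where "m = sgn (T1 + T)"
  define l where "l = norm (u1 x)"
  have B0: "0 \<le> B" using B by linarith
  have P: "\<bar>P - h * l\<bar> \<le> 2 * M ^ 3 * h ^ 3" unfolding P_def l_def by (rule length_sum)
  have Pb: "1 / (4 * M) * h \<le> P" "P \<le> M * h"
    using chord_bounds[of x] chord_bounds[of "x + h"] unfolding P_def by simp_all
  have "0 < 1 / (4 * M) * h" using h M by simp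
  then have P0: "0 < P" using Pb(1) by linarith
  have T: "norm (T1 - T - h *\<^sub>R w x) \<le> 140 * M ^ 6 * h ^ 3"
    unfolding T_def T1_def by (rule tangent_difference)
  have m: "norm (m - n x) \<le> 44 * M ^ 4 * h\<^sup>2" unfolding m_def T_def T1_def by (rule mid_tangent)
  have lv: "l *\<^sub>R v x = w x - (l * F0) *\<^sub>R perp (n x)"
    unfolding flow l_def scaleR_diff_right using u1_nz(2)[of x] by simp
  have "P *\<^sub>R (v x - ((1 / P) *\<^sub>R (T1 - T) - F *\<^sub>R perp m))
    = (P - h * l) *\<^sub>R v x - (T1 - T - h *\<^sub>R w x) + (h *\<^sub>R (l *\<^sub>R v x - w x) + (P * F) *\<^sub>R perp m)"
    using P0 by (simp add: algebra_simps)
  also have "h *\<^sub>R (l *\<^sub>R v x - w x) + (P * F) *\<^sub>R perp m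
    = ((P - h * l) * F0) *\<^sub>R perp (n x) + P *\<^sub>R ((F - F0) *\<^sub>R perp m + F0 *\<^sub>R perp (m - n x))"
    unfolding lv by (simp add: perp_simps algebra_simps)
  finally have eq: "P *\<^sub>R (v x - ((1 / P) *\<^sub>R (T1 - T) - F *\<^sub>R perp m))
    = (P - h * l) *\<^sub>R v x - (T1 - T - h *\<^sub>R w x)
      + (((P - h * l) * F0) *\<^sub>R perp (n x) + P *\<^sub>R ((F - F0) *\<^sub>R perp m + F0 *\<^sub>R perp (m - n x)))" .
  have 1: "norm ((P - h * l) *\<^sub>R v x) \<le> (2 * M ^ 3 * h ^ 3) * M"
    unfolding norm_scaleR using P bv(1)[of x] M h by (intro mult_mono) auto
  have 2: "norm (((P - h * l) * F0) *\<^sub>R perp (n x)) \<le> (2 * M ^ 3 * h ^ 3) * B"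
    using P B M h by (simp add: abs_mult) (intro mult_mono; simp)
  have m1: "norm m \<le> 1" unfolding m_def by (rule norm_sgn_le)
  have "norm ((F - F0) *\<^sub>R perp m + F0 *\<^sub>R perp (m - n x)) \<le> (D * h\<^sup>2) * 1 + B * (44 * M ^ 4 * h\<^sup>2)"
  proof (intro norm_triangle_mono)
    show "norm ((F - F0) *\<^sub>R perp m) \<le> (D * h\<^sup>2) * 1"
      unfolding norm_scaleR norm_perp using D m1 by (intro mult_mono) auto
    show "norm (F0 *\<^sub>R perp (m - n x)) \<le> B * (44 * M ^ 4 * h\<^sup>2)"
      unfolding norm_scaleR norm_perp using B m B0 by (intro mult_mono) auto
  qed
  then have 3: "norm (P *\<^sub>R ((F - F0) *\<^sub>R perp m + F0 *\<^sub>R perp (m - n x)))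
      \<le> (M * h) * ((D * h\<^sup>2) * 1 + B * (44 * M ^ 4 * h\<^sup>2))"
    unfolding norm_scaleR using P0 Pb(2) M h by (intro mult_mono) auto
  have "norm (P *\<^sub>R (v x - ((1 / P) *\<^sub>R (T1 - T) - F *\<^sub>R perp m)))
      \<le> ((2 * M ^ 3 * h ^ 3) * M + 140 * M ^ 6 * h ^ 3)
        + ((2 * M ^ 3 * h ^ 3) * B + (M * h) * ((D * h\<^sup>2) * 1 + B * (44 * M ^ 4 * h\<^sup>2)))"
    unfolding eq by (intro norm_triangle_mono norm_triangle_le_diff add_mono 1 2 3 T)
  also have "\<dots> = h / (4 * M) * (residual_const M B D * h\<^sup>2)"
    unfolding residual_const_def using M by (simp add: field_simps eval_nat_numeral)
  finally have "P * norm (v x - ((1 / P) *\<^sub>R (T1 - T) - F *\<^sub>R perp m)) \<le> h / (4 * M) * (residual_const M B D * h\<^sup>2)"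
    using P0 by simp
  moreover have "h / (4 * M) * norm (v x - ((1 / P) *\<^sub>R (T1 - T) - F *\<^sub>R perp m))
      \<le> P * norm (v x - ((1 / P) *\<^sub>R (T1 - T) - F *\<^sub>R perp m))"
    using Pb(1) by (intro mult_right_mono) auto
  ultimately have "h / (4 * M) * norm (v x - ((1 / P) *\<^sub>R (T1 - T) - F *\<^sub>R perp m)) \<le> h / (4 * M) * (residual_const M B D * h\<^sup>2)"
    by (rule order_trans[rotated])
  then have fin: "norm (v x - ((1 / P) *\<^sub>R (T1 - T) - F *\<^sub>R perp m)) \<le> residual_const M B D * h\<^sup>2"
    using h M by (subst (asm) mult_le_cancel_left_pos) auto
  have "2 / (norm (u x - u (x - h)) + norm (u (x + h) - u x)) = 1 / P"
    unfolding P_def by (simp add: add.commute)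
  then show ?thesis
    using fin unfolding m_def T_def T1_def by (simp only: add.commute)
qed

text \<open>With \<open>T\<close> the direction of the chord, \<open>T \<bullet> u1 s\<close>
  integrates exactly to the chord length. The excess \<open>norm (u1 s) - T \<bullet> u1 s\<close>
  is the speed times half the squared distance of \<open>T\<close> and \<open>n s\<close>:
  nonnegative, and of order h^2 on an interval of length \<open>h\<close>.\<close>

lemma chord_arc:
  "norm (u x - u (x - h)) \<le> integral {x - h..x} (\<lambda>s. norm (u1 s))"
  "integral {x - h..x} (\<lambda>s. norm (u1 s)) \<le> norm (u x - u (x - h)) + 2 * M ^ 5 * h ^ 3"
proof -
  define T where "T = sgn (u x - u (x - h))"
  have T1: "norm T = 1"
    using chord_bounds(2)[of x] h M unfolding T_def norm_sgn by (auto simp: field_simps)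
  have cu1: "continuous_on S u1" for S
    using du(2) by (meson continuous_at_imp_continuous_on has_vector_derivative_continuous)
  have iN: "(\<lambda>s. norm (u1 s)) integrable_on {x - h..x}"
    by (intro integrable_continuous_real continuous_intros cu1)
  have iT: "((\<lambda>s. T \<bullet> u1 s) has_integral (T \<bullet> u x - T \<bullet> u (x - h))) {x - h..x}"
  proof (rule fundamental_theorem_of_calculus)
    fix s
    have "((\<lambda>s. T \<bullet> u s) has_vector_derivative T \<bullet> u1 s) (at s)"
      by (rule bounded_linear.has_vector_derivative[OF bounded_linear_inner_right du(1)])
    then show "((\<lambda>s. T \<bullet> u s) has_vector_derivative T \<bullet> u1 s) (at s within {x - h..x})"
      by (rule has_vector_derivative_at_within)
  qed (use h in simp)
  have Q: "T \<bullet> u x - T \<bullet> u (x - h) = norm (u x - u (x - h))"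
    unfolding T_def inner_diff_right[symmetric] by (rule sgn_inner_self)
  define \<phi> where "\<phi> = (\<lambda>s. norm (u1 s) - T \<bullet> u1 s)"
  have I: "(\<phi> has_integral (integral {x - h..x} (\<lambda>s. norm (u1 s)) - norm (u x - u (x - h)))) {x - h..x}"
    unfolding \<phi>_def Q[symmetric] by (intro has_integral_diff integrable_integral iN iT)
  have \<phi>: "\<phi> s = norm (u1 s) * ((norm (T - n s))\<^sup>2 / 2)" for s
  proof -
    have "u1 s = norm (u1 s) *\<^sub>R n s" using u1_nz by (simp add: sgn_div_norm)
    then have "T \<bullet> u1 s = norm (u1 s) * (T \<bullet> n s)" by (metis inner_scaleR_right)
    then show ?thesis unfolding \<phi>_def unit_inner_deficit[OF T1 norm_n, symmetric] by (simp add: algebra_simps)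
  qed
  have "0 \<le> integral {x - h..x} (\<lambda>s. norm (u1 s)) - norm (u x - u (x - h))"
    by (rule has_integral_nonneg[OF I]) (simp add: \<phi>)
  then show "norm (u x - u (x - h)) \<le> integral {x - h..x} (\<lambda>s. norm (u1 s))" by simp
  have "\<phi> s \<le> 2 * M ^ 5 * h\<^sup>2" if s: "s \<in> {x - h..x}" for s
  proof -
    have "norm (T - n s) \<le> norm (T - n (x - h / 2)) + norm (n (x - h / 2) - n s)"
      using norm_triangle_ineq[of "T - n (x - h / 2)" "n (x - h / 2) - n s"] by simp
    also have "\<dots> \<le> M\<^sup>2 * h\<^sup>2 + 2 * M\<^sup>2 * (h / 2)"
    proof (intro add_mono)
      show "norm (T - n (x - h / 2)) \<le> M\<^sup>2 * h\<^sup>2" unfolding T_def by (rule chord_tangent)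
      have "\<bar>x - h / 2 - s\<bar> \<le> h / 2" using s by (auto simp: abs_le_iff field_simps)
      then have "2 * M\<^sup>2 * \<bar>x - h / 2 - s\<bar> \<le> 2 * M\<^sup>2 * (h / 2)" by (intro mult_left_mono) auto
      then show "norm (n (x - h / 2) - n s) \<le> 2 * M\<^sup>2 * (h / 2)" using n_lip[of "x - h / 2" s] by linarith
    qed
    also have "\<dots> \<le> M\<^sup>2 * h + M\<^sup>2 * h"
      using h h_small(2) by (intro add_mono mult_left_mono) (auto simp: power2_eq_square mult_left_le)
    finally have "norm (T - n s) \<le> 2 * (M\<^sup>2 * h)" by (simp only: mult_2)
    then have "(norm (T - n s))\<^sup>2 \<le> (2 * (M\<^sup>2 * h))\<^sup>2" by (intro power_mono) auto
    then have "norm (u1 s) * ((norm (T - n s))\<^sup>2 / 2) \<le> M * ((2 * (M\<^sup>2 * h))\<^sup>2 / 2)"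
      using bu(1) M by (intro mult_mono divide_right_mono) auto
    then show ?thesis unfolding \<phi> by (simp add: power_mult_distrib eval_nat_numeral)
  qed
  then have "integral {x - h..x} (\<lambda>s. norm (u1 s)) - norm (u x - u (x - h)) \<le> (2 * M ^ 5 * h\<^sup>2) * h"
    using has_integral_le[OF I has_integral_const_real[of "2 * M ^ 5 * h\<^sup>2" "x - h" x]] h by (simp add: mult.commute)
  then show "integral {x - h..x} (\<lambda>s. norm (u1 s)) \<le> norm (u x - u (x - h)) + 2 * M ^ 5 * h ^ 3"
    by (simp add: power2_eq_square power3_eq_cube)
qed

lemma polygon_length:
  "(\<Sum>j=1..int k. norm (u (of_int j * h) - u (of_int (j - 1) * h))) \<le> integral {0..real k * h} (\<lambda>s. norm (u1 s))
   \<and> integral {0..real k * h} (\<lambda>s. norm (u1 s))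
     \<le> (\<Sum>j=1..int k. norm (u (of_int j * h) - u (of_int (j - 1) * h))) + real k * (2 * M ^ 5 * h ^ 3)"
proof (induction k)
  case (Suc k)
  let ?x = "real (Suc k) * h"
  have cu1: "continuous_on S u1" for S
    using du(2) by (meson continuous_at_imp_continuous_on has_vector_derivative_continuous)
  have x: "?x - h = real k * h" by (simp add: algebra_simps)
  have "integral {0..real k * h} (\<lambda>s. norm (u1 s)) + integral {real k * h..?x} (\<lambda>s. norm (u1 s))
      = integral {0..?x} (\<lambda>s. norm (u1 s))"
  proof (rule Henstock_Kurzweil_Integration.integral_combine)
    show "(\<lambda>s. norm (u1 s)) integrable_on {0..?x}"
      by (intro integrable_continuous_real continuous_intros cu1)
  qed (use h in \<open>auto simp: algebra_simps\<close>)
  moreover have "(\<Sum>j=1..int (Suc k). norm (u (of_int j * h) - u (of_int (j - 1) * h)))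
      = (\<Sum>j=1..int k. norm (u (of_int j * h) - u (of_int (j - 1) * h))) + norm (u ?x - u (real k * h))"
  proof -
    have "{1..int (Suc k)} = insert (int k + 1) {1..int k}" by auto
    then show ?thesis by (simp add: add.commute)
  qed
  moreover note chord_arc[of ?x, unfolded x]
  moreover have "real (Suc k) * (2 * M ^ 5 * h ^ 3) = real k * (2 * M ^ 5 * h ^ 3) + 2 * M ^ 5 * h ^ 3"
    by (simp add: algebra_simps)
  ultimately show ?case using Suc.IH by linarith
qed simp

end

lemma grid_consistent:
  fixes f :: "real \<Rightarrow> real"
  assumes N: "N > 0" and hM: "44 * M ^ 4 * mesh N \<le> 1"
    and per: "\<And>x. u (x + 2 * pi) = u x" "\<And>x. v (x + 2 * pi) = v x"
    and lip: "\<And>a b. 0 < a \<Longrightarrow> 0 < b \<Longrightarrow> \<bar>f a - f b\<bar> \<le> \<Lambda> * \<bar>a - b\<bar>" and \<Lambda>: "0 \<le> \<Lambda>"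
    and L: "L = integral {0..2 * pi} (\<lambda>s. norm (u1 s))" and B: "\<bar>f L\<bar> \<le> B"
    and flow: "\<And>x. v x = (1 / norm (u1 x)) *\<^sub>R w x - f L *\<^sub>R perp (n x)"
    and dn: "\<And>x. (n has_vector_derivative w x) (at x)"
  shows "consistent (1 / (4 * M)) (consistency_const M \<Lambda> B) f N (\<lambda>j. u (grid_pt N j)) (\<lambda>j. v (grid_pt N j))"
proof -
  define h where "h = mesh N"
  define X where "X = (\<lambda>j. u (grid_pt N j))"
  have h: "0 < h" unfolding h_def by (rule mesh_pos[OF N])
  have hM': "44 * M ^ 4 * h \<le> 1" using hM by (simp add: h_def)
  have Nh: "real N * h = 2 * pi" unfolding h_def by (rule mesh_times[OF N])
  have h1: "h \<le> 1" using h_small(2)[OF h hM'] .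
  have gp: "grid_pt N (j - 1) = grid_pt N j - h" "grid_pt N (j + 1) = grid_pt N j + h"
    "grid_pt N (j + int N) = grid_pt N j + 2 * pi" for j
    using Nh by (simp_all add: grid_pt_def h_def algebra_simps)
  have gp2: "grid_pt N (j - 2) = grid_pt N j - 2 * h" for j
    by (simp add: grid_pt_def h_def algebra_simps)
  have seg: "seg_len X j = norm (u (grid_pt N j) - u (grid_pt N j - h))"
    "seg_tan X j = sgn (u (grid_pt N j) - u (grid_pt N j - h))"
    "seg_len X (j + 1) = norm (u (grid_pt N j + h) - u (grid_pt N j))"
    "seg_tan X (j + 1) = sgn (u (grid_pt N j + h) - u (grid_pt N j))"
    "seg_tan X (j - 1) = sgn (u (grid_pt N j - h) - u (grid_pt N j - h - h))" for j
    using gp(1)[of "j + 1"] gp2[of j] by (simp_all add: X_def seg_len_def seg_tan_eq_sgn gp)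
  have len: "discrete_len N X = (\<Sum>j=1..int N. norm (u (of_int j * h) - u (of_int (j - 1) * h)))"
    unfolding discrete_len_def seg_len_def X_def grid_pt_def h_def ..
  have dl: "discrete_len N X \<le> L" "L \<le> discrete_len N X + real N * (2 * M ^ 5 * h ^ 3)"
    using polygon_length[OF h hM', of N] unfolding len[symmetric] Nh L[symmetric] by blast+
  have "0 < seg_len X j" for j
  proof -
    have "0 < 1 / (4 * M) * h" using M h by simp
    then show ?thesis using chord_bounds(2)[OF h hM', of "grid_pt N j"] unfolding seg by linarith
  qed
  then have dpos: "0 < discrete_len N X" unfolding discrete_len_def using N by (intro sum_pos) auto
  let ?D = "length_const M \<Lambda>"
  have F: "\<bar>f (discrete_len N X) - f L\<bar> \<le> ?D * h\<^sup>2"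
  proof -
    have "\<bar>f (discrete_len N X) - f L\<bar> \<le> \<Lambda> * \<bar>discrete_len N X - L\<bar>"
      using dpos dl(1) by (intro lip) auto
    also have "\<dots> \<le> \<Lambda> * (real N * (2 * M ^ 5 * h ^ 3))" using dl \<Lambda> by (intro mult_left_mono) auto
    also have "real N * (2 * M ^ 5 * h ^ 3) = (real N * h) * (2 * M ^ 5 * h\<^sup>2)"
      by (simp add: power2_eq_square power3_eq_cube)
    also have "\<Lambda> * \<dots> = ?D * h\<^sup>2" unfolding Nh length_const_def by simp
    finally show ?thesis .
  qed
  have D0: "0 \<le> ?D" unfolding length_const_def using \<Lambda> M by simp
  have B0: "0 \<le> B" using B by linarith
  have R0: "0 \<le> residual_const M B ?D" unfolding residual_const_def using M D0 B0 by simp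
  let ?C = "consistency_const M \<Lambda> B"
  have M70: "0 \<le> 300 * M ^ 7" using M by simp
  have C: "M \<le> ?C" "300 * M ^ 7 \<le> ?C" "residual_const M B ?D \<le> ?C" "B + ?D \<le> ?C"
    unfolding consistency_const_def using M70 D0 B0 R0 M by linarith+
  \<comment> \<open>By the flow the velocity is normal to the curve; differentiating
    \<open>n y \<bullet> v y = 0\<close> along the curve gives the relation that
    \<open>tangential_variation\<close> needs.\<close>
  have orth: "w x \<bullet> v x = - (n x \<bullet> v1 x)" for x
  proof -
    have nv: "n y \<bullet> v y = 0" for y
      unfolding flow inner_diff_right using dsgn_inner_sgn[of "u1 y" "u2 y"]
      by (simp add: inner_commute[of "n y"])
    have "((\<lambda>y. n y \<bullet> v y) has_real_derivative n x \<bullet> v1 x + w x \<bullet> v x) (at x)"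
      by (rule has_real_derivative_inner[OF dn dv(1)])
    moreover have "((\<lambda>y. n y \<bullet> v y) has_real_derivative 0) (at x)" unfolding nv by simp
    ultimately have "n x \<bullet> v1 x + w x \<bullet> v x = 0" by (rule DERIV_unique)
    then show ?thesis by linarith
  qed
  show ?thesis
    unfolding consistent_def X_def[symmetric] h_def[symmetric]
  proof (intro conjI allI)
    show "grid_fun N X" "grid_fun N (\<lambda>j. v (grid_pt N j))"
      by (simp_all add: grid_fun_def X_def gp per)
    have "?D * h\<^sup>2 \<le> ?D" using D0 h h1 by (simp add: mult_left_le power_le_one)
    then show "\<bar>f (discrete_len N X)\<bar> \<le> ?C" using F B C(4) by linarith
    fix j
    let ?x = "grid_pt N j"
    note sj = seg[of j]
    show "1 / (4 * M) * h \<le> seg_len X j" unfolding sj by (rule chord_bounds[OF h hM'])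
    have "M * h \<le> ?C * h" using C h by (intro mult_right_mono) auto
    then show "seg_len X j \<le> ?C * h" unfolding sj using chord_bounds(1)[OF h hM', of ?x] by linarith
    show "norm (v ?x) \<le> ?C" using bv(1)[of ?x] C by linarith
    have "norm (v ?x - v (?x - h)) \<le> M * h"
      using vector_lipschitz[OF dv(1) bv(2), of ?x "?x - h"] h by simp
    then show "norm (v ?x - v (grid_pt N (j - 1))) \<le> ?C * h"
      unfolding gp using \<open>M * h \<le> ?C * h\<close> by linarith
    show "1 \<le> norm (seg_tan X j + seg_tan X (j + 1))"
      unfolding sj using tangent_sum_ge[OF h hM', of ?x]
      by (simp only: add.commute[of "sgn (u ?x - u (?x - h))"])
    have "residual_const M B ?D * h\<^sup>2 \<le> ?C * h\<^sup>2" using C by (intro mult_right_mono) auto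
    then show "norm (v ?x - scheme_rhs f N X j) \<le> ?C * h\<^sup>2"
      unfolding scheme_rhs_def mid_tan_eq_sgn sj
      by (rule order_trans[OF residual_bound[OF h hM' flow B F]])
    have "300 * M ^ 7 * h ^ 3 \<le> ?C * h ^ 3" using C h by (intro mult_right_mono) auto
    then show "\<bar>(seg_tan X j + seg_tan X (j + 1)) \<bullet> v ?x
        - (seg_tan X (j - 1) + seg_tan X j) \<bullet> v (grid_pt N (j - 1))\<bar> \<le> ?C * h ^ 3"
      unfolding sj gp by (rule order_trans[OF tangential_variation[OF h hM' orth]])
  qed
qed

end

section \<open>Regularity of the exact solution\<close>

lemma vderiv_funpow_Suc: "(vderiv ^^ Suc i) u = vderiv ((vderiv ^^ i) u)"
  by simp

lemma circle_Ck_deriv: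
  assumes "circle_Ck k u" "i < k"
  shows "((vderiv ^^ i) u has_vector_derivative (vderiv ^^ Suc i) u x) (at x)"
  using assms unfolding circle_Ck_def vderiv_funpow_Suc vderiv_def by (simp add: vector_derivative_works)

lemma circle_Ck_continuous:
  assumes "circle_Ck k u" "i \<le> k"
  shows "continuous_on S ((vderiv ^^ i) u)"
proof (cases "i = k")
  case True then show ?thesis using assms by (auto simp: circle_Ck_def intro: continuous_on_subset)
next
  case False
  then have "i < k" using assms by simp
  then show ?thesis
    using circle_Ck_deriv[OF assms(1)] by (meson continuous_at_imp_continuous_on has_vector_derivative_continuous)
qed

lemma circle_Ck_periodic:
  assumes u: "circle_Ck k u"
  shows "i \<le> k \<Longrightarrow> (vderiv ^^ i) u (x + 2 * pi) = (vderiv ^^ i) u x"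
proof (induction i arbitrary: x)
  case 0 then show ?case using u by (simp add: circle_Ck_def)
next
  case (Suc i)
  then have i: "i < k" by simp
  let ?g = "(vderiv ^^ i) u"
  have "((\<lambda>s. ?g (2 * pi + s)) has_vector_derivative (vderiv ^^ Suc i) u (2 * pi + x)) (at x)"
    by (rule has_vector_derivative_shift_add(1)[OF circle_Ck_deriv[OF u i]])
  moreover have "(\<lambda>s. ?g (2 * pi + s)) = ?g" using Suc by (simp add: add.commute)
  ultimately have "(?g has_vector_derivative (vderiv ^^ Suc i) u (2 * pi + x)) (at x)" by simp
  from vector_derivative_unique_at[OF this circle_Ck_deriv[OF u i]] show ?case by (simp add: add.commute)
qed

lemma periodic_real_reduce:
  fixes g :: "real \<Rightarrow> 'a"
  assumes per: "\<And>x. g (x + p) = g x" and "0 < p"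
  obtains y where "y \<in> {0..p}" "g x = g y"
proof -
  have *: "g (x + real n * p) = g x" for x n
  proof (induction n)
    case (Suc n) then show ?case using per[of "x + real n * p"] by (simp add: algebra_simps)
  qed simp
  have int: "g (x + of_int k * p) = g x" for x k
    using *[of x "nat k"] *[of "x + of_int k * p" "nat (- k)"] by (cases "0 \<le> k") auto
  define y where "y = x - of_int \<lfloor>x / p\<rfloor> * p"
  have "of_int \<lfloor>x / p\<rfloor> * p \<le> x" "x < (of_int \<lfloor>x / p\<rfloor> + 1) * p"
    by (rule floor_divide_lower floor_divide_upper, fact)+
  then have "y \<in> {0..p}" unfolding y_def by (simp add: algebra_simps)
  moreover have "g x = g y" using int[of y "\<lfloor>x / p\<rfloor>"] by (simp add: y_def)
  ultimately show thesis by (rule that)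
qed

lemma circle_Ck_bdd:
  assumes "circle_Ck k u" "i \<le> k"
  shows "bdd_above ((\<lambda>\<xi>. norm ((vderiv ^^ i) u \<xi>)) ` {0..2*pi})"
  by (intro bounded_imp_bdd_above compact_imp_bounded compact_continuous_image continuous_intros
      circle_Ck_continuous[OF assms]) auto

text \<open>The suprema run over one period, where compactness makes them finite; periodicity
  carries the bound to the whole line. The remaining summands of the norm are nonnegative.\<close>

lemma norm_le_Ck_norm:
  assumes u: "circle_Ck k u" and i: "i \<le> k"
  shows "norm ((vderiv ^^ i) u x) \<le> Ck_norm k u"
proof -
  let ?S = "\<lambda>i. SUP \<xi>\<in>{0..2*pi}. norm ((vderiv ^^ i) u \<xi>)"
  have le: "norm ((vderiv ^^ l) u y) \<le> ?S l" if "l \<le> k" "y \<in> {0..2*pi}" for l y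
    by (rule cSUP_upper[OF that(2) circle_Ck_bdd[OF u that(1)]])
  have nn: "0 \<le> ?S l" if "l \<le> k" for l using le[OF that, of 0] order_trans[OF norm_ge_zero] by auto
  obtain y where y: "y \<in> {0..2*pi}" "(vderiv ^^ i) u x = (vderiv ^^ i) u y"
    using periodic_real_reduce[of "(vderiv ^^ i) u" "2 * pi" x] circle_Ck_periodic[OF u i] by auto
  have "norm ((vderiv ^^ i) u x) \<le> ?S i" using le[OF i y(1)] y(2) by simp
  also have "\<dots> \<le> Ck_norm k u" unfolding Ck_norm_def
    by (rule member_le_sum[of i "{..k}" ?S]) (use i nn in auto)
  finally show ?thesis .
qed

lemma Ck_norm_leI:
  assumes "\<And>i x. i \<le> k \<Longrightarrow> norm ((vderiv ^^ i) u x) \<le> B"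
  shows "Ck_norm k u \<le> real (Suc k) * B"
proof -
  have "Ck_norm k u \<le> (\<Sum>i\<le>k. B)"
    unfolding Ck_norm_def using assms by (intro sum_mono cSUP_least) auto
  then show ?thesis by simp
qed

text \<open>One linear combination covers differences (\<open>a = b = 1\<close>) and multiples
  (\<open>b = 0\<close>) in a single induction.\<close>

lemma vderiv_diff_scale:
  assumes "circle_Ck k u" "circle_Ck k w"
  shows "i \<le> k \<Longrightarrow> (vderiv ^^ i) (\<lambda>x. a *\<^sub>R u x - b *\<^sub>R w x) = (\<lambda>x. a *\<^sub>R (vderiv ^^ i) u x - b *\<^sub>R (vderiv ^^ i) w x)"
proof (induction i)
  case (Suc i)
  then have i: "i < k" by simp
  have "((\<lambda>x. a *\<^sub>R (vderiv ^^ i) u x - b *\<^sub>R (vderiv ^^ i) w x) has_vector_derivative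
      a *\<^sub>R (vderiv ^^ Suc i) u x - b *\<^sub>R (vderiv ^^ Suc i) w x) (at x)" for x
    by (intro has_vector_derivative_diff bounded_linear.has_vector_derivative[OF bounded_linear_scaleR_right]
        circle_Ck_deriv[OF assms(1) i] circle_Ck_deriv[OF assms(2) i])
  then show ?case
    unfolding vderiv_funpow_Suc[of i "\<lambda>x. a *\<^sub>R u x - b *\<^sub>R w x"] Suc.IH[OF less_imp_le[OF i]] vderiv_def[of "\<lambda>x. a *\<^sub>R _ x - _ x"]
    by (auto intro!: vector_derivative_at)
qed simp

lemma circle_Ck_diff_scale:
  assumes u: "circle_Ck k u" and w: "circle_Ck k w"
  shows "circle_Ck k (\<lambda>x. a *\<^sub>R u x - b *\<^sub>R w x)"
  unfolding circle_Ck_def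
proof (intro conjI allI impI)
  show "a *\<^sub>R u (x + 2 * pi) - b *\<^sub>R w (x + 2 * pi) = a *\<^sub>R u x - b *\<^sub>R w x" for x
    using circle_Ck_periodic[OF u, of 0 x] circle_Ck_periodic[OF w, of 0 x] by simp
  show "(vderiv ^^ i) (\<lambda>x. a *\<^sub>R u x - b *\<^sub>R w x) differentiable (at x)" if "i < k" for i x
    unfolding vderiv_diff_scale[OF u w less_imp_le[OF that]]
    using u w that by (intro differentiable_diff differentiable_scaleR differentiable_const) (auto simp: circle_Ck_def)
  show "continuous_on UNIV ((vderiv ^^ k) (\<lambda>x. a *\<^sub>R u x - b *\<^sub>R w x))"
    unfolding vderiv_diff_scale[OF u w order_refl]
    by (intro continuous_intros circle_Ck_continuous[OF u] circle_Ck_continuous[OF w]) auto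
qed

lemma circle_Ck_diff: "circle_Ck k u \<Longrightarrow> circle_Ck k w \<Longrightarrow> circle_Ck k (\<lambda>x. u x - w x)"
  and vderiv_diff: "circle_Ck k u \<Longrightarrow> circle_Ck k w \<Longrightarrow> i \<le> k \<Longrightarrow>
    (vderiv ^^ i) (\<lambda>x. u x - w x) x = (vderiv ^^ i) u x - (vderiv ^^ i) w x"
  and circle_Ck_scale: "circle_Ck k u \<Longrightarrow> circle_Ck k (\<lambda>x. a *\<^sub>R u x)"
  and vderiv_scale: "circle_Ck k u \<Longrightarrow> i \<le> k \<Longrightarrow> (vderiv ^^ i) (\<lambda>x. a *\<^sub>R u x) x = a *\<^sub>R (vderiv ^^ i) u x"
  using circle_Ck_diff_scale[of k u w 1 1] vderiv_diff_scale[of k u w i 1 1]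
    circle_Ck_diff_scale[of k u u a 0] vderiv_diff_scale[of k u u i a 0] by simp_all

text \<open>The real supremum in \<open>C1_Ck_norm\<close> bounds its members only if the set is
  bounded above, while \<open>C1_Ck\<close> provides limits at single times. Local bounds become a
  global one by compactness of \<open>{0..T}\<close>.\<close>

lemma locally_bounded_compact:
  fixes g :: "real \<Rightarrow> real"
  assumes loc: "\<And>t. t \<in> {0..T} \<Longrightarrow> \<exists>B. eventually (\<lambda>s. g s \<le> B) (at t within {0..T})"
  shows "bdd_above (g ` {0..T})"
proof -
  have "\<exists>U B. open U \<and> t \<in> U \<and> (\<forall>s\<in>U \<inter> {0..T}. g s \<le> B)" if t: "t \<in> {0..T}" for t
  proof -
    obtain B where "eventually (\<lambda>s. g s \<le> B) (at t within {0..T})" using loc[OF t] by blast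
    then obtain U where U: "open U" "t \<in> U" "\<And>s. s \<in> U \<Longrightarrow> s \<noteq> t \<Longrightarrow> s \<in> {0..T} \<Longrightarrow> g s \<le> B"
      unfolding eventually_at_topological by blast
    \<comment> \<open>The filter leaves out \<open>t\<close> itself; the maximum restores
      it.\<close>
    then have "\<forall>s\<in>U \<inter> {0..T}. g s \<le> max B (g t)" by (metis IntE max.coboundedI1 max.cobounded2)
    then show ?thesis using U by blast
  qed
  then obtain U B where U: "\<And>t. t \<in> {0..T} \<Longrightarrow> open (U t)" "\<And>t. t \<in> {0..T} \<Longrightarrow> t \<in> U t"
    "\<And>t s. t \<in> {0..T} \<Longrightarrow> s \<in> U t \<Longrightarrow> s \<in> {0..T} \<Longrightarrow> g s \<le> B t" by (metis IntI)
  have "{0..T} \<subseteq> (\<Union>t\<in>{0..T}. U t)" using U(2) by blast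
  then obtain D where D: "D \<subseteq> {0..T}" "finite D" "{0..T} \<subseteq> (\<Union>t\<in>D. U t)"
    using compactE_image[OF compact_Icc, of "{0..T}" U 0 T] U(1) by metis
  have "g s \<le> (\<Sum>t\<in>D. \<bar>B t\<bar>)" if s: "s \<in> {0..T}" for s
  proof -
    obtain t where t: "t \<in> D" "s \<in> U t" using D s by blast
    then have "g s \<le> \<bar>B t\<bar>" using U(3)[of t s] D s by (smt (verit) subsetD)
    also have "\<dots> \<le> (\<Sum>t\<in>D. \<bar>B t\<bar>)" using t D by (intro member_le_sum) auto
    finally show ?thesis .
  qed
  then show ?thesis by (rule bdd_aboveI2)
qed

section \<open>Curves that are continuously differentiable in time with values in C^k\<close>

context
  fixes T :: real and k :: nat and X :: "real \<Rightarrow> real \<Rightarrow> real^2"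
  assumes T: "0 < T" and X: "C1_Ck T k X"
begin

lemma C1_Ck_D:
  assumes "t \<in> {0..T}"
  shows "circle_Ck k (\<lambda>\<xi>. X \<xi> t)" "circle_Ck k (\<lambda>\<xi>. time_deriv T X \<xi> t)"
    "((\<lambda>s. Ck_norm k (\<lambda>\<xi>. (X \<xi> s - X \<xi> t) /\<^sub>R (s - t) - time_deriv T X \<xi> t)) \<longlongrightarrow> 0) (at t within {0..T})"
    "((\<lambda>s. Ck_norm k (\<lambda>\<xi>. time_deriv T X \<xi> s - time_deriv T X \<xi> t)) \<longlongrightarrow> 0) (at t within {0..T})"
  using X assms unfolding C1_Ck_def by blast+

lemma quotient_Ck:
  assumes "t \<in> {0..T}" "s \<in> {0..T}"
  shows "circle_Ck k (\<lambda>\<xi>. (X \<xi> s - X \<xi> t) /\<^sub>R (s - t) - time_deriv T X \<xi> t)"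
  by (intro circle_Ck_diff circle_Ck_scale C1_Ck_D assms)

text \<open>\<open>time_deriv\<close> is a derivative by choice, so its existence has to be derived:
  the \<open>Ck_norm\<close> of the error of the difference quotient dominates this error at each
  point.\<close>

lemma X_has_time_deriv:
  assumes t: "t \<in> {0..T}"
  shows "((\<lambda>s. X \<xi> s) has_vector_derivative time_deriv T X \<xi> t) (at t within {0..T})"
proof -
  let ?V = "time_deriv T X \<xi> t" and ?q = "\<lambda>s. Ck_norm k (\<lambda>\<xi>. (X \<xi> s - X \<xi> t) /\<^sub>R (s - t) - time_deriv T X \<xi> t)"
  have "((\<lambda>s. norm ((X \<xi> s - X \<xi> t) - (s - t) *\<^sub>R ?V) / norm (s - t)) \<longlongrightarrow> 0) (at t within {0..T})"
  proof (rule tendsto_sandwich[OF _ _ tendsto_const C1_Ck_D(3)[OF t]])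
    show "\<forall>\<^sub>F s in at t within {0..T}. norm ((X \<xi> s - X \<xi> t) - (s - t) *\<^sub>R ?V) / norm (s - t) \<le> ?q s"
      unfolding eventually_at_topological
    proof (intro exI[of _ UNIV] conjI ballI impI)
      fix s assume s: "s \<in> {0..T}" "s \<noteq> t"
      have "(X \<xi> s - X \<xi> t) - (s - t) *\<^sub>R ?V = (s - t) *\<^sub>R ((X \<xi> s - X \<xi> t) /\<^sub>R (s - t) - ?V)"
        using s by (simp add: scaleR_diff_right[of "s - t" "_ /\<^sub>R _"])
      then have "norm ((X \<xi> s - X \<xi> t) - (s - t) *\<^sub>R ?V) / norm (s - t) = norm ((X \<xi> s - X \<xi> t) /\<^sub>R (s - t) - ?V)"
        using s by simp
      also have "\<dots> \<le> ?q s" using norm_le_Ck_norm[OF quotient_Ck[OF t s(1)], of 0 \<xi>] by simp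
      finally show "norm ((X \<xi> s - X \<xi> t) - (s - t) *\<^sub>R ?V) / norm (s - t) \<le> ?q s" .
    qed auto
  qed (auto simp: eventually_at_topological)
  then show ?thesis
    unfolding has_vector_derivative_def has_derivative_iff_norm by (simp add: bounded_linear_scaleR_left)
qed

lemma Ck_norm_bdd:
  "bdd_above ((\<lambda>t. Ck_norm k (\<lambda>\<xi>. X \<xi> t)) ` {0..T})"
  "bdd_above ((\<lambda>t. Ck_norm k (\<lambda>\<xi>. time_deriv T X \<xi> t)) ` {0..T})"
proof -
  \<comment> \<open>\<open>C1_Ck\<close> controls the difference quotient; solving it for the value
    at time \<open>s\<close> bounds \<open>X\<close> near \<open>t\<close> by the data at
    \<open>t\<close>.\<close>
  have recover: "a = b + r *\<^sub>R ((a - b) /\<^sub>R r - c + c)" if "r \<noteq> 0" for a b c :: "real^2" and r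
    using that by simp
  have ev_lt: "eventually (\<lambda>s. g s < 1 \<and> s \<in> {0..T} \<and> s \<noteq> t) (at t within {0..T})"
    if "(g \<longlongrightarrow> 0) (at t within {0..T})" for g :: "real \<Rightarrow> real" and t
    using order_tendstoD(2)[OF that, of 1] by (simp add: eventually_at_filter)
  show "bdd_above ((\<lambda>t. Ck_norm k (\<lambda>\<xi>. X \<xi> t)) ` {0..T})"
  proof (rule locally_bounded_compact)
    fix t assume t: "t \<in> {0..T}"
    let ?N = "Ck_norm k (\<lambda>\<xi>. X \<xi> t)" and ?V = "Ck_norm k (\<lambda>\<xi>. time_deriv T X \<xi> t)"
    have "\<forall>\<^sub>F s in at t within {0..T}. Ck_norm k (\<lambda>\<xi>. X \<xi> s) \<le> real (Suc k) * (?N + T * (1 + ?V))"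
      using ev_lt[OF C1_Ck_D(3)[OF t]]
    proof (rule eventually_mono, elim conjE)
      fix s
      let ?q = "\<lambda>\<xi>. (X \<xi> s - X \<xi> t) /\<^sub>R (s - t) - time_deriv T X \<xi> t"
      assume s: "Ck_norm k ?q < 1" "s \<in> {0..T}" "s \<noteq> t"
      show "Ck_norm k (\<lambda>\<xi>. X \<xi> s) \<le> real (Suc k) * (?N + T * (1 + ?V))"
      proof (rule Ck_norm_leI)
        fix i x assume i: "i \<le> k"
        let ?d = "\<lambda>u. (vderiv ^^ i) u x"
        note a = C1_Ck_D(1)[OF s(2)] and b = C1_Ck_D(1)[OF t] and c = C1_Ck_D(2)[OF t]
        have dq: "?d ?q = (?d (\<lambda>\<xi>. X \<xi> s) - ?d (\<lambda>\<xi>. X \<xi> t)) /\<^sub>R (s - t) - ?d (\<lambda>\<xi>. time_deriv T X \<xi> t)"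
          unfolding vderiv_diff[OF circle_Ck_scale[OF circle_Ck_diff[OF a b]] c i]
            vderiv_scale[OF circle_Ck_diff[OF a b] i] vderiv_diff[OF a b i] ..
        have eq: "?d (\<lambda>\<xi>. X \<xi> s) = ?d (\<lambda>\<xi>. X \<xi> t) + (s - t) *\<^sub>R (?d ?q + ?d (\<lambda>\<xi>. time_deriv T X \<xi> t))"
          unfolding dq by (rule recover) (use s(3) in simp)
        show "norm (?d (\<lambda>\<xi>. X \<xi> s)) \<le> ?N + T * (1 + ?V)"
          unfolding eq
        proof (intro norm_triangle_mono norm_le_Ck_norm C1_Ck_D t i)
          have "norm (?d ?q + ?d (\<lambda>\<xi>. time_deriv T X \<xi> t)) \<le> 1 + ?V"
            using norm_le_Ck_norm[OF quotient_Ck[OF t s(2)] i, of x] s(1)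
            by (intro norm_triangle_mono norm_le_Ck_norm C1_Ck_D t i) simp
          then show "norm ((s - t) *\<^sub>R (?d ?q + ?d (\<lambda>\<xi>. time_deriv T X \<xi> t))) \<le> T * (1 + ?V)"
            unfolding norm_scaleR using s(2) t by (intro mult_mono) auto
        qed
      qed
    qed
    then show "\<exists>B. \<forall>\<^sub>F s in at t within {0..T}. Ck_norm k (\<lambda>\<xi>. X \<xi> s) \<le> B" by blast
  qed
  show "bdd_above ((\<lambda>t. Ck_norm k (\<lambda>\<xi>. time_deriv T X \<xi> t)) ` {0..T})"
  proof (rule locally_bounded_compact)
    fix t assume t: "t \<in> {0..T}"
    let ?V = "Ck_norm k (\<lambda>\<xi>. time_deriv T X \<xi> t)"
    have "\<forall>\<^sub>F s in at t within {0..T}. Ck_norm k (\<lambda>\<xi>. time_deriv T X \<xi> s) \<le> real (Suc k) * (?V + 1)"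
      using ev_lt[OF C1_Ck_D(4)[OF t]]
    proof (rule eventually_mono, elim conjE)
      fix s
      let ?q = "\<lambda>\<xi>. time_deriv T X \<xi> s - time_deriv T X \<xi> t"
      assume s: "Ck_norm k ?q < 1" "s \<in> {0..T}" "s \<noteq> t"
      have q: "circle_Ck k ?q" by (intro circle_Ck_diff C1_Ck_D t s)
      show "Ck_norm k (\<lambda>\<xi>. time_deriv T X \<xi> s) \<le> real (Suc k) * (?V + 1)"
      proof (rule Ck_norm_leI)
        fix i x assume i: "i \<le> k"
        let ?d = "\<lambda>u. (vderiv ^^ i) u x"
        have eq: "?d (\<lambda>\<xi>. time_deriv T X \<xi> s) = ?d (\<lambda>\<xi>. time_deriv T X \<xi> t) + ?d ?q"
          unfolding vderiv_diff[OF C1_Ck_D(2)[OF s(2)] C1_Ck_D(2)[OF t] i] by simp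
        show "norm (?d (\<lambda>\<xi>. time_deriv T X \<xi> s)) \<le> ?V + 1"
          unfolding eq
          using norm_le_Ck_norm[OF q i, of x] s(1)
          by (intro norm_triangle_mono norm_le_Ck_norm C1_Ck_D t i) simp
      qed
    qed
    then show "\<exists>B. \<forall>\<^sub>F s in at t within {0..T}. Ck_norm k (\<lambda>\<xi>. time_deriv T X \<xi> s) \<le> B" by blast
  qed
qed

lemma norm_le_C1_Ck_norm:
  assumes t: "t \<in> {0..T}" and i: "i \<le> k"
  shows "norm ((vderiv ^^ i) (\<lambda>\<xi>. X \<xi> t) x) \<le> C1_Ck_norm T k X"
    and "norm ((vderiv ^^ i) (\<lambda>\<xi>. time_deriv T X \<xi> t) x) \<le> C1_Ck_norm T k X"
proof -
  note 1 = norm_le_Ck_norm[OF C1_Ck_D(1)[OF t] i, of x]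
  note 2 = norm_le_Ck_norm[OF C1_Ck_D(2)[OF t] i, of x]
  note 3 = cSUP_upper[OF t Ck_norm_bdd(1)] cSUP_upper[OF t Ck_norm_bdd(2)]
  have "0 \<le> norm ((vderiv ^^ i) (\<lambda>\<xi>. X \<xi> t) x)" "0 \<le> norm ((vderiv ^^ i) (\<lambda>\<xi>. time_deriv T X \<xi> t) x)" by simp_all
  with 1 2 3 show "norm ((vderiv ^^ i) (\<lambda>\<xi>. X \<xi> t) x) \<le> C1_Ck_norm T k X"
    "norm ((vderiv ^^ i) (\<lambda>\<xi>. time_deriv T X \<xi> t) x) \<le> C1_Ck_norm T k X"
    unfolding C1_Ck_norm_def by linarith+
qed

end

section \<open>Convergence\<close>

text \<open>The perimeter lies between \<open>2 * pi * C1\<close> and \<open>2 * pi * C2\<close>, so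
  the Lipschitz bound controls \<open>f\<close> there by its value at \<open>2 * pi * C1\<close>.
  The constant thus depends on the given bounds and on \<open>f\<close>, not on the individual
  curve.\<close>

lemma solution_consistent:
  fixes X :: "real \<Rightarrow> real \<Rightarrow> real^2"
  assumes T: "0 < T" and X: "C1_Ck T 4 X" and K: "C1_Ck_norm T 4 X \<le> M" and M: "1 \<le> M"
    and C: "0 < C1" "1 / M \<le> C1"
    and speed: "\<And>\<xi> t. t \<in> {0..T} \<Longrightarrow> C1 \<le> norm (space_deriv X \<xi> t) \<and> norm (space_deriv X \<xi> t) \<le> C2"
    and flow: "flow_solution f T X0 X"
    and lip: "\<And>a b. 0 < a \<Longrightarrow> 0 < b \<Longrightarrow> \<bar>f a - f b\<bar> \<le> \<Lambda> * \<bar>a - b\<bar>" and \<Lambda>: "0 \<le> \<Lambda>"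
    and N: "N > 0" and h: "44 * M ^ 4 * mesh N \<le> 1" and t: "t \<in> {0..T}"
  shows "consistent (1 / (4 * M)) (consistency_const M \<Lambda> (\<bar>f (2 * pi * C1)\<bar> + \<Lambda> * (2 * pi * (C2 - C1)))) f N
    (\<lambda>j. X (grid_pt N j) t) (\<lambda>j. time_deriv T X (grid_pt N j) t)"
proof -
  define u where "u = (\<lambda>\<xi>. X \<xi> t)"
  define v where "v = (\<lambda>\<xi>. time_deriv T X \<xi> t)"
  have uC: "circle_Ck 4 u" and vC: "circle_Ck 4 v" unfolding u_def v_def using C1_Ck_D[OF T X t] by auto
  note du = circle_Ck_deriv[OF uC] and dv = circle_Ck_deriv[OF vC]
  have bu: "norm ((vderiv ^^ i) u x) \<le> M" and bv: "norm ((vderiv ^^ i) v x) \<le> M" if "i \<le> 4" for i x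
    using norm_le_C1_Ck_norm[OF T X t that, of x] K unfolding u_def v_def by linarith+
  have u1: "space_deriv X \<xi> t = (vderiv ^^ 1) u \<xi>" for \<xi>
    by (simp add: space_deriv_def vderiv_def u_def)
  interpret smooth_curve u "(vderiv ^^ 1) u" "(vderiv ^^ 2) u" "(vderiv ^^ 3) u" "(vderiv ^^ 4) u"
      v "(vderiv ^^ 1) v" "(vderiv ^^ 2) v" "(vderiv ^^ 3) v" M
  proof
    show "1 / M \<le> norm ((vderiv ^^ 1) u x)" for x using speed[OF t, of x] C unfolding u1 by linarith
  qed (use du[of 0] du[of 1] du[of 2] du[of 3] dv[of 0] dv[of 1] dv[of 2] bu[of 1] bu[of 2] bu[of 3] bu[of 4] bv[of 0] bv[of 1] bv[of 2] bv[of 3] M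
      in \<open>simp_all add: eval_nat_numeral\<close>)
  have dn: "(n has_vector_derivative w x) (at x)" for x
    by (rule has_vector_derivative_sgn[OF smooth_curve.du(2)[OF smooth_curve_axioms] u1_nz(1)])
  have tan: "tangent X \<xi> t = n \<xi>" for \<xi> by (simp add: tangent_def u1 sgn_div_norm)
  have perim: "perimeter X t = integral {0..2 * pi} (\<lambda>s. norm ((vderiv ^^ 1) u s))"
    by (simp add: perimeter_def u1)
  have "space_deriv (tangent X) \<xi> t = w \<xi>" for \<xi>
    unfolding space_deriv_def tan using dn by (rule vector_derivative_at)
  then have fl: "v \<xi> = (1 / norm ((vderiv ^^ 1) u \<xi>)) *\<^sub>R w \<xi> - f (perimeter X t) *\<^sub>R perp (n \<xi>)" for \<xi>
    using flow t unfolding flow_solution_def v_def by (simp only: u1 tan)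
  have int: "(\<lambda>s. norm ((vderiv ^^ 1) u s)) integrable_on {0..2 * pi}"
    by (intro integrable_continuous_real continuous_intros circle_Ck_continuous[OF uC]) simp
  have P: "2 * pi * C1 \<le> perimeter X t" "perimeter X t \<le> 2 * pi * C2"
  proof -
    have "C1 \<le> norm ((vderiv ^^ 1) u s)" "norm ((vderiv ^^ 1) u s) \<le> C2" for s
      using speed[OF t, of s] unfolding u1 by auto
    then show "2 * pi * C1 \<le> perimeter X t" "perimeter X t \<le> 2 * pi * C2"
      using integral_le[OF integrable_const_ivl int, of C1] integral_le[OF int integrable_const_ivl, of C2]
      unfolding perim by simp_all
  qed
  have B: "\<bar>f (perimeter X t)\<bar> \<le> \<bar>f (2 * pi * C1)\<bar> + \<Lambda> * (2 * pi * (C2 - C1))"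
  proof -
    have C': "0 < 2 * pi * C1" using C by simp
    moreover have "0 < perimeter X t" using C' P by linarith
    ultimately have "\<bar>f (perimeter X t) - f (2 * pi * C1)\<bar> \<le> \<Lambda> * \<bar>perimeter X t - 2 * pi * C1\<bar>"
      by (intro lip)
    also have "\<dots> \<le> \<Lambda> * (2 * pi * (C2 - C1))"
      using P \<Lambda> by (intro mult_left_mono) (auto simp: algebra_simps)
    finally show ?thesis by linarith
  qed
  have "u (x + 2 * pi) = u x" "v (x + 2 * pi) = v x" for x
    using circle_Ck_periodic[OF uC, of 0 x] circle_Ck_periodic[OF vC, of 0 x] by simp_all
  from grid_consistent[OF N h this lip \<Lambda> perim B fl dn] show ?thesis by (simp only: u_def v_def)
qed

text \<open>\<open>h0\<close> and \<open>C\<close> are quantified before \<open>X\<close>, which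
  expresses that they depend only on the listed data. The supremum is taken in the extended reals,
  where an unbounded family cannot satisfy the estimate by convention.\<close>

theorem theorem3p2:
  fixes f :: "real \<Rightarrow> real" and T C1 C2 K1 :: real
  assumes "T > 0"
    and "\<exists>\<Lambda>. lipschitz_on \<Lambda> {0<..} f"
    and "0 < C1" and "C1 < C2"
  shows "\<exists>h0>0. \<exists>C. \<forall>(X :: real \<Rightarrow> real \<Rightarrow> real^2) (X0 :: real \<Rightarrow> real^2).
     C1_Ck T 4 X \<and> C1_Ck_norm T 4 X = K1 \<and>
     (\<forall>\<xi>. \<forall>t\<in>{0..T}. C1 \<le> norm (space_deriv X \<xi> t) \<and> norm (space_deriv X \<xi> t) \<le> C2) \<and>
     flow_solution f T X0 X
     \<longrightarrow> (\<forall>N\<ge>2. mesh N \<le> h0 \<longrightarrow>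
       (\<exists>x. scheme_solution f T X0 N x \<and>
            (\<forall>y. scheme_solution f T X0 N y \<longrightarrow> (\<forall>j. \<forall>t\<in>{0..T}. y j t = x j t)) \<and>
            (SUP t\<in>{0..T}. ereal (H1G_norm N (\<lambda>j. X (grid_pt N j) t - x j t)))
              \<le> ereal (C * (mesh N)\<^sup>2)))"
proof -
  obtain \<Lambda> where L: "lipschitz_on \<Lambda> {0<..} f" using assms(2) by blast
  have \<Lambda>: "0 \<le> \<Lambda>" using lipschitz_on_nonneg[OF L] .
  have lip: "\<bar>f a - f b\<bar> \<le> \<Lambda> * \<bar>a - b\<bar>" if "0 < a" "0 < b" for a b
    using lipschitz_onD[OF L, of a b] that by (simp add: dist_real_def)
  define M where "M = max 1 (max K1 (1 / C1))"
  have M: "1 \<le> M" "K1 \<le> M" "1 / C1 \<le> M" by (simp_all add: M_def)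
  have MC: "1 / M \<le> C1" using M assms(3) by (simp add: field_simps)
  define B where "B = \<bar>f (2 * pi * C1)\<bar> + \<Lambda> * (2 * pi * (C2 - C1))"
  have B: "0 \<le> B" unfolding B_def using \<Lambda> assms by simp
  define M' where "M' = consistency_const M \<Lambda> B"
  have M': "1 \<le> M'"
  proof -
    have D: "0 \<le> length_const M \<Lambda>" unfolding length_const_def using \<Lambda> M by simp
    have "0 \<le> residual_const M B (length_const M \<Lambda>)" unfolding residual_const_def using B D M by simp
    moreover have "0 \<le> 300 * M ^ 7" using M by simp
    ultimately show ?thesis unfolding M'_def consistency_const_def using M B D by linarith
  qed
  define c where "c = 1 / (4 * M)"
  have c: "0 < c" "c \<le> 1" unfolding c_def using M by (simp_all add: divide_le_eq)
  \<comment> \<open>The summand 1 keeps the denominator positive when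
    \<open>\<Lambda> = 0\<close>.\<close>
  define \<epsilon> where "\<epsilon> = min (c / 8) (1 / (1 + 7 * \<Lambda>))"
  have \<epsilon>: "0 < \<epsilon>" "\<epsilon> \<le> c / 8" "7 * \<Lambda> * \<epsilon> \<le> 1"
  proof -
    show "0 < \<epsilon>" "\<epsilon> \<le> c / 8" unfolding \<epsilon>_def using c \<Lambda> by (simp_all add: add_pos_nonneg)
    have "7 * \<Lambda> * \<epsilon> \<le> 7 * \<Lambda> * (1 / (1 + 7 * \<Lambda>))" unfolding \<epsilon>_def using \<Lambda> by (intro mult_left_mono) auto
    also have "\<dots> \<le> 1" using \<Lambda> by (simp add: divide_le_eq)
    finally show "7 * \<Lambda> * \<epsilon> \<le> 1" .
  qed
  define C where "C = 7 * rate_const c M' * (3 + 8 / c + 4 * pi\<^sup>2 * \<Lambda>\<^sup>2 + 2 * pi)"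
  define G where "G = 8 * M' * exp (C * T)"
  have G: "0 < G" unfolding G_def using M' by simp
  \<comment> \<open>The first bound is the resolution condition under which consistency was shown,
    the second the condition \<open>small\<close>; the factor 2 makes the latter strict.\<close>
  define h0 where "h0 = min (1 / (44 * M ^ 4)) (\<epsilon>\<^sup>2 / (2 * G))"
  have "0 < h0" unfolding h0_def using M \<epsilon> G by simp
  have main: "\<exists>x. scheme_solution f T X0 N x \<and>
      (\<forall>y. scheme_solution f T X0 N y \<longrightarrow> (\<forall>j. \<forall>t\<in>{0..T}. y j t = x j t)) \<and>
      (SUP t\<in>{0..T}. ereal (H1G_norm N (\<lambda>j. X (grid_pt N j) t - x j t)))
        \<le> ereal (sqrt ((1 + 8 * M') * exp (C * T)) * (mesh N)\<^sup>2)"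
    if X: "C1_Ck T 4 X" "C1_Ck_norm T 4 X = K1"
      "\<forall>\<xi>. \<forall>t\<in>{0..T}. C1 \<le> norm (space_deriv X \<xi> t) \<and> norm (space_deriv X \<xi> t) \<le> C2"
      "flow_solution f T X0 X" and N: "2 \<le> N" and hN: "mesh N \<le> h0" for X X0 N
  proof -
    have N0: "N > 0" using N by simp
    have M4: "1 \<le> M ^ 4" using M by (simp add: one_le_power)
    have hM: "44 * M ^ 4 * mesh N \<le> 1"
    proof -
      have "mesh N \<le> 1 / (44 * M ^ 4)" using hN by (simp add: h0_def)
      moreover have "0 < 44 * M ^ 4" using M4 by linarith
      ultimately show ?thesis by (simp only: pos_le_divide_eq mult.commute[of "mesh N"])
    qed
    have h1: "mesh N \<le> 1"
      using mult_right_mono[OF M4, of "mesh N"] mesh_pos[OF N0] hM by linarith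
    have small: "8 * M' * exp (C * T) * mesh N < \<epsilon>\<^sup>2"
    proof -
      have "mesh N \<le> \<epsilon>\<^sup>2 / (2 * G)" using hN by (simp add: h0_def)
      then have "G * mesh N \<le> G * (\<epsilon>\<^sup>2 / (2 * G))" using G by (intro mult_left_mono) auto
      also have "\<dots> = \<epsilon>\<^sup>2 / 2" using G by simp
      also have "\<dots> < \<epsilon>\<^sup>2" using \<epsilon> by simp
      finally show ?thesis by (simp add: G_def)
    qed
    interpret moving_grid f N c M' \<Lambda> \<epsilon> C T "\<lambda>j t. X (grid_pt N j) t" "\<lambda>j t. time_deriv T X (grid_pt N j) t"
    proof
      show "consistent c M' f N (\<lambda>j. X (grid_pt N j) t) (\<lambda>j. time_deriv T X (grid_pt N j) t)"
        if "t \<in> {0..T}" for t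
        unfolding c_def M'_def B_def
        by (rule solution_consistent[OF assms(1) X(1) _ M(1) assms(3) MC _ X(4) lip \<Lambda> N0 hM that])
          (use X(2,3) M in auto)
      show "(X (grid_pt N j) has_vector_derivative time_deriv T X (grid_pt N j) t) (at t within {0..T})"
        if "t \<in> {0..T}" for j t
        by (rule X_has_time_deriv[OF assms(1) X(1) that])
    qed (use N0 assms(1) lip c M' \<Lambda> h1 \<epsilon> small C_def in auto)
    have "X (grid_pt N j) 0 = X0 (grid_pt N j)" for j using X(4) by (simp add: flow_solution_def)
    note conv = scheme_converges[of X0, OF this]
    have sup: "(SUP t\<in>{0..T}. ereal (g t)) \<le> ereal b" if "\<forall>t\<in>{0..T}. g t \<le> b" for g b
      using that by (intro SUP_least) simp
    show ?thesis
      by (rule exE[OF conv], elim conjE) (intro exI conjI sup, assumption+)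
  qed
  show ?thesis
  proof (rule exI[of _ h0], rule conjI[OF \<open>0 < h0\<close>], rule exI[of _ "sqrt ((1 + 8 * M') * exp (C * T))"],
      intro allI impI, elim conjE)
  qed (rule main)
qed

end
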